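(* Let $n,N\in\mathbb N_+$ and consider the leader-follower multi-agent system $\dot x_i=Ax_i+Bu_i$, $i=0,\dots,N$, $u_0=0$, with communication weights $w_{ij}$, as described in the context. Let $\lambda>0$, $K_{lin}=\eta_1^\top(A+\lambda I_n)^n$, $h_k=-\eta_1^\top(A+\lambda I_n)^{k-1}$ for $k=1,\dots,n$, let $H\in\mathbb R^{n\times n}$ be the matrix with rows $h_1,\dots,h_n$, and let $$\Omega=\{e\in\mathbb R^{Nn}:(I_N\otimes H)e\ge0\}\subset\Sigma=\{e\in\mathbb R^{Nn}:(I_N\otimes\eta_1^\top)e\le0\}.$$ Let $\mu\in[-1,0)$, $G_{\mathbf d}=\mathrm{diag}\{1-\mu(n-k)\}_{k=1}^n$, and let $P\in\mathbb R^{n\times n}$ be a solution of the linear matrix inequalities $$P\succ0,\qquad PG_{\mathbf d}+G_{\mathbf d}P\succ0,\qquad P(A-BK_{lin})+(A-BK_{lin})^\top P\prec0 .$$ Let $\mathbf d(s)=\exp(sG_{\mathbf d})$, $s\in\mathbb R$, and let $\|\cdot\|_{\mathbf d}$ be the canonical homogeneous norm induced by $\|x\|_P=\sqrt{x^\top Px}$. Let the transmitted vectors $v_i\in\mathbb R^n$ be defined by $$v_0=\mathbf 0_n,\qquad v_i=\frac{1}{\sum_{j=0}^N w_{ij}}\sum_{j=0}^N w_{ij}\,(x_i-x_j+v_j),\quad i=1,\dots,N,$$ and let the control protocol be $$u_i=-\|v_i\|_{\mathbf d}^{1+\mu}K_{lin}\,\mathbf d(-\ln\|v_i\|_{\mathbf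 d})\,v_i,\quad i=1,\dots,N .$$ Then the closed-loop error equation $\dot e=f(e)$ is globally finite-time stable, and the homogeneous cone $$\Omega_{\mathbf d}=\{e\in\mathbb R^{Nn}:\mathrm{diag}\{H\mathbf d(-\ln\|e_i\|_{\mathbf d})\}_{i=1}^N\,e\ge0\}$$ is strictly positively invariant for this equation. Moreover $\Omega_{\mathbf d}\subset\Sigma$, and $e(0)\in\Omega_{\mathbf d}$ whenever $e(0)\in\Omega$ and $\|e_i(0)\|_P\le1$ for all $i=1,\dots,N$.
   Context: Agents: $x_i(t)\in\mathbb R^n$, $i=0,\dots,N$; agent $0$ is the leader with $u_0=0$, agents $1,\dots,N$ are followers with scalar inputs $u_i$. $A=\begin{pmatrix}\mathbf 0_{n-1}&I_{n-1}\\0&\mathbf 0_{n-1}^\top\end{pmatrix}\in\mathbb R^{n\times n}$, $B=\begin{pmatrix}\mathbf 0_{n-1}\\1\end{pmatrix}\in\mathbb R^n$ (integrator chain). $\eta_1$ is the first canonical basis vector of $\mathbb R^n$. Vector inequalities $\ge0$, $\le0$ are componentwise; $\otimes$ is the Kronecker product; $\succ0$ ($\prec0$) means symmetric positive (negative) definite; $\mathrm{diag}\{\cdot\}_{i=1}^N$ is block diagonal. Communication graph: a fixed directed graph on vertices $\{0,\dots,N\}$ with edge set $\mathcal E$; $(i,j)\in\mathcal E$ means that $j$ sends information to $i$; $w_{ij}=1$ if $(i,j)\in\mathcal E$ and $w_{ij}=0$ otherwise; no self-loops ($w_{ii}=0$). Vertex $0$ is the root: it has no incoming edges ($w_{0j}=0$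 for all $j$), and every vertex $1,\dots,N$ is the endpoint of at least one directed path starting at $0$. Consensus error: $e_i=x_i-x_0$, $e=(e_1^\top,\dots,e_N^\top)^\top\in\mathbb R^{Nn}$. The closed-loop error equation $\dot e=f(e)$ is the differential equation obtained from $\dot e_i=Ae_i+Bu_i$, $i=1,\dots,N$, by substituting the control protocol (the equations for the $v_i$ determine them uniquely). Canonical homogeneous norm: $\|\mathbf 0\|_{\mathbf d}=0$, and for $x\neq\mathbf 0$, $\|x\|_{\mathbf d}=\exp(s_x)$ where $s_x\in\mathbb R$ is such that $\|\mathbf d(-s_x)x\|_P=1$ (it is unique because $PG_{\mathbf d}+G_{\mathbf d}P\succ0$). The expression $\mathbf d(-\ln\|e_i\|_{\mathbf d})e_i$ is read as $\mathbf 0$ when $e_i=\mathbf 0$. For $\mu>-1$ the control at $v_i=\mathbf 0$ is defined by continuity ($u_i=0$); for $\mu=-1$ the control is discontinuous at $v_i=\mathbf 0$ and solutions of the closed-loop system are understood in the sense of Filippov. Globally finite-time stable: the origin is Lyapunov stable and there is a settling-time function $T:\mathbb R^{Nn}\to\mathbb R_{\ge0}$ such that $e(t)=\mathbf 0$ for all $t\ge T(e(0))$, for every $e(0)\in\mathbb R^{Nn}$. A set is strictly positively invariant for the error equation if $e(0)$ in the set implies $e(t)$ in the set for all $t\ge0$. A non-empty set $\mathcal C\subset\mathbb R^{Nn}$ is a homogeneous cone if $e\in\mathcal C$ implies $(I_N\otimes\mathbf d(s))e\in\mathcal C$ for all $s\in\mathbb R$. *)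

theory Defs
  imports "HOL-Analysis.Analysis"
begin

section \<open>Matrices\<close>

type_synonym 'n colvec = "(real, 'n) vec"
type_synonym 'n sqmat = "('n colvec, 'n) vec"
type_synonym ('n, 'N) stacked = "('n colvec, 'N) vec"

text \<open>On \<open>'n sqmat\<close> the class operations \<open>*\<close> and \<open>^\<close> act entrywise, so powers and the exponential
  with respect to the matrix product are introduced separately.\<close>

primrec matpow :: "'n::finite sqmat \<Rightarrow> nat \<Rightarrow> 'n sqmat" where
  "matpow M 0 = mat 1"
| "matpow M (Suc k) = M ** matpow M k"

definition mat_exp :: "'n::finite sqmat \<Rightarrow> 'n sqmat" where
  "mat_exp M = (\<Sum>k. matpow M k /\<^sub>R fact k)"

definition positive_definite :: "'n::finite sqmat \<Rightarrow> bool" where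
  "positive_definite M \<longleftrightarrow> transpose M = M \<and> (\<forall>x. x \<noteq> 0 \<longrightarrow> 0 < x \<bullet> (M *v x))"

definition negative_definite :: "'n::finite sqmat \<Rightarrow> bool" where
  "negative_definite M \<longleftrightarrow> transpose M = M \<and> (\<forall>x. x \<noteq> 0 \<longrightarrow> x \<bullet> (M *v x) < 0)"

definition pnorm :: "'n::finite sqmat \<Rightarrow> 'n colvec \<Rightarrow> real" where
  "pnorm P x = sqrt (x \<bullet> (P *v x))"

text \<open>A stacked vector in $R^{Nn}$ is represented as \<open>e :: ('n, 'N) stacked\<close> with blocks \<open>e $ i\<close>; its norm is
  the Euclidean one and its order is the componentwise one. A block diagonal matrix acts blockwise,
  and \<open>block_diag (\<lambda>_. M)\<close> is the action of the Kronecker product of the identity with \<open>M\<close>.\<close>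

definition block_diag ::
    "('N::finite \<Rightarrow> 'n::finite sqmat) \<Rightarrow> ('n, 'N) stacked \<Rightarrow> ('n, 'N) stacked" where
  "block_diag M e = (\<chi> i. M i *v (e $ i))"


section \<open>The integrator chain\<close>

text \<open>The dimension \<open>n\<close> is \<open>CARD('n)\<close>. The linear order on the index type identifies it with
  \<open>{1..n}\<close>; \<open>position i\<close> is the position of \<open>i\<close>.\<close>

definition position :: "'n::{finite,linorder} \<Rightarrow> nat" where
  "position i = card {j. j \<le> i}"

definition A_mat :: "'n::{finite,linorder} sqmat" where
  "A_mat = (\<chi> i j. if position j = position i + 1 then 1 else 0)"

definition B_vec :: "'n::{finite,linorder} colvec" where
  "B_vec = (\<chi> i. if position i = CARD('n) then 1 else 0)"

definition eta1 :: "'n::{finite,linorder} colvec" where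
  "eta1 = (\<chi> i. if position i = 1 then 1 else 0)"

text \<open>Row vectors are elements of \<open>'n colvec\<close> as well: \<open>x v* M\<close> is the row \<open>x\<^sup>T M\<close> and \<open>K \<bullet> x\<close> is the
  product of the row \<open>K\<close> with the column \<open>x\<close>.\<close>

definition K_lin :: "real \<Rightarrow> 'n::{finite,linorder} colvec" where
  "K_lin lam = eta1 v* matpow (A_mat + lam *\<^sub>R mat 1) CARD('n)"

definition BK_mat :: "real \<Rightarrow> 'n::{finite,linorder} sqmat" where
  "BK_mat lam = (\<chi> i j. (B_vec :: 'n colvec) $ i * (K_lin lam :: 'n colvec) $ j)"

definition h_row :: "real \<Rightarrow> nat \<Rightarrow> 'n::{finite,linorder} colvec" where
  "h_row lam k = - (eta1 v* matpow (A_mat + lam *\<^sub>R mat 1) (k - 1))"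

definition H_mat :: "real \<Rightarrow> 'n::{finite,linorder} sqmat" where
  "H_mat lam = (\<chi> i. h_row lam (position i))"

definition G_mat :: "real \<Rightarrow> 'n::{finite,linorder} sqmat" where
  "G_mat mu = (\<chi> i j. if i = j then 1 - mu * (real CARD('n) - real (position i)) else 0)"


section \<open>Dilation and canonical homogeneous norm\<close>

definition dil :: "real \<Rightarrow> real \<Rightarrow> 'n::{finite,linorder} sqmat" where
  "dil mu s = mat_exp (s *\<^sub>R G_mat mu)"

definition hnorm :: "real \<Rightarrow> 'n::{finite,linorder} sqmat \<Rightarrow> 'n colvec \<Rightarrow> real" where
  "hnorm mu P x = (if x = 0 then 0 else exp (THE s. pnorm P (dil mu (- s) *v x) = 1))"

definition homogeneous_cone :: "real \<Rightarrow> ('n::{finite,linorder}, 'N::finite) stacked set \<Rightarrow> bool" where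
  "homogeneous_cone mu C \<longleftrightarrow>
     C \<noteq> {} \<and> (\<forall>e\<in>C. \<forall>s. block_diag (\<lambda>_. dil mu s) e \<in> C)"

definition Omega_lin :: "real \<Rightarrow> ('n::{finite,linorder}, 'N::finite) stacked set" where
  "Omega_lin lam = {e. 0 \<le> block_diag (\<lambda>_. H_mat lam) e}"

definition Sigma_set :: "('n::{finite,linorder}, 'N::finite) stacked set" where
  "Sigma_set = {e. (\<chi> i. eta1 \<bullet> (e $ i)) \<le> 0}"

text \<open>For \<open>e $ i = 0\<close> the corresponding block of the product is \<open>0\<close>, whatever the value of \<open>ln 0\<close>.\<close>

definition Omega_hom ::
    "real \<Rightarrow> real \<Rightarrow> 'n::{finite,linorder} sqmat
      \<Rightarrow> ('n, 'N::finite) stacked set" where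
  "Omega_hom lam mu P =
     {e. 0 \<le> block_diag (\<lambda>i. H_mat lam ** dil mu (- ln (hnorm mu P (e $ i)))) e}"


section \<open>Communication and control protocol\<close>

text \<open>Agents are elements of \<open>'N option\<close>: \<open>None\<close> is the leader, \<open>Some i\<close> are the followers.
  \<open>(a, b) \<in> E\<close> means that \<open>b\<close> sends information to \<open>a\<close>, so a directed path from the leader
  to \<open>a\<close> is witnessed by \<open>(a, None) \<in> E\<^sup>+\<close>.\<close>

definition comm_graph :: "('N option \<times> 'N option) set \<Rightarrow> bool" where
  "comm_graph E \<longleftrightarrow>
     irrefl E \<and> (\<forall>b. (None, b) \<notin> E) \<and> (\<forall>i. (Some i, None) \<in> E\<^sup>+)"

definition weight :: "('a \<times> 'a) set \<Rightarrow> 'a \<Rightarrow> 'a \<Rightarrow> real" where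
  "weight E a b = (if (a, b) \<in> E then 1 else 0)"

definition transmitted ::
    "('N::finite option \<times> 'N option) set \<Rightarrow> ('N option \<Rightarrow> 'n::finite colvec)
      \<Rightarrow> ('N option \<Rightarrow> 'n colvec) \<Rightarrow> bool" where
  "transmitted E x v \<longleftrightarrow> v None = 0 \<and>
     (\<forall>i. v (Some i) =
        (1 / (\<Sum>b\<in>UNIV. weight E (Some i) b)) *\<^sub>R
        (\<Sum>b\<in>UNIV. weight E (Some i) b *\<^sub>R (x (Some i) - x b + v b)))"

text \<open>At \<open>v = 0\<close> the value is \<open>0\<close>, since the last factor vanishes.\<close>

definition control :: "real \<Rightarrow> real \<Rightarrow> 'n::{finite,linorder} sqmat \<Rightarrow> 'n colvec \<Rightarrow> real" where
  "control lam mu P v =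
     - (hnorm mu P v powr (1 + mu)) * (K_lin lam \<bullet> (dil mu (- ln (hnorm mu P v)) *v v))"

text \<open>The transmitted vectors depend on the agents only through the differences of their states:\<close>

lemma transmitted_translate: "transmitted E (\<lambda>a. x a + c) v \<longleftrightarrow> transmitted E x v"
  by (simp add: transmitted_def)

text \<open>Hence they may be computed from the state relative to the leader, in which the leader is at \<open>0\<close>
  and follower \<open>i\<close> is at \<open>e $ i\<close>.\<close>

definition rel_state :: "('n::finite, 'N::finite) stacked \<Rightarrow> 'N option \<Rightarrow> 'n colvec" where
  "rel_state e a = (case a of None \<Rightarrow> 0 | Some i \<Rightarrow> e $ i)"

definition error_field ::
    "('N::finite option \<times> 'N option) set \<Rightarrow> real \<Rightarrow> real \<Rightarrow> 'n::{finite,linorder} sqmat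
      \<Rightarrow> ('n::{finite,linorder}, 'N) stacked \<Rightarrow> ('n, 'N) stacked" where
  "error_field E lam mu P e =
     (let v = (THE v. transmitted E (rel_state e) v)
      in \<chi> i. A_mat *v (e $ i) + control lam mu P (v (Some i)) *\<^sub>R B_vec)"


section \<open>Solutions\<close>

definition classical_solution ::
    "('a::euclidean_space \<Rightarrow> 'a) \<Rightarrow> real set \<Rightarrow> (real \<Rightarrow> 'a) \<Rightarrow> bool" where
  "classical_solution f J e \<longleftrightarrow>
     (\<forall>t\<in>J. (e has_vector_derivative f (e t)) (at t within J))"

definition abs_continuous_on :: "real set \<Rightarrow> (real \<Rightarrow> 'a::euclidean_space) \<Rightarrow> bool" where
  "abs_continuous_on S g \<longleftrightarrow>
     (\<forall>\<epsilon>>0. \<exists>\<delta>>0. \<forall>D T. D division_of T \<and> T \<subseteq> S \<and> (\<Sum>k\<in>D. measure lborel k) < \<delta>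
        \<longrightarrow> (\<Sum>k\<in>D. norm (g (Sup k) - g (Inf k))) < \<epsilon>)"

definition filippov :: "('a::euclidean_space \<Rightarrow> 'a) \<Rightarrow> 'a \<Rightarrow> 'a set" where
  "filippov f x =
     (\<Inter>\<delta>\<in>{0<..}. \<Inter>Z\<in>null_sets lebesgue. closure (convex hull (f ` (ball x \<delta> - Z))))"

definition filippov_solution ::
    "('a::euclidean_space \<Rightarrow> 'a) \<Rightarrow> real set \<Rightarrow> (real \<Rightarrow> 'a) \<Rightarrow> bool" where
  "filippov_solution f J e \<longleftrightarrow>
     (\<forall>a b. {a..b} \<subseteq> J \<longrightarrow> abs_continuous_on {a..b} e) \<and>
     (AE t in lebesgue. t \<in> J \<longrightarrow>
        (\<exists>y\<in>filippov f (e t). (e has_vector_derivative y) (at t within J)))"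

definition error_solution ::
    "('N::finite option \<times> 'N option) set \<Rightarrow> real \<Rightarrow> real \<Rightarrow> 'n::{finite,linorder} sqmat
      \<Rightarrow> real set \<Rightarrow> (real \<Rightarrow> ('n::{finite,linorder}, 'N) stacked) \<Rightarrow> bool" where
  "error_solution E lam mu P =
     (if mu = -1 then filippov_solution (error_field E lam mu P)
      else classical_solution (error_field E lam mu P))"


section \<open>Stability and invariance\<close>

text \<open>The notions below refer to an equation through its solution predicate: \<open>S J e\<close> means that \<open>e\<close>
  is a solution on the time interval \<open>J\<close>. Solutions need not be unique, so the properties are required
  of all of them. The requirement that a solution starting at any given point exists for
  all \<open>t \<ge> 0\<close>, and that no solution ceases to exist in finite time, is implicit in speaking
  of \<open>e(t)\<close> for every \<open>e(0)\<close> and every \<open>t \<ge> 0\<close>; \<open>forward_complete\<close> makes it explicit.\<close>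

definition forward_complete :: "(real set \<Rightarrow> (real \<Rightarrow> 'a::euclidean_space) \<Rightarrow> bool) \<Rightarrow> bool" where
  "forward_complete S \<longleftrightarrow>
     (\<forall>e0. \<exists>e. S {0..} e \<and> e 0 = e0) \<and>
     (\<forall>\<tau>>0. \<forall>e. S {0..<\<tau>} e \<longrightarrow> (\<exists>e'. S {0..} e' \<and> (\<forall>t\<in>{0..<\<tau>}. e' t = e t)))"

definition lyapunov_stable :: "(real set \<Rightarrow> (real \<Rightarrow> 'a::euclidean_space) \<Rightarrow> bool) \<Rightarrow> bool" where
  "lyapunov_stable S \<longleftrightarrow>
     (\<forall>\<epsilon>>0. \<exists>\<delta>>0. \<forall>e. S {0..} e \<and> norm (e 0) < \<delta> \<longrightarrow> (\<forall>t\<ge>0. norm (e t) < \<epsilon>))"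

definition globally_finite_time_stable ::
    "(real set \<Rightarrow> (real \<Rightarrow> 'a::euclidean_space) \<Rightarrow> bool) \<Rightarrow> bool" where
  "globally_finite_time_stable S \<longleftrightarrow>
     forward_complete S \<and> lyapunov_stable S \<and>
     (\<exists>T::'a \<Rightarrow> real. (\<forall>x. 0 \<le> T x) \<and> (\<forall>e. S {0..} e \<longrightarrow> (\<forall>t\<ge>T (e 0). e t = 0)))"

definition strictly_positively_invariant ::
    "(real set \<Rightarrow> (real \<Rightarrow> 'a::euclidean_space) \<Rightarrow> bool) \<Rightarrow> 'a set \<Rightarrow> bool" where
  "strictly_positively_invariant S C \<longleftrightarrow>
     (\<forall>e. S {0..} e \<and> e 0 \<in> C \<longrightarrow> (\<forall>t\<ge>0. e t \<in> C))"

end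

theory Submission
  imports Defs
begin

text \<open>The equations for the transmitted vectors have the unique solution \<open>v\<^sub>i = e\<^sub>i\<close>, so the error
  equation decouples into copies of \<open>x' = \<phi>(x)\<close>. Write \<open>x = d(s) y\<close> with \<open>s\<close> the logarithm of the
  homogeneous norm of \<open>x\<close>, so that \<open>y\<close> lies on the unit sphere of \<open>P\<close>. With \<open>F = A - B K\<close>,
  homogeneity gives
    \<open>s' = - exp(\<mu> s) \<rho>(y)\<close> and \<open>y' = exp(\<mu> s) (F y + \<rho>(y) G y)\<close>
  where, by the matrix inequalities, \<open>\<rho>\<close> lies between two positive constants. Hence the power \<open>-\<mu>\<close> of
  the homogeneous norm decreases at least at a constant rate until it vanishes, which is finite-time
  stability. The quantities \<open>z\<^sub>k = h\<^sub>k y\<close> satisfy \<open>h\<^sub>k F = h\<^sub>k\<^sub>+\<^sub>1 - \<lambda> h\<^sub>k\<close>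
  (without the term \<open>h\<^sub>k\<^sub>+\<^sub>1\<close> if \<open>k = n\<close>) and
  \<open>h\<^sub>k G = g\<^sub>k h\<^sub>k - \<mu> (k - 1) \<lambda> h\<^sub>k\<^sub>-\<^sub>1\<close>, a system with nonnegative off-diagonal coefficients, so the
  orthant \<open>z \<ge> 0\<close> is invariant.

  Since \<open>\<phi>\<close> is continuous off the origin and odd, classical solutions (\<open>\<mu> > -1\<close>) and Filippov solutions
  (\<open>\<mu> = -1\<close>) are both exactly the curves whose blocks are continuous and solve \<open>x' = \<phi>(x)\<close> as long as
  they do not vanish. Existence comes from the equation for \<open>y\<close> in the time \<open>d\<tau> = exp(\<mu> s) dt\<close>, which is
  globally Lipschitz.\<close>

section \<open>Differential equations and absolute continuity\<close>

text \<open>The field \<open>phi\<close> cannot be Lipschitz near the origin, because solutions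
  arrive there in finite time, and it is discontinuous there for \<open>mu = -1\<close>. So nothing
  may rest on the velocity at a zero. What replaces uniqueness is monotonicity: the homogeneous norm
  never increases along a solution, hence the origin is absorbing, and a block that is nonzero at
  time \<open>t\<close> was nonzero at all earlier times. Invariance of the cone therefore only has
  to be argued where the polar coordinates \<open>(s, y)\<close> exist.

  The function \<rho> is forced by the constraint that \<open>y\<close> stays on the unit sphere.
  With \<open>qF y = y \<bullet> (P *v (F *v y))\<close> and \<open>qG\<close> likewise for
  \<open>G\<close>, the constraint reads \<open>qF y + rho y * qG y = 0\<close>; the Lyapunov
  inequality makes \<open>qF\<close> negative and the monotonicity inequality makes
  \<open>qG\<close> positive.

  The sign of \<open>mu\<close> enters in three ways: it makes the power \<open>- mu\<close> of the
  norm a decreasing quantity with bounded rate, it makes the coefficients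
  \<open>- mu * (k - 1) * lam\<close> nonnegative, and it makes all dilation weights at least
  1.\<close>

lemma has_vector_derivative_vecI:
  fixes f :: "real \<Rightarrow> 'a::euclidean_space ^ 'k"
  assumes "\<And>i. ((\<lambda>t. f t $ i) has_vector_derivative f' $ i) (at x within S)"
  shows "(f has_vector_derivative f') (at x within S)"
  unfolding has_vector_derivative_def
proof (subst has_derivative_componentwise_within, rule ballI)
  fix b :: "'a ^ 'k" assume "b \<in> Basis"
  then obtain i u where b: "b = axis i u" by (auto simp: Basis_vec_def)
  have "((\<lambda>t. f t $ i \<bullet> u) has_derivative (\<lambda>h. (h *\<^sub>R f' $ i) \<bullet> u)) (at x within S)"
    by (rule bounded_linear.has_derivative[OF bounded_linear_inner_left])
      (use assms[of i] in \<open>simp add: has_vector_derivative_def\<close>)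
  then show "((\<lambda>t. f t \<bullet> b) has_derivative (\<lambda>h. (h *\<^sub>R f') \<bullet> b)) (at x within S)"
    by (simp add: b inner_axis)
qed

section \<open>Global solutions of Lipschitz equations\<close>

lemma antiderivative_exists:
  fixes g :: "real \<Rightarrow> 'a::euclidean_space"
  assumes "continuous_on UNIV g"
  obtains G where "G 0 = 0" "\<And>t. (G has_vector_derivative g t) (at t)"
proof -
  have "isCont g x" for x
    using assms by (simp add: continuous_on_eq_continuous_at)
  then obtain F where F: "\<And>t. (F has_vector_derivative g t) (at t)"
    using einterval_antiderivative[of "-\<infinity>" "\<infinity>" g] by auto
  have "((\<lambda>t. F t - F 0) has_vector_derivative g t) (at t)" for t
    using F[of t] by (auto intro!: derivative_eq_intros)
  then show ?thesis by (intro that[of "\<lambda>t. F t - F 0"]) auto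
qed

text \<open>Mean value inequality against the comparison function \<open>M * exp (K * t)\<close>.
  For the Picard operator, \<open>M\<close> is half the distance of the two curves, and the
  exponential is undone by the weight.\<close>

lemma norm_antiderivative_diff_le:
  fixes G H :: "real \<Rightarrow> 'a::euclidean_space"
  assumes G: "G 0 = 0" "\<And>t. (G has_vector_derivative g t) (at t)"
    and H: "H 0 = 0" "\<And>t. (H has_vector_derivative h t) (at t)"
    and le: "\<And>t. 0 \<le> t \<Longrightarrow> norm (g t - h t) \<le> M * K * exp (K * t)"
    and "0 \<le> M" "0 \<le> (t::real)"
  shows "norm (G t - H t) \<le> M * exp (K * t)"
proof (cases "t = 0")
  case False
  define \<phi> where "\<phi> = (\<lambda>t. M * exp (K * t))"
  have "norm ((G t - H t) - (G 0 - H 0)) \<le> \<phi> t - \<phi> 0"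
  proof (rule differentiable_bound_general[where f = "\<lambda>t. G t - H t"
        and f' = "\<lambda>t. g t - h t" and \<phi>' = "\<lambda>t. M * K * exp (K * t)"])
    show "0 < t" using False \<open>0 \<le> t\<close> by simp
    show "continuous_on {0..t} (\<lambda>t. G t - H t)"
      by (intro continuous_on_diff continuous_at_imp_continuous_on ballI
          has_vector_derivative_continuous[OF G(2)] has_vector_derivative_continuous[OF H(2)])
    show "continuous_on {0..t} \<phi>" unfolding \<phi>_def by (intro continuous_intros)
    show "((\<lambda>t. G t - H t) has_vector_derivative g x - h x) (at x)" for x
      by (intro has_vector_derivative_diff G H)
    show "(\<phi> has_vector_derivative M * K * exp (K * x)) (at x)" for x
      unfolding \<phi>_def has_real_derivative_iff_has_vector_derivative[symmetric]
      by (auto intro!: derivative_eq_intros)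
    show "norm (g x - h x) \<le> M * K * exp (K * x)" if "0 < x" "x < t" for x
      using le that by simp
  qed
  also have "\<dots> \<le> M * exp (K * t)" using \<open>0 \<le> M\<close> by (simp add: \<phi>_def)
  finally show ?thesis using G H by simp
qed (use assms in auto)

text \<open>Weighting trajectories by \<open>exp (- K t)\<close> with \<open>K\<close> above the Lipschitz constant makes the
  Picard operator a contraction on the whole half-line at once.\<close>

theorem lipschitz_ode_solution:
  fixes f :: "'a::euclidean_space \<Rightarrow> 'a"
  assumes lip: "\<And>x y. norm (f x - f y) \<le> L * norm (x - y)" and f0: "f 0 = 0"
  obtains y where "y 0 = x0"
    and "\<And>t. 0 \<le> t \<Longrightarrow> (y has_vector_derivative f (y t)) (at t within {0..})"
proof -
  \<comment> \<open>Twice the Lipschitz constant gives contraction factor 1/2; the added 1 keeps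
    \<open>K\<close> positive.\<close>
  define K where "K = 2 * \<bar>L\<bar> + 1"
  have K: "K > 0" "2 * \<bar>L\<bar> \<le> K" unfolding K_def by auto
  have lip': "norm (f x - f y) \<le> (K/2) * norm (x - y)" for x y
  proof -
    have "L * norm (x - y) \<le> (K/2) * norm (x - y)"
      using K by (intro mult_right_mono) auto
    with lip[of x y] show ?thesis by linarith
  qed
  have contf: "continuous_on UNIV f"
  proof (rule lipschitz_on_continuous_on)
    show "(K/2)-lipschitz_on UNIV f"
      using lip' K by (auto simp: lipschitz_on_def dist_norm)
  qed
  \<comment> \<open>The unknown \<open>w\<close> is the weighted curve, so
    \<open>exp (K * r) *\<^sub>R w r\<close> is the curve itself.\<close>
  define g where "g = (\<lambda>(w :: real \<Rightarrow>\<^sub>C 'a) r. f (exp (K * r) *\<^sub>R w r))"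
  have contg: "continuous_on UNIV (g w)" for w
    unfolding g_def
    by (intro continuous_on_compose2[OF contf] continuous_intros) auto
  have "\<exists>G. G 0 = 0 \<and> (\<forall>t. (G has_vector_derivative g w t) (at t))" for w
    using antiderivative_exists[OF contg] by metis
  then obtain G where G0: "\<And>w. G w 0 = 0"
    and G: "\<And>w t. (G w has_vector_derivative g w t) (at t)" by metis
  have contG: "continuous_on UNIV (G w)" for w
    using G by (meson continuous_at_imp_continuous_on has_vector_derivative_continuous)
  \<comment> \<open>Bounded continuous functions live on the whole line here; \<open>max 0 t\<close>
    freezes negative times.\<close>
  define p where "p = (\<lambda>w t. exp (- K * max 0 t) *\<^sub>R (x0 + G w (max 0 t)))"
  have gdiff: "norm (g w t - g v t) \<le> (dist w v / 2) * K * exp (K * t)" for w v t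
  proof -
    have "norm (g w t - g v t) \<le> (K/2) * norm (exp (K * t) *\<^sub>R w t - exp (K * t) *\<^sub>R v t)"
      unfolding g_def by (rule lip')
    also have "\<dots> = (K/2) * (exp (K * t) * dist (w t) (v t))"
      by (simp add: scaleR_diff_right[symmetric] dist_norm)
    also have "\<dots> \<le> (K/2) * (exp (K * t) * dist w v)"
      using K dist_bounded[of w t v] by (intro mult_left_mono) auto
    finally show ?thesis by (simp add: algebra_simps)
  qed
  have Gdiff: "norm (G w t - G v t) \<le> (dist w v / 2) * exp (K * t)" if "0 \<le> t" for w v t
    by (rule norm_antiderivative_diff_le[OF G0 G G0 G gdiff]) (use that in auto)
  have pdiff: "dist (p w t) (p v t) \<le> dist w v / 2" for w v t
  proof -
    have "dist (p w t) (p v t) = exp (- K * max 0 t) * norm (G w (max 0 t) - G v (max 0 t))"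
      unfolding p_def dist_norm by (simp add: scaleR_diff_right[symmetric])
    also have "\<dots> \<le> exp (- K * max 0 t) * ((dist w v / 2) * exp (K * max 0 t))"
      by (intro mult_left_mono Gdiff) auto
    also have "\<dots> = dist w v / 2" by (simp add: exp_minus field_simps)
    finally show ?thesis .
  qed
  have pb: "p w \<in> bcontfun" for w
  proof (rule bcontfun_normI)
    show "continuous_on UNIV (p w)" unfolding p_def
      by (intro continuous_intros continuous_on_compose2[OF contG]) auto
    fix t
    \<comment> \<open>Since \<open>f 0 = 0\<close>, the image of the zero curve is explicitly
      bounded, and the contraction estimate carries the bound to every \<open>w\<close>.\<close>
    have g0: "g 0 = (\<lambda>_. 0)" by (auto simp: g_def f0)
    have "norm (G 0 (max 0 t)) \<le> 0 * exp (K * max 0 t)"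
      using norm_antiderivative_diff_le[OF G0[of 0] G, of "\<lambda>_. 0" "\<lambda>_. 0" 0 K "max 0 t"]
      by (simp add: g0)
    then have "norm (p 0 t) \<le> 1 * norm x0"
      unfolding p_def using K by (auto intro!: mult_left_le_one_le)
    moreover have "norm (p w t) \<le> norm (p 0 t) + dist (p w t) (p 0 t)"
      by (metis dist_norm norm_triangle_sub)
    ultimately show "norm (p w t) \<le> norm x0 + dist w 0 / 2" using pdiff[of w t 0] by linarith
  qed
  define \<Phi> where "\<Phi> = (\<lambda>w. Bcontfun (p w))"
  have \<Phi>: "apply_bcontfun (\<Phi> w) = p w" for w
    unfolding \<Phi>_def using pb by (simp add: Bcontfun_inverse)
  have "\<exists>!w. \<Phi> w = w"
  proof (rule banach_fix_type[where c = "1/2"])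
    have "dist (\<Phi> w) (\<Phi> v) \<le> dist w v / 2" for w v
      by (rule dist_bound) (unfold \<Phi>, rule pdiff)
    then show "\<forall>w v. dist (\<Phi> w) (\<Phi> v) \<le> 1/2 * dist w v" by simp
  qed auto
  then obtain w where w: "\<Phi> w = w" by blast
  define y where "y = (\<lambda>t. x0 + G w t)"
  have yw: "y t = exp (K * t) *\<^sub>R w t" if "0 \<le> t" for t
  proof -
    have "w t = p w t" using \<Phi>[of w] w by simp
    then show ?thesis using that by (simp add: p_def y_def exp_minus)
  qed
  show ?thesis
  proof
    show "y 0 = x0" by (simp add: y_def G0)
    fix t :: real assume "0 \<le> t"
    have "(y has_vector_derivative g w t) (at t within {0..})"
      unfolding y_def using has_vector_derivative_at_within[OF G[of w t]]
      by (auto intro!: derivative_eq_intros)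
    moreover have "g w t = f (y t)" using yw[OF \<open>0 \<le> t\<close>] by (simp add: g_def)
    ultimately show "(y has_vector_derivative f (y t)) (at t within {0..})" by simp
  qed
qed

text \<open>A fine tagged division splits by its tags. Intervals tagged at good points contribute at
  most \<eta> times their length. Those tagged in the exceptional null set lie in an open set of
  small measure, so absolute continuity controls their total variation. Each part is at most
  \<epsilon>/2.\<close>

theorem abs_continuous_derivative_zero_imp_constant:
  fixes g :: "real \<Rightarrow> 'a::euclidean_space"
  assumes ac: "abs_continuous_on {a..b} g" and "a \<le> b"
    and der: "AE t in lebesgue. t \<in> {a..b} \<longrightarrow> (g has_vector_derivative 0) (at t within {a..b})"
  shows "g b = g a"
proof -
  have "norm (g b - g a) \<le> \<epsilon>" if "\<epsilon> > 0" for \<epsilon>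
  proof -
    define \<eta> where "\<eta> = \<epsilon> / (2 * (b - a + 1))"
    have \<eta>: "\<eta> > 0" "\<eta> * (b - a) \<le> \<epsilon> / 2"
      using \<open>\<epsilon> > 0\<close> \<open>a \<le> b\<close> by (auto simp: \<eta>_def field_simps)
    obtain \<delta> where "\<delta> > 0" and \<delta>: "\<And>D T. D division_of T \<Longrightarrow> T \<subseteq> {a..b} \<Longrightarrow>
        (\<Sum>k\<in>D. measure lborel k) < \<delta> \<Longrightarrow> (\<Sum>k\<in>D. norm (g (Sup k) - g (Inf k))) < \<epsilon> / 2"
      using ac \<open>\<epsilon> > 0\<close> unfolding abs_continuous_on_def by (meson half_gt_zero)
    obtain E where E: "E \<in> null_sets lebesgue"
      "\<And>t. t \<notin> E \<Longrightarrow> t \<in> {a..b} \<Longrightarrow> (g has_vector_derivative 0) (at t within {a..b})"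
      using AE_E3[OF der] by auto
    obtain U where U: "open U" "E \<subseteq> U" "U - E \<in> lmeasurable" "emeasure lebesgue (U - E) < \<delta>"
      using sets_lebesgue_outer_open[of E \<delta>] E \<open>\<delta> > 0\<close> by auto
    have U': "U \<in> lmeasurable" "measure lebesgue U < \<delta>"
    proof -
      have "emeasure lebesgue U < \<delta>"
        using U E(1) by (simp add: emeasure_Diff_null_set)
      moreover show "U \<in> lmeasurable"
        using calculation U(1) by (intro fmeasurableI) (auto intro: less_trans)
      ultimately show "measure lebesgue U < \<delta>"
        using \<open>\<delta> > 0\<close> by (simp add: emeasure_eq_measure2 ennreal_less_iff)
    qed
    have "\<exists>r>0. \<forall>v\<in>{a..b}. \<bar>v - t\<bar> < r \<longrightarrow> norm (g v - g t) \<le> \<eta> * \<bar>v - t\<bar>"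
      if "t \<in> {a..b} - E" for t
    proof -
      have "(g has_derivative (\<lambda>h. h *\<^sub>R 0)) (at t within {a..b})"
        using that E(2) by (auto simp: has_vector_derivative_def)
      then show ?thesis
        using \<eta>(1) by (auto simp: has_derivative_within_alt)
    qed
    then obtain r where r: "\<And>t. t \<in> {a..b} - E \<Longrightarrow> r t > 0"
      and rb: "\<And>t v. t \<in> {a..b} - E \<Longrightarrow> v \<in> {a..b} \<Longrightarrow> \<bar>v - t\<bar> < r t
        \<Longrightarrow> norm (g v - g t) \<le> \<eta> * \<bar>v - t\<bar>" by metis
    \<comment> \<open>The gauge confines intervals tagged in \<open>E\<close> to the small open set
      \<open>U\<close> and the others to the ball on which the derivative estimate holds.\<close>
    define \<gamma> where "\<gamma> = (\<lambda>t. if t \<in> E then U else if t \<in> {a..b} then ball t (r t) else UNIV)"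
    have "gauge \<gamma>"
      using U r by (auto simp: gauge_def \<gamma>_def)
    then obtain p where p: "p tagged_division_of {a..b}" "\<gamma> fine p"
      using fine_division_exists_real by blast
    have pK: "\<exists>u v. K = {u..v} \<and> u \<le> v \<and> t \<in> {u..v} \<and> {u..v} \<subseteq> {a..b}"
      if "(t, K) \<in> p" for t K
      using tagged_division_ofD(2,3,4)[OF p(1) that] by fastforce
    define q where "q = {x \<in> p. fst x \<in> E}"
    define h where "h = (\<lambda>K. if K = {} then 0 else norm (g (Sup K) - g (Inf K)))"
    have "finite p" using p(1) by blast
    have good: "h K \<le> \<eta> * measure lborel K" if tK: "(t, K) \<in> p - q" for t K
    proof -
      obtain u v where uv: "K = {u..v}" "u \<le> v" "t \<in> {u..v}" "{u..v} \<subseteq> {a..b}"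
        using pK tK by blast
      have t: "t \<in> {a..b} - E" using tK uv by (auto simp: q_def)
      have "K \<subseteq> ball t (r t)"
        using fineD[OF p(2), of t K] tK t by (auto simp: \<gamma>_def)
      moreover have "u \<in> K" "v \<in> K" using uv by auto
      ultimately have "u \<in> ball t (r t)" "v \<in> ball t (r t)" by blast+
      then have "\<bar>u - t\<bar> < r t" "\<bar>v - t\<bar> < r t"
        by (auto simp: dist_real_def abs_minus_commute)
      then have "norm (g u - g t) \<le> \<eta> * \<bar>u - t\<bar>" "norm (g v - g t) \<le> \<eta> * \<bar>v - t\<bar>"
        using rb[OF t, of u] rb[OF t, of v] uv by auto
      moreover have "norm (g v - g u) \<le> norm (g v - g t) + norm (g u - g t)"
        by (metis norm_minus_commute norm_triangle_ineq diff_add_cancel add_diff_eq)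
      moreover have "\<eta> * \<bar>u - t\<bar> + \<eta> * \<bar>v - t\<bar> = \<eta> * (v - u)"
        using uv by (simp add: algebra_simps)
      ultimately show ?thesis using uv by (simp add: h_def)
    qed
    have "(\<Sum>(t,K)\<in>p - q. h K) \<le> (\<Sum>(t,K)\<in>p - q. \<eta> * measure lborel K)"
      using good by (intro sum_mono) auto
    also have "\<dots> \<le> (\<Sum>(t,K)\<in>p. \<eta> * measure lborel K)"
      using \<eta>(1) \<open>finite p\<close> by (intro sum_mono2) auto
    also have "\<dots> = \<eta> * (b - a)"
      using additive_content_tagged_division[of p a b] p(1) \<open>a \<le> b\<close>
      by (simp add: sum_distrib_left[symmetric] case_prod_unfold)
    finally have g1: "(\<Sum>(t,K)\<in>p - q. h K) \<le> \<epsilon> / 2" using \<eta>(2) by linarith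
    have q: "q tagged_partial_division_of {a..b}"
      using p(1) tagged_partial_division_subset[of p "{a..b}" q]
      by (auto simp: q_def tagged_division_of_def)
    define D where "D = snd ` q"
    have Ddiv: "D division_of \<Union>D"
      unfolding D_def by (metis q partial_division_of_tagged_division)
    have DU: "\<Union>D \<subseteq> U" "\<Union>D \<subseteq> {a..b}"
    proof -
      show "\<Union>D \<subseteq> U" using p(2) unfolding D_def q_def fine_def \<gamma>_def by fastforce
      show "\<Union>D \<subseteq> {a..b}" using pK unfolding D_def q_def by fastforce
    qed
    have "(\<Sum>K\<in>D. measure lborel K) = measure lebesgue (\<Union>D)"
    proof -
      have "measure lborel K = measure lebesgue K" if "K \<in> D" for K
        using division_ofD(4)[OF Ddiv that] by auto
      then show ?thesis using content_division[OF Ddiv] by simp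
    qed
    also have "\<dots> \<le> measure lebesgue U"
      using DU U' lmeasurable_division[OF Ddiv] by (intro measure_mono_fmeasurable) auto
    also have "\<dots> < \<delta>" by (rule U')
    finally have "(\<Sum>K\<in>D. norm (g (Sup K) - g (Inf K))) < \<epsilon> / 2"
      by (rule \<delta>[OF Ddiv DU(2)])
    moreover have "(\<Sum>K\<in>D. h K) = (\<Sum>K\<in>D. norm (g (Sup K) - g (Inf K)))"
      using division_ofD(3)[OF Ddiv] by (intro sum.cong) (auto simp: h_def)
    ultimately have "(\<Sum>K\<in>D. h K) < \<epsilon> / 2" by simp
    \<comment> \<open>Different tags can share an interval only if it is degenerate, where
      \<open>h\<close> vanishes, so dropping the tags does not change the sum.\<close>
    moreover have "(\<Sum>(t,K)\<in>q. h K) = (\<Sum>K\<in>D. h K)"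
      unfolding D_def
    proof (rule sum.over_tagged_division_lemma[OF tagged_partial_division_of_Union_self[OF q]])
      fix u v :: real assume "box u v = {}"
      then show "h (cbox u v) = 0"
        by (cases "u = v") (auto simp: h_def)
    qed
    moreover have "norm (g b - g a) \<le> (\<Sum>(t,K)\<in>p. h K)"
    proof -
      have "g b - g a = (\<Sum>(t,K)\<in>p. g (Sup K) - g (Inf K))"
        using additive_tagged_division_1[OF \<open>a \<le> b\<close> p(1), of g] by simp
      also have "norm \<dots> \<le> (\<Sum>(t,K)\<in>p. h K)"
        using pK by (intro sum_norm_le) (fastforce simp: h_def)
      finally show ?thesis .
    qed
    moreover have "(\<Sum>(t,K)\<in>p. h K) = (\<Sum>(t,K)\<in>p - q. h K) + (\<Sum>(t,K)\<in>q. h K)"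
      using \<open>finite p\<close> by (intro sum.subset_diff) (auto simp: q_def)
    ultimately show ?thesis using g1 by linarith
  qed
  then have "norm (g b - g a) \<le> 0" by (rule field_le_epsilon) simp
  then show ?thesis by simp
qed

text \<open>The fundamental theorem tolerates finitely many exceptional points, so \<open>x\<close>
  is an integral of the continuous \<open>g\<close> and inherits its derivative everywhere. This is
  what glues two solutions at a joint.\<close>

lemma has_vector_derivative_removable:
  fixes x g :: "real \<Rightarrow> 'a::euclidean_space"
  assumes "finite S" "a \<le> b" and "continuous_on {a..b} x" "continuous_on {a..b} g"
    and der: "\<And>t. t \<in> {a<..<b} - S \<Longrightarrow> (x has_vector_derivative g t) (at t)"
    and t: "t \<in> {a..b}"
  shows "(x has_vector_derivative g t) (at t within {a..b})"
proof -
  have "integral {a..u} g = x u - x a" if "u \<in> {a..b}" for u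
    by (rule integral_unique, rule fundamental_theorem_of_calculus_interior_strong[OF \<open>finite S\<close>])
      (use assms that in \<open>auto intro: continuous_on_subset\<close>)
  moreover have "((\<lambda>u. x a + integral {a..u} g) has_vector_derivative g t) (at t within {a..b})"
    using integral_has_vector_derivative[OF assms(4) t] by (auto intro!: derivative_eq_intros)
  ultimately show ?thesis
    by (rule_tac has_vector_derivative_transform[OF t]) auto
qed

section \<open>Differential inequalities on an interval\<close>

lemma nonincreasing_of_derivative_le:
  fixes W :: "real \<Rightarrow> real"
  assumes "a \<le> b" "continuous_on {a..b} W"
    and "\<And>t. a < t \<Longrightarrow> t < b \<Longrightarrow> \<exists>D. D \<le> c \<and> (W has_real_derivative D) (at t)"
  shows "W b \<le> W a + c * (b - a)"
proof -
  have "(\<lambda>t. W t - c * t) b \<le> (\<lambda>t. W t - c * t) a"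
  proof (rule DERIV_nonpos_imp_decreasing_open[OF \<open>a \<le> b\<close>])
    show "continuous_on {a..b} (\<lambda>t. W t - c * t)" by (intro continuous_intros assms)
    fix t assume "a < t" "t < b"
    then obtain D where "D \<le> c" "(W has_real_derivative D) (at t)" using assms(3) by blast
    then show "\<exists>y. ((\<lambda>t. W t - c * t) has_real_derivative y) (at t) \<and> y \<le> 0"
      by (intro exI[of _ "D - c"]) (auto intro!: derivative_eq_intros)
  qed
  then show ?thesis by (simp add: algebra_simps)
qed

text \<open>The derivative bound is only available off the zeros of \<open>W\<close>. If there is a
  zero, the bound holds after the last one, from which \<open>W\<close> starts at 0; otherwise it
  holds throughout.\<close>

lemma decay_to_zero:
  fixes W :: "real \<Rightarrow> real"
  assumes "a \<le> b" "continuous_on {a..b} W" "0 \<le> \<kappa>"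
    and nn: "\<And>t. t \<in> {a..b} \<Longrightarrow> 0 \<le> W t"
    and der: "\<And>t. a < t \<Longrightarrow> t < b \<Longrightarrow> W t \<noteq> 0 \<Longrightarrow> \<exists>D. D \<le> - \<kappa> \<and> (W has_real_derivative D) (at t)"
  shows "W b \<le> max 0 (W a - \<kappa> * (b - a))"
proof (cases "\<exists>t\<in>{a..b}. W t = 0")
  case True
  define Z where "Z = {t\<in>{a..b}. W t = 0}"
  have "closed Z" unfolding Z_def
    using continuous_closed_preimage_constant[OF assms(2), of 0] by auto
  then have "compact Z"
    unfolding Z_def by (metis (no_types, lifting) compact_eq_bounded_closed bounded_subset
        bounded_closed_interval mem_Collect_eq subsetI)
  moreover have "Z \<noteq> {}" using True by (auto simp: Z_def)
  ultimately obtain c where c: "c \<in> Z" "\<And>t. t \<in> Z \<Longrightarrow> t \<le> c"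
    using compact_attains_sup by metis
  have "W b \<le> W c + (-\<kappa>) * (b - c)"
  proof (rule nonincreasing_of_derivative_le)
    show "c \<le> b" using c by (auto simp: Z_def)
    show "continuous_on {c..b} W" using c by (auto simp: Z_def intro: continuous_on_subset[OF assms(2)])
    fix t assume "c < t" "t < b"
    then show "\<exists>D. D \<le> - \<kappa> \<and> (W has_real_derivative D) (at t)"
      using c(2)[of t] c(1) by (intro der) (force simp: Z_def)+
  qed
  moreover have "0 \<le> \<kappa> * (b - c)" using c(1) \<open>0 \<le> \<kappa>\<close> by (auto simp: Z_def)
  ultimately show ?thesis using c(1) by (auto simp: Z_def)
next
  case False
  have "W b \<le> W a + (-\<kappa>) * (b - a)"
    using False by (intro nonincreasing_of_derivative_le assms der) auto
  then show ?thesis by simp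
qed

lemma min_zero_power2_derivative:
  "((\<lambda>u::real. (min 0 u)\<^sup>2) has_real_derivative 2 * min 0 u) (at u)"
proof (cases u "0::real" rule: linorder_cases)
  case less
  have "((\<lambda>u::real. u\<^sup>2) has_real_derivative 2 * min 0 u) (at u)"
    using less by (auto intro!: derivative_eq_intros)
  then show ?thesis
    by (rule has_field_derivative_transform_within_open[where S="{..<0}"]) (use less in auto)
next
  case greater
  have "((\<lambda>u::real. 0) has_real_derivative 2 * min 0 u) (at u)"
    using greater by auto
  then show ?thesis
    by (rule has_field_derivative_transform_within_open[where S="{0<..}"]) (use greater in auto)
next
  case equal
  have "((\<lambda>h. ((min 0 h)\<^sup>2) / h) \<longlongrightarrow> (0::real)) (at 0)"
  proof (rule Lim_null_comparison[where g="\<lambda>h. \<bar>h\<bar>"])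
    have "norm ((min 0 h)\<^sup>2 / h) \<le> \<bar>h\<bar>" for h :: real
      by (cases "h < 0") (auto simp: min_def power2_eq_square)
    then show "\<forall>\<^sub>F h in at 0. norm ((min 0 h)\<^sup>2 / h) \<le> \<bar>h::real\<bar>" by simp
    show "((\<lambda>h. \<bar>h::real\<bar>) \<longlongrightarrow> 0) (at 0)" by (rule tendsto_eq_intros)+ auto
  qed
  then show ?thesis using equal by (simp add: has_field_derivative_iff)
qed

text \<open>A quantitative Nagumo condition for the positive orthant: the squared distance of \<open>z\<close> to the
  orthant satisfies a linear differential inequality.\<close>

theorem orthant_invariance:
  fixes z D :: "'k \<Rightarrow> real \<Rightarrow> real"
  assumes "finite I" "0 \<le> C"
    and der: "\<And>k t. k \<in> I \<Longrightarrow> t \<in> {0..T} \<Longrightarrow> (z k has_real_derivative D k t) (at t within {0..T})"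
    and low: "\<And>k t. k \<in> I \<Longrightarrow> t \<in> {0..T} \<Longrightarrow> z k t < 0 \<Longrightarrow> C * (\<Sum>l\<in>I. min 0 (z l t)) \<le> D k t"
    and init: "\<And>k. k \<in> I \<Longrightarrow> 0 \<le> z k 0"
    and "k \<in> I" "t \<in> {0..T}"
  shows "0 \<le> z k t"
proof -
  define W where "W = (\<lambda>t. \<Sum>k\<in>I. (min 0 (z k t))\<^sup>2)"
  define W' where "W' = (\<lambda>t. \<Sum>k\<in>I. 2 * min 0 (z k t) * D k t)"
  define c where "c = 2 * C * card I"
  have W: "(W has_real_derivative W' t) (at t within {0..T})" if "t \<in> {0..T}" for t
    unfolding W_def W'_def
  proof (rule DERIV_sum)
    fix k assume "k \<in> I"
    show "((\<lambda>t. (min 0 (z k t))\<^sup>2) has_real_derivative 2 * min 0 (z k t) * D k t) (at t within {0..T})"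
      using DERIV_chain2[OF min_zero_power2_derivative der[OF \<open>k \<in> I\<close> that]] by simp
  qed
  have W': "W' t \<le> c * W t" if "t \<in> {0..T}" for t
  proof -
    \<comment> \<open>Only negative coordinates contribute, so the lower bound on \<open>D\<close>
      is needed only there; the negative factor turns it into an upper bound.\<close>
    have "2 * min 0 (z k t) * D k t \<le> 2 * min 0 (z k t) * (C * (\<Sum>l\<in>I. min 0 (z l t)))"
      if "k \<in> I" for k
      using low[OF that \<open>t \<in> {0..T}\<close>] by (cases "z k t < 0") (auto intro: mult_left_mono_neg)
    then have "W' t \<le> (\<Sum>k\<in>I. 2 * min 0 (z k t) * (C * (\<Sum>l\<in>I. min 0 (z l t))))"
      unfolding W'_def by (intro sum_mono)
    also have "\<dots> = 2 * C * (\<Sum>k\<in>I. min 0 (z k t))\<^sup>2"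
      by (simp add: sum_distrib_right[symmetric] sum_distrib_left[symmetric] power2_eq_square)
    also have "\<dots> \<le> 2 * C * (card I * W t)"
      using sum_squared_le_sum_of_squares[of "\<lambda>k. min 0 (z k t)" I] \<open>finite I\<close> \<open>0 \<le> C\<close>
      by (intro mult_left_mono) (auto simp: W_def mult.commute)
    finally show ?thesis by (simp add: c_def)
  qed
  have contW: "continuous_on {0..T} W"
    using W by (meson DERIV_continuous continuous_on_eq_continuous_within)
  \<comment> \<open>Gronwall by integrating factor: the weighted squared distance is nonincreasing
    and starts at 0.\<close>
  have "exp (- c * t) * W t \<le> exp (- c * 0) * W 0 + 0 * (t - 0)"
  proof (rule nonincreasing_of_derivative_le)
    show "0 \<le> t" using assms by simp
    show "continuous_on {0..t} (\<lambda>t. exp (- c * t) * W t)"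
      using assms by (intro continuous_intros continuous_on_subset[OF contW]) auto
    fix r assume r: "0 < r" "r < t"
    then have rT: "r \<in> {0<..<T}" "r \<in> {0..T}" using assms by auto
    have "(W has_real_derivative W' r) (at r)"
      using W[OF rT(2)] rT(1) by (metis at_within_Icc_at greaterThanLessThan_iff)
    then have "((\<lambda>t. exp (- c * t) * W t) has_real_derivative exp (- c * r) * (W' r - c * W r)) (at r)"
      by (auto intro!: derivative_eq_intros simp: algebra_simps)
    moreover have "exp (- c * r) * (W' r - c * W r) \<le> 0"
      using W'[OF rT(2)] by (simp add: mult_le_0_iff)
    ultimately show "\<exists>D\<le>0. ((\<lambda>t. exp (- c * t) * W t) has_real_derivative D) (at r)" by blast
  qed
  moreover have "W 0 = 0" unfolding W_def using init by (auto intro!: sum.neutral simp: min_def)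
  ultimately have "W t \<le> 0" by (simp add: mult_le_0_iff)
  moreover have "(min 0 (z k t))\<^sup>2 \<le> W t"
    unfolding W_def using \<open>finite I\<close> \<open>k \<in> I\<close> by (intro member_le_sum) auto
  ultimately have "(min 0 (z k t))\<^sup>2 \<le> 0" by linarith
  then show ?thesis by (simp add: min_def split: if_splits)
qed

lemma implicit_function_derivative:
  fixes f f2 :: "real \<Rightarrow> real \<Rightarrow> real" and s :: "real \<Rightarrow> real"
  assumes t0: "t0 \<in> J"
    and level: "\<And>t. t \<in> J \<Longrightarrow> f t (s t) = c"
    and d2: "\<And>t \<sigma>. t \<in> J \<Longrightarrow> (f t has_real_derivative f2 t \<sigma>) (at \<sigma>)"
    and nz: "\<And>t \<sigma>. t \<in> J \<Longrightarrow> f2 t \<sigma> \<noteq> 0"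
    and cont2: "continuous_on (J \<times> UNIV) (\<lambda>(t, \<sigma>). f2 t \<sigma>)"
    and d1: "((\<lambda>t. f t (s t0)) has_real_derivative a) (at t0 within J)"
    and conts: "continuous (at t0 within J) s"
  shows "(s has_real_derivative - a / f2 t0 (s t0)) (at t0 within J)"
proof -
  have "\<exists>\<xi>. \<bar>\<xi> - s t0\<bar> \<le> \<bar>s t - s t0\<bar> \<and> f t (s t) - f t (s t0) = (s t - s t0) * f2 t \<xi>"
    if tJ: "t \<in> J" for t
  proof (cases "s t" "s t0" rule: linorder_cases)
    case less
    obtain \<xi> where "s t < \<xi>" "\<xi> < s t0" "f t (s t0) - f t (s t) = (s t0 - s t) * f2 t \<xi>"
      using MVT2[OF less, of "f t" "f2 t", OF d2[OF tJ]] by blast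
    then show ?thesis by (intro exI[of _ \<xi>]) (auto simp: algebra_simps)
  next
    case greater
    obtain \<xi> where "s t0 < \<xi>" "\<xi> < s t" "f t (s t) - f t (s t0) = (s t - s t0) * f2 t \<xi>"
      using MVT2[OF greater, of "f t" "f2 t", OF d2[OF tJ]] by blast
    then show ?thesis by (intro exI[of _ \<xi>]) auto
  qed auto
  then obtain \<xi> where \<xi>: "\<And>t. t \<in> J \<Longrightarrow> \<bar>\<xi> t - s t0\<bar> \<le> \<bar>s t - s t0\<bar>"
    and mvt: "\<And>t. t \<in> J \<Longrightarrow> f t (s t) - f t (s t0) = (s t - s t0) * f2 t (\<xi> t)" by metis
  have inJ: "\<forall>\<^sub>F t in at t0 within J. t \<in> J" by (simp add: eventually_at_filter)
  have st: "(s \<longlongrightarrow> s t0) (at t0 within J)" using conts by (simp add: continuous_within)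
  have \<xi>t: "(\<xi> \<longlongrightarrow> s t0) (at t0 within J)"
  proof (rule Lim_transform[OF tendsto_const])
    show "((\<lambda>t. \<xi> t - s t0) \<longlongrightarrow> 0) (at t0 within J)"
    proof (rule Lim_null_comparison)
      show "\<forall>\<^sub>F t in at t0 within J. norm (\<xi> t - s t0) \<le> \<bar>s t - s t0\<bar>"
        using inJ by eventually_elim (use \<xi> in \<open>auto simp: abs_minus_commute\<close>)
      show "((\<lambda>t. \<bar>s t - s t0\<bar>) \<longlongrightarrow> 0) (at t0 within J)"
        using tendsto_rabs[OF tendsto_diff[OF st tendsto_const[of "s t0"]]] by simp
    qed
  qed
  have f2t: "((\<lambda>t. f2 t (\<xi> t)) \<longlongrightarrow> f2 t0 (s t0)) (at t0 within J)"
  proof -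
    have "((\<lambda>t. (t, \<xi> t)) \<longlongrightarrow> (t0, s t0)) (at t0 within J)"
      by (intro tendsto_Pair \<xi>t tendsto_ident_at)
    from continuous_on_tendsto_compose[OF cont2 this] t0 inJ show ?thesis by (auto simp: eventually_mono)
  qed
  have "((\<lambda>t. - ((f t (s t0) - f t0 (s t0)) / (t - t0)) / f2 t (\<xi> t)) \<longlongrightarrow> - a / f2 t0 (s t0))
      (at t0 within J)"
    using d1 nz t0 by (intro tendsto_intros f2t) (auto simp: has_field_derivative_iff)
  moreover have "\<forall>\<^sub>F t in at t0 within J.
      - ((f t (s t0) - f t0 (s t0)) / (t - t0)) / f2 t (\<xi> t) = (s t - s t0) / (t - t0)"
    using inJ
  proof eventually_elim
    case (elim t)
    have "f t0 (s t0) = f t (s t)" using level t0 elim by simp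
    then have "- (f t (s t0) - f t0 (s t0)) = (s t - s t0) * f2 t (\<xi> t)"
      using mvt[OF elim] by simp
    then have "- ((f t (s t0) - f t0 (s t0)) / (t - t0)) = (s t - s t0) / (t - t0) * f2 t (\<xi> t)"
      by (metis minus_divide_left times_divide_eq_left)
    then show ?case using nz[OF elim, of "\<xi> t"] by simp
  qed
  ultimately have "((\<lambda>t. (s t - s t0) / (t - t0)) \<longlongrightarrow> - a / f2 t0 (s t0)) (at t0 within J)"
    by (rule Lim_transform_eventually)
  then show ?thesis by (simp add: has_field_derivative_iff)
qed

section \<open>The integrator chain and its dilations\<close>

lemma position_strict_mono: "i < j \<Longrightarrow> position i < position (j :: 'n::{finite,linorder})"
  unfolding position_def by (intro psubset_card_mono psubsetI) (auto simp: set_eq_iff intro: exI[of _ j])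

lemma position_eq_iff [simp]: "position i = position j \<longleftrightarrow> i = (j :: 'n::{finite,linorder})"
  using position_strict_mono by (metis less_irrefl linorder_neqE)

lemma range_position: "range (position :: 'n::{finite,linorder} \<Rightarrow> nat) = {1..CARD('n)}"
proof (rule card_subset_eq)
  show "range (position :: 'n \<Rightarrow> nat) \<subseteq> {1..CARD('n)}"
  proof safe
    fix i :: 'n
    have "0 < card {j. j \<le> i}" by (auto simp: card_gt_0_iff)
    moreover have "card {j. j \<le> i} \<le> CARD('n)" by (intro card_mono) auto
    ultimately show "position i \<in> {1..CARD('n)}" unfolding position_def by simp
  qed
  show "card (range (position :: 'n \<Rightarrow> nat)) = card {1..CARD('n)}"
    by (subst card_image) (auto simp: inj_on_def)
qed auto

lemma position_bounds: "1 \<le> position i" "position (i :: 'n::{finite,linorder}) \<le> CARD('n)"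
  using range_position[where 'n='n] by (metis atLeastAtMost_iff rangeI)+

lemma position_surj:
  assumes "1 \<le> k" "k \<le> CARD('n)"
  obtains i :: "'n::{finite,linorder}" where "position i = k"
  using range_position[where 'n='n] assms by (metis atLeastAtMost_iff rangeE)

definition grade :: "real \<Rightarrow> 'n::{finite,linorder} \<Rightarrow> real" where
  "grade mu i = 1 - mu * (real CARD('n) - real (position i))"

lemma grade_ge_1: "mu \<le> 0 \<Longrightarrow> 1 \<le> grade mu i"
  using position_bounds(2)[of i] by (simp add: grade_def mult_nonpos_nonneg)

lemma matrix_vector_minus:
  fixes M :: "real ^ 'k ^ 'm"
  shows "M *v (- x) = - (M *v x)" "(- M) *v x = - (M *v x)"
  using matrix_vector_mult_diff_distrib[of M 0 x] matrix_vector_mult_diff_rdistrib[of 0 M x] by simp_all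

lemma diagonal_matrix_vector:
  fixes x :: "real ^ 'k"
  shows "((\<chi> i j. if i = j then d i else 0) *v x) $ i = d i * x $ i"
proof -
  have "(if i = j then d i else 0) * x $ j = (if i = j then d i * x $ i else 0)" for j
    by simp
  then show ?thesis by (simp add: matrix_vector_mult_def)
qed

lemma G_mat_nth: "(G_mat mu *v x) $ i = grade mu i * x $ i"
  unfolding G_mat_def grade_def[symmetric] by (rule diagonal_matrix_vector)

lemma A_mat_nth: "(A_mat *v x) $ i = (\<Sum>j\<in>UNIV. if position j = position i + 1 then x $ j else 0)"
proof -
  have "(if position j = position i + 1 then 1 else 0) * x $ j
      = (if position j = position i + 1 then x $ j else 0)" for j
    by simp
  then show ?thesis by (simp add: matrix_vector_mult_def A_mat_def)
qed

lemma A_mat_axis: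
  fixes i j :: "'n::{finite,linorder}"
  assumes "position j = Suc (position i)"
  shows "A_mat *v axis j 1 = axis i (1::real)"
proof (rule vec_eq_iff[THEN iffD2], rule allI)
  fix l :: 'n
  have "(if position m = position l + 1 then axis j 1 $ m else 0)
      = (if m = j then (if l = i then 1 else 0 :: real) else 0)" for m
    using assms by (auto simp: axis_def)
  then have "(\<Sum>m\<in>UNIV. if position m = position l + 1 then axis j 1 $ m else 0)
      = (\<Sum>m\<in>UNIV. if m = j then (if l = i then 1 else 0 :: real) else 0)"
    by presburger
  then show "(A_mat *v axis j 1) $ l = axis i (1::real) $ l"
    unfolding A_mat_nth by (simp add: axis_def)
qed

lemma B_vec_eq_axis: "position i = CARD('n) \<Longrightarrow> B_vec = axis (i :: 'n::{finite,linorder}) 1"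
  by (auto simp: vec_eq_iff B_vec_def axis_def) (metis position_eq_iff)+

lemma eta1_eq_axis: "position i = 1 \<Longrightarrow> eta1 = axis (i :: 'n::{finite,linorder}) 1"
  by (auto simp: vec_eq_iff eta1_def axis_def) (metis position_eq_iff)+

text \<open>Infinitesimal homogeneity: the chain links consecutive positions, whose grades differ by
  exactly \<open>mu\<close>.\<close>

lemma A_mat_G_mat:
  fixes x :: "'n::{finite,linorder} colvec"
  shows "A_mat *v (G_mat mu *v x) = G_mat mu *v (A_mat *v x) + mu *\<^sub>R (A_mat *v x)"
  unfolding vec_eq_iff
proof
  fix i :: 'n
  have "(A_mat *v (G_mat mu *v x)) $ i
      = (\<Sum>j\<in>UNIV. (grade mu i + mu) * (if position j = position i + 1 then x $ j else 0))"
    unfolding A_mat_nth G_mat_nth by (intro sum.cong) (auto simp: grade_def algebra_simps)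
  also have "\<dots> = (G_mat mu *v (A_mat *v x) + mu *\<^sub>R (A_mat *v x)) $ i"
    unfolding sum_distrib_left[symmetric] vector_add_component vector_scaleR_component G_mat_nth
      A_mat_nth by (simp add: distrib_right)
  finally show "(A_mat *v (G_mat mu *v x)) $ i
      = (G_mat mu *v (A_mat *v x) + mu *\<^sub>R (A_mat *v x)) $ i" .
qed

section \<open>The rows of \<open>H\<close> and the gain as one family\<close>

lemma matpow_commute: "matpow M k ** M = M ** matpow M k"
  by (induction k) (simp_all add: matrix_mul_assoc[symmetric])

text \<open>With the index started at 0, this is the negative of the row with number
  \<open>k + 1\<close> of \<open>H\<close> for \<open>k < CARD('n)\<close>, and the gain for
  \<open>k = CARD('n)\<close>. Nonnegativity of \<open>H y\<close> thus becomes nonpositivity of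
  these products.\<close>

definition chain_row :: "real \<Rightarrow> nat \<Rightarrow> 'n::{finite,linorder} colvec" where
  "chain_row lam k = eta1 v* matpow (A_mat + lam *\<^sub>R mat 1) k"

lemma h_row_eq: "h_row lam (Suc k) = - chain_row lam k"
  by (simp add: h_row_def chain_row_def)

lemma chain_row_0: "chain_row lam 0 = eta1"
  by (simp add: chain_row_def)

lemma K_lin_eq: "K_lin lam = (chain_row lam CARD('n) :: 'n::{finite,linorder} colvec)"
  by (simp add: K_lin_def chain_row_def)

lemma scaleR_mat_vector: "(lam *\<^sub>R mat 1) *v y = lam *\<^sub>R (y :: real ^ 'n)"
  by (simp add: scaleR_matrix_vector_assoc[symmetric])

lemma chain_row_Suc:
  "chain_row lam (Suc k) \<bullet> y = chain_row lam k \<bullet> (A_mat *v y) + lam * (chain_row lam k \<bullet> y)"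
proof -
  have "chain_row lam (Suc k) \<bullet> y = chain_row lam k \<bullet> ((A_mat + lam *\<^sub>R mat 1) *v y)"
    by (simp add: chain_row_def dot_lmul_matrix matrix_vector_mul_assoc matpow_commute)
  then show ?thesis
    by (simp add: matrix_vector_mult_add_rdistrib scaleR_mat_vector inner_add_right)
qed

text \<open>Each multiplication by \<open>A_mat + lam *\<^sub>R mat 1\<close> moves the support one
  position to the right and keeps the leading coefficient 1.\<close>

lemma chain_row_support:
  fixes i :: "'n::{finite,linorder}"
  shows
  "(Suc k < position i \<longrightarrow> chain_row lam k $ i = 0) \<and> (position i = Suc k \<longrightarrow> chain_row lam k $ i = 1)"
proof (induction k arbitrary: i)
  case 0
  then show ?case by (simp add: chain_row_0 eta1_def)
next
  case (Suc k)
  have nth: "chain_row lam (Suc k) $ j = chain_row lam k \<bullet> (A_mat *v axis j 1) + lam * chain_row lam k $ j"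
    for j :: 'n
    using chain_row_Suc[of lam k "axis j 1"] by (simp add: inner_axis)
  show ?case
  proof (cases "Suc (Suc k) \<le> position i")
    case True
    then have "1 \<le> position i - 1" "position i - 1 \<le> CARD('n)"
      using position_bounds(2)[of i] by linarith+
    then obtain j :: 'n where "position j = position i - 1" by (rule position_surj)
    with True have j: "position i = Suc (position j)" by simp
    with True Suc.IH[of i] Suc.IH[of j] show ?thesis
      by (simp add: nth A_mat_axis[OF j] inner_axis)
  qed simp
qed

lemma chain_row_B_vec:
  assumes "k < CARD('n)"
  shows "chain_row lam k \<bullet> (B_vec :: 'n::{finite,linorder} colvec) = (if Suc k = CARD('n) then 1 else 0)"
proof -
  obtain i :: 'n where i: "position i = CARD('n)"
    using position_surj[of "CARD('n)", where 'n='n] by force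
  then show ?thesis
    using chain_row_support[of k i lam] assms by (auto simp: B_vec_eq_axis inner_axis)
qed

lemma BK_mat_vector: "BK_mat lam *v y = (K_lin lam \<bullet> y) *\<^sub>R B_vec"
  by (auto simp: vec_eq_iff BK_mat_def matrix_vector_mult_def inner_vec_def sum_distrib_right
      intro!: sum.cong)

text \<open>For the last row the recursion would produce the gain applied to \<open>y\<close>; the
  input enters only this row, with coefficient 1, and cancels exactly that term.\<close>

lemma chain_row_closed_loop:
  fixes y :: "'n::{finite,linorder} colvec"
  assumes "k < CARD('n)"
  shows "chain_row lam k \<bullet> ((A_mat - BK_mat lam) *v y)
    = (if Suc k < CARD('n) then chain_row lam (Suc k) \<bullet> y else 0) - lam * (chain_row lam k \<bullet> y)"
proof -
  have "chain_row lam k \<bullet> ((A_mat - BK_mat lam) *v y) = chain_row lam (Suc k) \<bullet> y - lam * (chain_row lam k \<bullet> y)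
      - (chain_row lam CARD('n) \<bullet> y) * (if Suc k = CARD('n) then 1 else 0)"
    using chain_row_Suc[of lam k y] assms
    by (simp add: matrix_vector_mult_diff_rdistrib BK_mat_vector inner_diff_right chain_row_B_vec K_lin_eq)
  then show ?thesis using assms by (cases "Suc k = CARD('n)") auto
qed

text \<open>Induction on \<open>k\<close>, moving \<open>G_mat\<close> past \<open>A_mat\<close> by
  the commutation relation. The truncated \<open>k - 1\<close> at \<open>k = 0\<close> is harmless
  because of the factor \<open>k\<close>.\<close>

lemma chain_row_G_mat:
  fixes y :: "'n::{finite,linorder} colvec"
  shows "chain_row lam k \<bullet> (G_mat mu *v y)
    = (1 - mu * (real CARD('n) - real (Suc k))) * (chain_row lam k \<bullet> y)
      - mu * real k * lam * (chain_row lam (k - 1) \<bullet> y)"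
proof (induction k arbitrary: y)
  case 0
  obtain i :: 'n where i: "position i = 1" using position_surj[of 1, where 'n='n] by force
  then show ?case unfolding chain_row_0 eta1_eq_axis[OF i] using i by (simp add: inner_axis' G_mat_nth grade_def)
next
  case (Suc k)
  have "chain_row lam (Suc k) \<bullet> (G_mat mu *v y)
      = chain_row lam k \<bullet> (G_mat mu *v (A_mat *v y)) + mu * (chain_row lam k \<bullet> (A_mat *v y))
        + lam * (chain_row lam k \<bullet> (G_mat mu *v y))"
    by (simp add: chain_row_Suc A_mat_G_mat inner_add_right)
  moreover have "real k * (chain_row lam (k - 1) \<bullet> (A_mat *v y) + lam * (chain_row lam (k - 1) \<bullet> y))
      = real k * (chain_row lam k \<bullet> y)"
    using chain_row_Suc[of lam "k - 1" y] by (cases k) auto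
  ultimately show ?case
    unfolding Suc.IH using chain_row_Suc[of lam k y] by (simp add: algebra_simps) algebra
qed

section \<open>Dilations\<close>

lemma matpow_scaleR_G_mat:
  "matpow (s *\<^sub>R (G_mat mu :: 'n::{finite,linorder} sqmat)) k = (\<chi> i j. if i = j then (s * grade mu i) ^ k else 0)"
proof -
  have "(matpow (s *\<^sub>R (G_mat mu :: 'n sqmat)) k *v x) $ i = (s * grade mu i) ^ k * x $ i" for x i
    by (induction k) (simp_all add: matrix_vector_mul_assoc[symmetric] scaleR_matrix_vector_assoc[symmetric] G_mat_nth)
  then show ?thesis
    by (simp add: matrix_eq vec_eq_iff diagonal_matrix_vector)
qed

lemma dil_eq: "dil mu s = (\<chi> i j. if i = j then exp (s * grade mu i) else 0)"
proof -
  have "(\<lambda>k. matpow (s *\<^sub>R G_mat mu :: 'a sqmat) k /\<^sub>R fact k) sums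
      (\<chi> i j. if i = j then exp (s * grade mu i) else 0)"
    unfolding sums_def
  proof (intro vec_tendstoI)
    fix i j :: 'a
    have "(\<lambda>n. \<Sum>k<n. (s * grade mu i) ^ k /\<^sub>R fact k) \<longlonglongrightarrow> exp (s * grade mu i)"
      using exp_converges[of "s * grade mu i"] by (simp add: sums_def)
    then show "(\<lambda>n. (\<Sum>k<n. matpow (s *\<^sub>R G_mat mu :: 'a sqmat) k /\<^sub>R fact k) $ i $ j)
      \<longlonglongrightarrow> (\<chi> i j. if i = j then exp (s * grade mu i) else 0) $ i $ j"
      by (cases "i = j") (simp_all add: matpow_scaleR_G_mat)
  qed
  then show ?thesis unfolding dil_def mat_exp_def by (simp add: sums_iff)
qed

lemma dil_nth: "(dil mu s *v x) $ i = exp (s * grade mu i) * x $ i"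
  unfolding dil_eq by (rule diagonal_matrix_vector)

lemma dil_0 [simp]: "dil mu 0 *v x = x"
  by (simp add: vec_eq_iff dil_nth)

lemma dil_dil: "dil mu s *v (dil mu t *v x) = dil mu (s + t) *v x"
  by (simp add: vec_eq_iff dil_nth distrib_right exp_add)

lemma dil_eq_0_iff [simp]: "dil mu s *v x = 0 \<longleftrightarrow> x = 0"
  by (simp add: vec_eq_iff dil_nth)

text \<open>Finite form of the commutation relation: the grade difference \<open>mu\<close> of
  consecutive positions becomes the factor \<open>exp (mu * s)\<close>.\<close>

lemma A_mat_dil:
  fixes x :: "'n::{finite,linorder} colvec"
  shows "A_mat *v (dil mu s *v x) = exp (mu * s) *\<^sub>R (dil mu s *v (A_mat *v x))"
  unfolding vec_eq_iff
proof
  fix i :: 'n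
  have "(A_mat *v (dil mu s *v x)) $ i
     = (\<Sum>j\<in>UNIV. exp (mu * s) * (exp (s * grade mu i) * (if position j = position i + 1 then x $ j else 0)))"
    unfolding A_mat_nth dil_nth
    by (intro sum.cong) (auto simp: grade_def exp_add[symmetric] algebra_simps)
  then show "(A_mat *v (dil mu s *v x)) $ i = (exp (mu * s) *\<^sub>R (dil mu s *v (A_mat *v x))) $ i"
    by (simp add: dil_nth A_mat_nth sum_distrib_left)
qed

lemma dil_B_vec: "dil mu s *v B_vec = exp s *\<^sub>R B_vec"
  by (auto simp: vec_eq_iff dil_nth B_vec_def grade_def)

lemma norm_dil_le:
  fixes x :: "'n::{finite,linorder} colvec"
  assumes "mu \<le> 0" "s \<le> 0"
  shows "norm (dil mu s *v x) \<le> exp s * norm x"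
proof -
  have "norm (dil mu s *v x) \<le> norm (exp s *\<^sub>R x)"
    unfolding norm_vec_def
  proof (rule L2_set_mono)
    fix i :: 'n
    have "s * grade mu i \<le> s" using grade_ge_1[OF assms(1), of i] assms(2)
      using mult_left_mono_neg[of 1 "grade mu i" s] by simp
    then show "norm ((dil mu s *v x) $ i) \<le> norm ((exp s *\<^sub>R x) $ i)"
      by (auto simp: dil_nth abs_mult intro!: mult_right_mono)
  qed auto
  then show ?thesis by simp
qed

lemma norm_dil_ge:
  assumes "mu \<le> 0" "0 \<le> s"
  shows "exp s * norm x \<le> norm (dil mu s *v x)"
proof -
  have "norm x \<le> exp (- s) * norm (dil mu s *v x)"
    using norm_dil_le[OF assms(1), of "- s" "dil mu s *v x"] assms(2) by (simp add: dil_dil)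
  then show ?thesis by (simp add: exp_minus field_simps)
qed

lemma has_vector_derivative_dil:
  fixes x :: "real \<Rightarrow> 'n::{finite,linorder} colvec"
  assumes "(s has_real_derivative s') (at t within J)" "(x has_vector_derivative x') (at t within J)"
  shows "((\<lambda>t. dil mu (s t) *v x t) has_vector_derivative
    s' *\<^sub>R (G_mat mu *v (dil mu (s t) *v x t)) + dil mu (s t) *v x') (at t within J)"
proof (rule has_vector_derivative_vecI)
  fix i
  have "((\<lambda>t. x t $ i) has_real_derivative x' $ i) (at t within J)"
    unfolding has_real_derivative_iff_has_vector_derivative
    by (rule bounded_linear.has_vector_derivative[OF bounded_linear_vec_nth assms(2)])
  then show "((\<lambda>t. (dil mu (s t) *v x t) $ i) has_vector_derivative
      (s' *\<^sub>R (G_mat mu *v (dil mu (s t) *v x t)) + dil mu (s t) *v x') $ i) (at t within J)"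
    unfolding has_real_derivative_iff_has_vector_derivative[symmetric] dil_nth vector_add_component
      vector_scaleR_component G_mat_nth
    using assms(1) by (auto intro!: derivative_eq_intros)
qed

lemma continuous_on_dil [continuous_intros]:
  fixes x :: "'b::t2_space \<Rightarrow> 'n::{finite,linorder} colvec"
  assumes "continuous_on S s" "continuous_on S x"
  shows "continuous_on S (\<lambda>t. dil mu (s t) *v x t)"
proof -
  have "(\<lambda>t. dil mu (s t) *v x t) = (\<lambda>t. \<chi> i. exp (s t * grade mu i) * x t $ i)"
    by (auto simp: vec_eq_iff dil_nth)
  then show ?thesis
    by (simp only:) (intro continuous_intros assms)
qed

lemma continuous_on_matrix_vector [continuous_intros]:
  fixes x :: "'b::t2_space \<Rightarrow> real ^ 'n" and M :: "real ^ 'n ^ 'm"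
  assumes "continuous_on S x"
  shows "continuous_on S (\<lambda>t. M *v x t)"
  by (rule continuous_on_compose2[OF linear_continuous_on[OF matrix_vector_mul_bounded_linear] assms]) auto

section \<open>Bounds for quadratic and bilinear forms\<close>

lemma quadratic_form_lower_bound:
  fixes M :: "'n::finite sqmat"
  assumes "\<And>x. x \<noteq> 0 \<Longrightarrow> 0 < x \<bullet> (M *v x)"
  obtains c where "c > 0" "\<And>x. c * (norm x)\<^sup>2 \<le> x \<bullet> (M *v x)"
proof -
  have "\<exists>x\<in>sphere 0 1. \<forall>y\<in>sphere 0 1. x \<bullet> (M *v x) \<le> y \<bullet> (M *v y)"
    by (intro continuous_attains_inf continuous_intros) (auto intro: exI[of _ "axis undefined 1"])
  then obtain u where u: "norm u = 1" "\<And>y. norm y = 1 \<Longrightarrow> u \<bullet> (M *v u) \<le> y \<bullet> (M *v y)"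
    by auto
  show ?thesis
  proof
    show "0 < u \<bullet> (M *v u)" using u(1) by (intro assms) auto
    fix x :: "'n colvec"
    show "u \<bullet> (M *v u) * (norm x)\<^sup>2 \<le> x \<bullet> (M *v x)"
    proof (cases "x = 0")
      case False
      then have "u \<bullet> (M *v u) \<le> (x /\<^sub>R norm x) \<bullet> (M *v (x /\<^sub>R norm x))"
        by (intro u(2)) simp
      then show ?thesis using False
        by (simp add: matrix_vector_mult_scaleR field_simps power2_eq_square)
    qed simp
  qed
qed

lemma bilinear_form_bound:
  fixes M :: "real ^ 'n ^ 'm"
  obtains C where "C > 0" "\<And>x y. \<bar>x \<bullet> (M *v y)\<bar> \<le> C * norm x * norm y"
proof -
  obtain C where C: "C > 0" "\<And>y. norm (M *v y) \<le> norm y * C"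
    using bounded_linear.pos_bounded[OF matrix_vector_mul_bounded_linear[of M]] by blast
  show ?thesis
  proof
    show "C > 0" by (rule C)
    fix x y
    have "\<bar>x \<bullet> (M *v y)\<bar> \<le> norm x * norm (M *v y)" by (rule Cauchy_Schwarz_ineq2)
    also have "\<dots> \<le> norm x * (norm y * C)" by (intro mult_left_mono C) auto
    finally show "\<bar>x \<bullet> (M *v y)\<bar> \<le> C * norm x * norm y" by (simp add: mult_ac)
  qed
qed

section \<open>The transmitted vectors\<close>

text \<open>Uniqueness is a maximum principle: the set of agents at which the difference of two solutions
  is largest is closed under passing to in-neighbours, hence contains the leader.\<close>

lemma transmitted_unique:
  fixes E :: "('N::finite option \<times> 'N option) set" and x :: "'N option \<Rightarrow> 'n::finite colvec"
  assumes "comm_graph E" "x None = 0"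
  shows "transmitted E x v \<longleftrightarrow> v = x"
proof -
  define deg where "deg = (\<lambda>i. \<Sum>b\<in>UNIV. weight E (Some i) b)"
  have deg: "deg i > 0" for i
  proof -
    \<comment> \<open>The first edge of the path that connects the follower to the leader.\<close>
    obtain b where "(Some i, b) \<in> E"
      using assms(1) unfolding comm_graph_def by (metis converse_tranclE)
    then show ?thesis unfolding deg_def by (intro sum_pos2[of _ b]) (auto simp: weight_def)
  qed
  \<comment> \<open>In terms of \<open>v - x\<close> the equations say that the value at each
    follower is the average over its in-neighbours, the setting of the maximum principle.\<close>
  have iff: "transmitted E x v \<longleftrightarrow> v None = 0 \<and>
      (\<forall>i. deg i *\<^sub>R (v (Some i) - x (Some i)) = (\<Sum>b\<in>UNIV. weight E (Some i) b *\<^sub>R (v b - x b)))"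
  proof -
    have "v (Some i) = (1 / deg i) *\<^sub>R (\<Sum>b\<in>UNIV. weight E (Some i) b *\<^sub>R (x (Some i) - x b + v b))
      \<longleftrightarrow> deg i *\<^sub>R (v (Some i) - x (Some i)) = (\<Sum>b\<in>UNIV. weight E (Some i) b *\<^sub>R (v b - x b))" for i
    proof -
      have "(\<Sum>b\<in>UNIV. weight E (Some i) b *\<^sub>R (x (Some i) - x b + v b))
          = deg i *\<^sub>R x (Some i) + (\<Sum>b\<in>UNIV. weight E (Some i) b *\<^sub>R (v b - x b))"
        by (simp add: deg_def scaleR_sum_left sum.distrib[symmetric] algebra_simps)
      moreover have "v (Some i) = (1 / deg i) *\<^sub>R w \<longleftrightarrow> deg i *\<^sub>R v (Some i) = w" for w
        using deg[of i] by (auto simp: field_simps)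
      ultimately show ?thesis by (metis (no_types, lifting) add_diff_cancel_left' diff_add_cancel scaleR_diff_right add.commute)
    qed
    then show ?thesis unfolding transmitted_def deg_def by blast
  qed
  show ?thesis
  proof
    assume "v = x"
    then show "transmitted E x v" unfolding iff using assms(2) by simp
  next
    assume tr: "transmitted E x v"
    define \<delta> where "\<delta> = (\<lambda>b. norm (v b - x b))"
    define m where "m = Max (range \<delta>)"
    have le: "\<delta> b \<le> m" for b unfolding m_def by (intro Max_ge) auto
    have "m \<in> range \<delta>" unfolding m_def by (intro Max_in) auto
    then obtain a where a: "\<delta> a = m" by auto
    have step: "\<delta> b = m" if edge: "(c, b) \<in> E" and max: "\<delta> c = m" for b c
    proof -
      obtain i where c: "c = Some i"
        using edge assms(1) by (cases c) (auto simp: comm_graph_def)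
      have "deg i * m = norm (deg i *\<^sub>R (v (Some i) - x (Some i)))"
        using deg[of i] max by (simp add: c \<delta>_def)
      also have "\<dots> = norm (\<Sum>b\<in>UNIV. weight E (Some i) b *\<^sub>R (v b - x b))"
        using tr by (simp add: iff)
      also have "\<dots> \<le> (\<Sum>b\<in>UNIV. weight E (Some i) b * \<delta> b)"
        by (rule sum_norm_le) (simp add: \<delta>_def weight_def)
      \<comment> \<open>At a maximal follower the weighted gaps to the maximum are nonnegative with
        nonpositive sum, so every in-neighbour is maximal as well.\<close>
      finally have "(\<Sum>b\<in>UNIV. weight E (Some i) b * (m - \<delta> b)) \<le> 0"
        by (simp add: deg_def sum_distrib_right sum_subtractf right_diff_distrib)
      moreover have nn: "0 \<le> weight E (Some i) b * (m - \<delta> b)" for b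
        using le[of b] by (simp add: weight_def)
      ultimately have "weight E (Some i) b * (m - \<delta> b) = 0"
        using sum_nonneg_eq_0_iff[of UNIV "\<lambda>b. weight E (Some i) b * (m - \<delta> b)"]
        by (meson UNIV_I antisym finite sum_nonneg)
      then show ?thesis using edge by (simp add: c weight_def)
    qed
    have "\<delta> b = m" if "(a, b) \<in> E\<^sup>*" for b
      using that by (induction rule: rtrancl_induct) (use a step in auto)
    moreover have "(a, None) \<in> E\<^sup>*"
      using assms(1) by (cases a) (auto simp: comm_graph_def trancl_into_rtrancl)
    moreover have "\<delta> None = 0" using tr assms(2) by (simp add: iff \<delta>_def)
    ultimately have "m = 0" by metis
    then have "v b = x b" for b using le[of b] by (simp add: \<delta>_def)
    then show "v = x" by auto
  qed
qed

lemma error_field_eq: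
  assumes "comm_graph E"
  shows "error_field E lam mu P e
    = (\<chi> i. A_mat *v (e $ i) + control lam mu P (e $ i) *\<^sub>R B_vec)"
proof -
  have "(THE v. transmitted E (rel_state e) v) = rel_state e"
    using transmitted_unique[OF assms, of "rel_state e"] by (simp add: rel_state_def)
  then show ?thesis unfolding error_field_def by (simp add: Let_def rel_state_def)
qed

section \<open>The homogeneous norm along the closed loop\<close>

lemma symmetric_matrix_inner:
  fixes M :: "real ^ 'n ^ 'n"
  assumes "transpose M = M"
  shows "x \<bullet> (M *v y) = (M *v x) \<bullet> y"
  by (metis assms dot_lmul_matrix transpose_matrix_vector)

locale homogeneous_chain =
  fixes lam mu :: real and P :: "'n::{finite,linorder} sqmat"
  assumes lam: "0 < lam" and mu: "-1 \<le> mu" "mu < 0"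
    and P_pos: "positive_definite P"
    and P_mono: "positive_definite (P ** G_mat mu + G_mat mu ** P)"
    and P_lyap: "negative_definite (P ** (A_mat - BK_mat lam) + transpose (A_mat - BK_mat lam) ** P)"
begin

abbreviation "F \<equiv> A_mat - BK_mat lam :: 'n sqmat"
abbreviation "G \<equiv> G_mat mu :: 'n sqmat"
abbreviation "dl \<equiv> dil mu :: real \<Rightarrow> 'n sqmat"
abbreviation "hn \<equiv> hnorm mu P"

definition Q :: "'n colvec \<Rightarrow> real" where "Q x = x \<bullet> (P *v x)"
text \<open>\<open>qG\<close> and \<open>qF\<close> are half the derivatives of \<open>Q\<close> in
  the directions \<open>G y\<close> and \<open>F y\<close>; \<open>rho\<close> is the coefficient
  for which \<open>Q\<close> is stationary in the direction
  \<open>F y + rho y *\<^sub>R G y\<close>.\<close>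

definition qG :: "'n colvec \<Rightarrow> real" where "qG y = y \<bullet> (P *v (G *v y))"
definition qF :: "'n colvec \<Rightarrow> real" where "qF y = y \<bullet> (P *v (F *v y))"
definition rho :: "'n colvec \<Rightarrow> real" where "rho y = - qF y / qG y"
text \<open>Projection to the unit sphere of \<open>P\<close> along the orbits of the dilation. It
  sends the origin to itself.\<close>

definition proj :: "'n colvec \<Rightarrow> 'n colvec" where "proj x = dl (- ln (hn x)) *v x"
definition phi :: "'n colvec \<Rightarrow> 'n colvec"
  where "phi x = A_mat *v x + control lam mu P x *\<^sub>R B_vec"

lemma P_sym: "transpose P = P"
  using P_pos by (simp add: positive_definite_def)

lemma qG_eq: "qG y = y \<bullet> ((P ** G + G ** P) *v y) / 2"
proof -
  have "transpose G = G" by (simp add: transpose_def G_mat_def vec_eq_iff)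
  then have "y \<bullet> ((G ** P) *v y) = qG y"
    unfolding qG_def
    by (metis symmetric_matrix_inner P_sym matrix_vector_mul_assoc inner_commute)
  then show ?thesis
    by (simp add: matrix_vector_mult_add_rdistrib inner_add_right qG_def matrix_vector_mul_assoc)
qed

lemma qF_eq: "qF y = y \<bullet> ((P ** F + transpose F ** P) *v y) / 2"
proof -
  have "y \<bullet> ((transpose F ** P) *v y) = qF y"
    unfolding qF_def matrix_vector_mul_assoc[symmetric]
    by (metis symmetric_matrix_inner P_sym dot_lmul_matrix inner_commute transpose_matrix_vector transpose_transpose)
  then show ?thesis
    by (simp add: matrix_vector_mult_add_rdistrib inner_add_right qF_def matrix_vector_mul_assoc)
qed

lemma Q_lower: obtains c where "c > 0" "\<And>x. c * (norm x)\<^sup>2 \<le> Q x"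
  unfolding Q_def using P_pos by (rule_tac quadratic_form_lower_bound[of P]) (auto simp: positive_definite_def)

lemma Q_upper: obtains C where "C > 0" "\<And>x. Q x \<le> C * (norm x)\<^sup>2"
proof -
  obtain C where "C > 0" "\<And>x y. \<bar>x \<bullet> (P *v y)\<bar> \<le> C * norm x * norm y"
    using bilinear_form_bound by blast
  then show ?thesis
    by (intro that[of C]) (auto simp: Q_def power2_eq_square intro: order_trans[OF abs_ge_self] simp flip: mult.assoc)
qed

lemma qG_lower: obtains c where "c > 0" "\<And>x. c * (norm x)\<^sup>2 \<le> qG x"
proof -
  obtain c where "c > 0" "\<And>x. c * (norm x)\<^sup>2 \<le> x \<bullet> ((P ** G + G ** P) *v x)"
    using quadratic_form_lower_bound[of "P ** G + G ** P"] P_mono by (auto simp: positive_definite_def)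
  then show ?thesis by (intro that[of "c / 2"]) (auto simp: qG_eq)
qed

lemma qF_upper: obtains c where "c > 0" "\<And>x. qF x \<le> - c * (norm x)\<^sup>2"
proof -
  have "x \<bullet> (- (P ** F + transpose F ** P) *v x) = - (x \<bullet> ((P ** F + transpose F ** P) *v x))" for x
    by (simp only: matrix_vector_minus inner_minus_right)
  then obtain c where c: "c > 0" "\<And>x. c * (norm x)\<^sup>2 \<le> - (x \<bullet> ((P ** F + transpose F ** P) *v x))"
    using quadratic_form_lower_bound[of "- (P ** F + transpose F ** P)"] P_lyap
    by (auto simp: negative_definite_def)
  then have "qF x \<le> - (c / 2) * (norm x)\<^sup>2" for x
  proof -
    have "c * (norm x)\<^sup>2 \<le> - (2 * qF x)" using c(2)[of x] by (simp add: qF_eq)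
    then show ?thesis by simp
  qed
  then show ?thesis using c(1) by (intro that[of "c / 2"]) auto
qed

lemma Q_0 [simp]: "Q 0 = 0" by (simp add: Q_def)

lemma qG_pos: "x \<noteq> 0 \<Longrightarrow> 0 < qG x"
  using P_mono by (simp add: positive_definite_def qG_eq)

lemma qF_neg: "x \<noteq> 0 \<Longrightarrow> qF x < 0"
  using P_lyap by (simp add: negative_definite_def qF_eq)

text \<open>Numerator and denominator are both comparable to the squared norm, from above by
  continuity and from below by definiteness.\<close>

lemma rho_bounds: obtains c C where "c > 0" "C > 0" "\<And>y. y \<noteq> 0 \<Longrightarrow> c \<le> rho y" "\<And>y. y \<noteq> 0 \<Longrightarrow> rho y \<le> C"
proof -
  obtain g where g: "g > 0" "\<And>x. g * (norm x)\<^sup>2 \<le> qG x" using qG_lower by blast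
  obtain f where f: "f > 0" "\<And>x. qF x \<le> - f * (norm x)\<^sup>2" using qF_upper by blast
  obtain a where a: "a > 0" "\<And>x y. \<bar>x \<bullet> ((P ** G) *v y)\<bar> \<le> a * norm x * norm y"
    using bilinear_form_bound by blast
  obtain b where b: "b > 0" "\<And>x y. \<bar>x \<bullet> ((P ** F) *v y)\<bar> \<le> b * norm x * norm y"
    using bilinear_form_bound by blast
  have qGu: "qG y \<le> a * (norm y)\<^sup>2" for y
    using a(2)[of y y] by (simp add: qG_def matrix_vector_mul_assoc power2_eq_square mult.assoc)
  have qFl: "- qF y \<le> b * (norm y)\<^sup>2" for y
    using b(2)[of y y] by (simp add: qF_def matrix_vector_mul_assoc power2_eq_square mult.assoc)
  show ?thesis
  proof (rule that[of "f / a" "b / g"])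
    fix y :: "'n colvec" assume "y \<noteq> 0"
    then have n: "(norm y)\<^sup>2 > 0" and q: "qG y > 0" by (auto intro: qG_pos)
    have "f / a * qG y \<le> f / a * (a * (norm y)\<^sup>2)" using qGu f a by (intro mult_left_mono) auto
    also have "\<dots> \<le> - qF y" using f(2)[of y] a by simp
    finally show "f / a \<le> rho y" unfolding rho_def pos_le_divide_eq[OF q] .
    have "- qF y \<le> b / g * (g * (norm y)\<^sup>2)" using qFl[of y] g by simp
    also have "\<dots> \<le> b / g * qG y" using g b by (intro mult_left_mono) auto
    finally show "rho y \<le> b / g" unfolding rho_def pos_divide_le_eq[OF q] .
  qed (use f a b g in auto)
qed

lemma rho_pos: "y \<noteq> 0 \<Longrightarrow> 0 < rho y"
  using qF_neg[of y] qG_pos[of y] unfolding rho_def by (intro divide_pos_pos) auto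

lemma continuous_on_Q [continuous_intros]:
  fixes x :: "'b::t2_space \<Rightarrow> 'n colvec"
  shows "continuous_on S x \<Longrightarrow> continuous_on S (\<lambda>t. Q (x t))"
  unfolding Q_def by (intro continuous_intros)

lemma continuous_on_qG [continuous_intros]:
  fixes x :: "'b::t2_space \<Rightarrow> 'n colvec"
  shows "continuous_on S x \<Longrightarrow> continuous_on S (\<lambda>t. qG (x t))"
  unfolding qG_def by (intro continuous_intros)

lemma continuous_on_qF [continuous_intros]:
  fixes x :: "'b::t2_space \<Rightarrow> 'n colvec"
  shows "continuous_on S x \<Longrightarrow> continuous_on S (\<lambda>t. qF (x t))"
  unfolding qF_def by (intro continuous_intros)

lemma Q_derivative:
  assumes "(f has_vector_derivative f') (at t within J)"
  shows "((\<lambda>t. Q (f t)) has_real_derivative 2 * (f t \<bullet> (P *v f'))) (at t within J)"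
proof -
  have "((\<lambda>t. P *v f t) has_vector_derivative P *v f') (at t within J)"
    by (rule bounded_linear.has_vector_derivative[OF matrix_vector_mul_bounded_linear assms])
  from bounded_bilinear.has_vector_derivative[OF bounded_bilinear_inner assms this]
  show ?thesis
    unfolding Q_def has_real_derivative_iff_has_vector_derivative
    by (simp add: symmetric_matrix_inner[OF P_sym, of "f t"] inner_commute[of f'])
qed

section \<open>Dilation orbits and the canonical homogeneous norm\<close>

lemma Q_dil_derivative:
  "((\<lambda>s. Q (dl (- s) *v x)) has_real_derivative - 2 * qG (dl (- s) *v x)) (at s)"
proof -
  have "((\<lambda>s. dl (- s) *v x) has_vector_derivative
      (-1) *\<^sub>R (G *v (dl (- s) *v x)) + dl (- s) *v 0) (at s)"
    by (rule has_vector_derivative_dil) (auto intro!: derivative_eq_intros)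
  from Q_derivative[OF this] show ?thesis
    by (simp add: qG_def matrix_vector_minus)
qed

text \<open>Here positive definiteness of \<open>P ** G + G ** P\<close> enters: it makes the sphere
  transversal to the orbits, so that each orbit meets it only once.\<close>

lemma Q_dil_strict_antimono:
  assumes "x \<noteq> 0" "s < t"
  shows "Q (dl (- t) *v x) < Q (dl (- s) *v x)"
  by (rule DERIV_neg_imp_decreasing[OF assms(2)])
    (use Q_dil_derivative[of x] qG_pos assms(1) in fastforce)

lemma level_exists:
  assumes "x \<noteq> 0"
  shows "\<exists>s. Q (dl (- s) *v x) = 1"
proof -
  obtain c where c: "c > 0" "\<And>x. c * (norm x)\<^sup>2 \<le> Q x" using Q_lower by blast
  obtain C where C: "C > 0" "\<And>x. Q x \<le> C * (norm x)\<^sup>2" using Q_upper by blast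
  have n: "(norm x)\<^sup>2 > 0" using assms by simp
  \<comment> \<open>Large enough that the square of \<open>exp S\<close> beats both quotients:
    contracting by \<open>S\<close> brings \<open>Q\<close> below 1, expanding by \<open>S\<close>
    brings it above 1.\<close>
  define S where "S = max (C * (norm x)\<^sup>2) (1 / (c * (norm x)\<^sup>2))"
  have S0: "0 < S" using C n by (simp add: S_def less_max_iff_disj)
  have "S < exp S" using exp_ge_add_one_self[of S] by linarith
  also have "exp S \<le> (exp S)\<^sup>2" using S0 by (simp add: power2_eq_square)
  finally have S: "S \<le> (exp S)\<^sup>2" by simp
  have "Q (dl (- S) *v x) \<le> C * (exp (- S) * norm x)\<^sup>2"
    using norm_dil_le[of mu "- S" x] mu S0 C
    by (intro order_trans[OF C(2)] mult_left_mono power_mono) auto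
  also have "\<dots> = C * (norm x)\<^sup>2 / (exp S)\<^sup>2"
    by (simp add: exp_minus power_mult_distrib field_simps)
  also have "\<dots> \<le> 1"
    using S by (simp add: S_def)
  finally have 1: "Q (dl (- S) *v x) \<le> 1" .
  have "1 = c * (norm x)\<^sup>2 * (1 / (c * (norm x)\<^sup>2))" using c n by simp
  also have "\<dots> \<le> c * (norm x)\<^sup>2 * (exp S)\<^sup>2"
    using S c n by (intro mult_left_mono) (auto simp: S_def)
  also have "\<dots> = c * (exp S * norm x)\<^sup>2" by (simp add: power_mult_distrib)
  also have "\<dots> \<le> c * (norm (dl S *v x))\<^sup>2"
    using norm_dil_ge[of mu S x] mu S0 c by (intro mult_left_mono power_mono) auto
  also have "\<dots> \<le> Q (dl (- (- S)) *v x)" using c by simp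
  finally have 2: "1 \<le> Q (dl (- (- S)) *v x)" .
  have "continuous_on {-S..S} (\<lambda>s. Q (dl (- s) *v x))" by (intro continuous_intros)
  from IVT2'[OF 1 2 _ this] S0 show ?thesis by auto
qed

lemma Q_dil_inj:
  assumes "x \<noteq> 0" "Q (dl (- s) *v x) = Q (dl (- t) *v x)"
  shows "s = t"
  using Q_dil_strict_antimono[OF assms(1), of s t] Q_dil_strict_antimono[OF assms(1), of t s] assms(2)
  by (cases s t rule: linorder_cases) auto

lemma hnorm_eqI:
  assumes "x \<noteq> 0" "Q (dl (- s) *v x) = 1"
  shows "hn x = exp s"
proof -
  have "pnorm P (dl (- t) *v x) = 1 \<longleftrightarrow> Q (dl (- t) *v x) = 1" for t
    by (simp add: pnorm_def Q_def)
  then have "(THE s. pnorm P (dl (- s) *v x) = 1) = s"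
    using Q_dil_inj[OF assms(1), of _ s] assms(2) by (intro the_equality) metis+
  then show ?thesis using assms(1) by (simp add: hnorm_def)
qed

lemma hnorm_0 [simp]: "hn 0 = 0" by (simp add: hnorm_def)

lemma hnorm_pos: "x \<noteq> 0 \<Longrightarrow> 0 < hn x"
  using level_exists hnorm_eqI by fastforce

lemma hnorm_eq_0_iff [simp]: "hn x = 0 \<longleftrightarrow> x = 0"
  using hnorm_pos by fastforce

lemma hnorm_nonneg: "0 \<le> hn x"
  using hnorm_pos[of x] by (cases "x = 0") auto

lemma Q_proj: "x \<noteq> 0 \<Longrightarrow> Q (proj x) = 1"
  using level_exists[of x] hnorm_eqI[of x] by (auto simp: proj_def)

lemma proj_nonzero: "x \<noteq> 0 \<Longrightarrow> proj x \<noteq> 0"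
  by (simp add: proj_def)

lemma dil_proj: "dl (ln (hn x)) *v proj x = x"
  by (simp add: proj_def dil_dil)

text \<open>Trades a bound on the implicitly defined norm for a strict inequality between continuous
  functions of \<open>x\<close>; together with the reverse comparison it yields continuity of the
  norm.\<close>

lemma hnorm_less_iff: "0 < b \<Longrightarrow> hn x < b \<longleftrightarrow> Q (dl (- ln b) *v x) < 1"
proof (cases "x = 0")
  case False
  assume b: "0 < b"
  have q: "Q (dl (- ln (hn x)) *v x) = 1" using Q_proj[OF False] by (simp add: proj_def)
  show ?thesis
    using Q_dil_strict_antimono[OF False, of "ln (hn x)" "ln b"]
      Q_dil_strict_antimono[OF False, of "ln b" "ln (hn x)"] hnorm_pos[OF False] q b
    by (cases "hn x" b rule: linorder_cases) auto
qed auto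

lemma hnorm_greater_iff: "0 < a \<Longrightarrow> a < hn x \<longleftrightarrow> 1 < Q (dl (- ln a) *v x)"
proof (cases "x = 0")
  case False
  assume a: "0 < a"
  have q: "Q (dl (- ln (hn x)) *v x) = 1" using Q_proj[OF False] by (simp add: proj_def)
  show ?thesis
    using Q_dil_strict_antimono[OF False, of "ln (hn x)" "ln a"]
      Q_dil_strict_antimono[OF False, of "ln a" "ln (hn x)"] hnorm_pos[OF False] q a
    by (cases "hn x" a rule: linorder_cases) auto
qed auto

lemma hnorm_dil: "hn (dl t *v x) = exp t * hn x"
proof (cases "x = 0")
  case False
  have "Q (dl (- (t + ln (hn x))) *v (dl t *v x)) = 1"
    using Q_proj[OF False] by (simp add: dil_dil proj_def)
  then have "hn (dl t *v x) = exp (t + ln (hn x))" using False by (intro hnorm_eqI) auto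
  then show ?thesis using hnorm_pos[OF False] by (simp add: exp_add)
qed simp

lemma proj_dil: "x \<noteq> 0 \<Longrightarrow> proj (dl t *v x) = proj x"
  using hnorm_pos[of x] by (simp add: proj_def hnorm_dil ln_mult dil_dil)

lemma hnorm_minus: "hn (- x) = hn x"
proof (cases "x = 0")
  case False
  have "dl s *v (- x) = - (dl s *v x)" for s by (simp add: vec_eq_iff dil_nth)
  then have "Q (dl (- ln (hn x)) *v (- x)) = 1"
    using Q_proj[OF False] by (simp add: Q_def proj_def matrix_vector_minus)
  then show ?thesis using False hnorm_pos[OF False] by (subst hnorm_eqI) auto
qed simp

lemma isCont_hnorm: "isCont hn x"
  unfolding isCont_def
proof (rule order_tendstoI)
  have cont: "isCont (\<lambda>x. Q (dl s *v x)) x" for s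
    using continuous_on_eq_continuous_at[OF open_UNIV, of "\<lambda>x. Q (dl s *v x)"]
    by (auto intro!: continuous_intros)
  fix a assume a: "a < hn x"
  show "\<forall>\<^sub>F y in at x. a < hn y"
  proof (cases a "0::real" rule: linorder_cases)
    case less
    then show ?thesis using hnorm_nonneg by (auto intro!: always_eventually intro: less_le_trans)
  next
    case equal
    then have "x \<noteq> 0" using a by auto
    then have "\<forall>\<^sub>F y in at x. y \<noteq> 0" by (rule tendsto_imp_eventually_ne[OF tendsto_ident_at])
    then show ?thesis by eventually_elim (use equal hnorm_pos in auto)
  next
    case greater
    then have "1 < Q (dl (- ln a) *v x)" using a hnorm_greater_iff by simp
    then have "\<forall>\<^sub>F y in at x. 1 < Q (dl (- ln a) *v y)"
      using order_tendstoD(1)[OF cont[unfolded isCont_def]] by blast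
    then show ?thesis by eventually_elim (use greater hnorm_greater_iff in simp)
  qed
next
  have cont: "isCont (\<lambda>x. Q (dl s *v x)) x" for s
    using continuous_on_eq_continuous_at[OF open_UNIV, of "\<lambda>x. Q (dl s *v x)"]
    by (auto intro!: continuous_intros)
  fix b assume b: "hn x < b"
  then have b0: "0 < b" using hnorm_nonneg[of x] by linarith
  then have "Q (dl (- ln b) *v x) < 1" using b hnorm_less_iff by simp
  then have "\<forall>\<^sub>F y in at x. Q (dl (- ln b) *v y) < 1"
    using order_tendstoD(2)[OF cont[unfolded isCont_def]] by blast
  then show "\<forall>\<^sub>F y in at x. hn y < b" by eventually_elim (use b0 hnorm_less_iff in simp)
qed

lemma continuous_on_hnorm [continuous_intros]:
  fixes x :: "'b::t2_space \<Rightarrow> 'n colvec"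
  assumes "continuous_on S x"
  shows "continuous_on S (\<lambda>t. hn (x t))"
  by (rule continuous_on_compose2[OF _ assms, of UNIV])
    (auto intro: continuous_at_imp_continuous_on isCont_hnorm)

lemma continuous_on_proj [continuous_intros]:
  fixes x :: "'b::t2_space \<Rightarrow> 'n colvec"
  assumes "continuous_on S x" "\<And>t. t \<in> S \<Longrightarrow> x t \<noteq> 0"
  shows "continuous_on S (\<lambda>t. proj (x t))"
  unfolding proj_def using assms by (intro continuous_intros) auto

lemma proj_bounded: obtains Y where "Y > 0" "\<And>x. norm (proj x) \<le> Y"
proof -
  obtain c where c: "c > 0" "\<And>x. c * (norm x)\<^sup>2 \<le> Q x" using Q_lower by blast
  have "norm (proj x) \<le> sqrt (1 / c)" for x
  proof (cases "x = 0")
    case False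
    then have "(norm (proj x))\<^sup>2 \<le> 1 / c"
      using c(2)[of "proj x"] c(1) Q_proj by (simp add: field_simps)
    then show ?thesis using real_le_rsqrt by blast
  qed (use c in \<open>simp add: proj_def\<close>)
  then show ?thesis using c(1) by (intro that[of "sqrt (1 / c)"]) auto
qed

section \<open>The closed-loop field in polar coordinates\<close>

lemma control_eq: "control lam mu P x = - (hn x powr (1 + mu)) * (K_lin lam \<bullet> proj x)"
  by (simp add: control_def proj_def)

lemma phi_0 [simp]: "phi 0 = 0"
  by (simp add: phi_def control_eq proj_def)

lemma phi_minus: "phi (- x) = - phi x"
proof -
  have "dl s *v (- x) = - (dl s *v x)" for s by (simp add: vec_eq_iff dil_nth)
  then show ?thesis by (simp add: phi_def control_eq proj_def hnorm_minus matrix_vector_minus)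
qed

text \<open>The chain is homogeneous of degree \<open>mu\<close>, the input vector scales by
  \<open>exp s\<close>, and the power \<open>1 + mu\<close> of the norm in the control supplies what
  is missing. Both terms acquire the same factor, leaving the linear closed loop on the
  sphere.\<close>

lemma phi_eq:
  assumes "x \<noteq> 0"
  shows "phi x = exp (mu * ln (hn x)) *\<^sub>R (dl (ln (hn x)) *v (F *v proj x))"
proof -
  define s where "s = ln (hn x)"
  have h: "hn x = exp s" using hnorm_pos[OF assms] by (simp add: s_def)
  have "phi x = A_mat *v (dl s *v proj x) - (exp (mu * s) * exp s * (K_lin lam \<bullet> proj x)) *\<^sub>R B_vec"
    using dil_proj[of x] unfolding phi_def control_eq
    by (simp add: s_def[symmetric] h powr_def exp_add[symmetric] algebra_simps)
  also have "\<dots> = exp (mu * s) *\<^sub>R (dl s *v (A_mat *v proj x) - (K_lin lam \<bullet> proj x) *\<^sub>R (dl s *v B_vec))"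
    by (simp add: A_mat_dil dil_B_vec scaleR_diff_right mult_ac)
  also have "\<dots> = exp (mu * s) *\<^sub>R (dl s *v (F *v proj x))"
    by (simp add: matrix_vector_mult_diff_rdistrib BK_mat_vector matrix_vector_mult_scaleR matrix_vector_mult_diff_distrib)
  finally show ?thesis by (simp add: s_def)
qed

lemma continuous_on_phi: "continuous_on (- {0}) phi"
  unfolding phi_def control_eq
  by (intro continuous_intros) auto

text \<open>The logarithm \<open>s\<close> of the norm solves \<open>Q (dl (- s) *v x) = 1\<close>.
  Its rate is minus the quotient of the derivative in time at frozen \<open>s\<close>, which is
  \<open>2 * exp (mu * s) * qF\<close>, and the derivative in \<open>s\<close>, which is
  \<open>- 2 * qG\<close>.\<close>

lemma ln_hnorm_derivative:
  assumes nz: "\<And>r. r \<in> J \<Longrightarrow> x r \<noteq> 0" and cont: "continuous_on J x" and t: "t \<in> J"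
    and der: "(x has_vector_derivative phi (x t)) (at t within J)"
  shows "((\<lambda>r. ln (hn (x r))) has_real_derivative - exp (mu * ln (hn (x t))) * rho (proj (x t)))
    (at t within J)"
proof -
  define s where "s = ln (hn (x t))"
  have "((\<lambda>r. ln (hn (x r))) has_real_derivative
      - (2 * (exp (mu * s) * qF (proj (x t)))) / (- 2 * qG (dl (- ln (hn (x t))) *v x t))) (at t within J)"
  proof (rule implicit_function_derivative[OF t, where f = "\<lambda>t \<sigma>. Q (dl (- \<sigma>) *v x t)" and c = 1])
    show "Q (dl (- ln (hn (x r))) *v x r) = 1" if "r \<in> J" for r
      using Q_proj[OF nz[OF that]] by (simp add: proj_def)
    show "((\<lambda>\<sigma>. Q (dl (- \<sigma>) *v x r)) has_real_derivative - 2 * qG (dl (- \<sigma>) *v x r)) (at \<sigma>)" for r \<sigma>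
      by (rule Q_dil_derivative)
    show "- 2 * qG (dl (- \<sigma>) *v x r) \<noteq> 0" if "r \<in> J" for r \<sigma>
      using qG_pos[of "dl (- \<sigma>) *v x r"] nz[OF that] by simp
    show "continuous_on (J \<times> UNIV) (\<lambda>(r, \<sigma>). - 2 * qG (dl (- \<sigma>) *v x r))"
      unfolding case_prod_unfold
      by (intro continuous_intros continuous_on_compose2[OF cont]) auto
    have "((\<lambda>r. dl (- s) *v x r) has_vector_derivative
        0 *\<^sub>R (G *v (dl (- s) *v x t)) + dl (- s) *v phi (x t)) (at t within J)"
      by (rule has_vector_derivative_dil[OF _ der]) (auto intro!: derivative_eq_intros)
    from Q_derivative[OF this]
    have "((\<lambda>r. Q (dl (- s) *v x r)) has_real_derivative
        2 * (proj (x t) \<bullet> (P *v (dl (- s) *v phi (x t))))) (at t within J)"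
      by (simp add: s_def proj_def)
    moreover have "dl (- s) *v phi (x t) = exp (mu * s) *\<^sub>R (F *v proj (x t))"
      using phi_eq[OF nz[OF t]] by (simp add: s_def[symmetric] dil_dil matrix_vector_mult_scaleR)
    ultimately show "((\<lambda>r. Q (dl (- ln (hn (x t))) *v x r)) has_real_derivative
        2 * (exp (mu * s) * qF (proj (x t)))) (at t within J)"
      by (simp add: s_def[symmetric] qF_def matrix_vector_mult_scaleR)
    show "continuous (at t within J) (\<lambda>r. ln (hn (x r)))"
    proof -
      have "continuous_on J (\<lambda>r. ln (hn (x r)))"
        using nz by (intro continuous_intros cont) auto
      then show ?thesis using t by (simp add: continuous_on_eq_continuous_within)
    qed
  qed
  moreover have "dl (- ln (hn (x t))) *v x t = proj (x t)" by (simp add: proj_def)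
  ultimately show ?thesis by (simp add: s_def rho_def)
qed

text \<open>The term with \<open>rho\<close> and \<open>G\<close> is the contribution of the moving
  dilation parameter.\<close>

lemma proj_derivative:
  assumes nz: "\<And>r. r \<in> J \<Longrightarrow> x r \<noteq> 0" and cont: "continuous_on J x" and t: "t \<in> J"
    and der: "(x has_vector_derivative phi (x t)) (at t within J)"
  shows "((\<lambda>r. proj (x r)) has_vector_derivative
    exp (mu * ln (hn (x t))) *\<^sub>R (F *v proj (x t) + rho (proj (x t)) *\<^sub>R (G *v proj (x t)))) (at t within J)"
proof -
  define s where "s = ln (hn (x t))"
  have "dl (- s) *v phi (x t) = exp (mu * s) *\<^sub>R (F *v proj (x t))"
    using phi_eq[OF nz[OF t]] by (simp add: s_def[symmetric] dil_dil matrix_vector_mult_scaleR)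
  moreover have "((\<lambda>r. dl (- ln (hn (x r))) *v x r) has_vector_derivative
      (exp (mu * s) * rho (proj (x t))) *\<^sub>R (G *v (dl (- ln (hn (x t))) *v x t))
        + dl (- ln (hn (x t))) *v phi (x t)) (at t within J)"
    using DERIV_minus[OF ln_hnorm_derivative[OF assms]]
    by (intro has_vector_derivative_dil der) (simp add: s_def)
  moreover have "dl (- s) *v x t = proj (x t)" by (simp add: proj_def s_def)
  ultimately show ?thesis
    unfolding proj_def[symmetric] s_def[symmetric] by (simp add: scaleR_add_right add.commute)
qed

end

section \<open>Solutions of a single block\<close>

lemma quadratic_form_diff_bound:
  fixes M :: "real ^ 'n ^ 'n"
  assumes "\<And>x y. \<bar>x \<bullet> (M *v y)\<bar> \<le> C * norm x * norm y"
  shows "\<bar>y \<bullet> (M *v y) - x \<bullet> (M *v x)\<bar> \<le> C * norm (y - x) * (norm x + norm y)"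
proof -
  have "y \<bullet> (M *v y) - x \<bullet> (M *v x) = (y - x) \<bullet> (M *v y) + x \<bullet> (M *v (y - x))"
    by (simp add: matrix_vector_mult_diff_distrib inner_diff_left inner_diff_right)
  then show ?thesis
    using assms[of "y - x" y] assms[of x "y - x"] by (simp add: algebra_simps)
qed

context homogeneous_chain
begin

text \<open>The common core of both solution concepts. At a zero only continuity is demanded, since
  for \<open>mu = -1\<close> the velocity there is not determined by the field.\<close>

definition block_solution :: "real set \<Rightarrow> (real \<Rightarrow> 'n colvec) \<Rightarrow> bool" where
  "block_solution J x \<longleftrightarrow> continuous_on J x \<and>
    (\<forall>t\<in>J. x t \<noteq> 0 \<longrightarrow> (x has_vector_derivative phi (x t)) (at t within J))"

lemma block_solution_subset: "block_solution J x \<Longrightarrow> K \<subseteq> J \<Longrightarrow> block_solution K x"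
  unfolding block_solution_def
  by (meson continuous_on_subset has_vector_derivative_within_subset subsetD)

lemma block_solution_derivative_at:
  assumes "block_solution {a..b} x" "a < t" "t < b" "x t \<noteq> 0"
  shows "(x has_vector_derivative phi (x t)) (at t)"
proof -
  have "(x has_vector_derivative phi (x t)) (at t within {a..b})"
    using assms by (simp add: block_solution_def)
  then show ?thesis using assms by (metis at_within_Icc_at)
qed

text \<open>The exponent \<open>- mu\<close> is the one for which the factor
  \<open>exp (mu * s)\<close> in the rate of \<open>s\<close> cancels.\<close>

lemma block_solution_hnorm_derivative:
  assumes sol: "block_solution {a..b} x" and t: "a < t" "t < b" "x t \<noteq> 0"
  shows "((\<lambda>r. hn (x r) powr (- mu)) has_real_derivative mu * rho (proj (x t))) (at t)"
proof -
  \<comment> \<open>On this open set the polar coordinates exist, and derivatives within it are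
    two-sided.\<close>
  define J where "J = {r\<in>{a<..<b}. x r \<noteq> 0}"
  have cont: "continuous_on {a<..<b} x"
    using sol by (auto simp: block_solution_def intro: continuous_on_subset)
  have "open J"
  proof -
    have "J = {a<..<b} \<inter> x -` (- {0})" by (auto simp: J_def)
    then show ?thesis using continuous_open_preimage[OF cont open_greaterThanLessThan open_Compl[OF closed_singleton]] by simp
  qed
  have tJ: "t \<in> J" using t by (simp add: J_def)
  define s where "s = ln (hn (x t))"
  have "((\<lambda>r. ln (hn (x r))) has_real_derivative - exp (mu * s) * rho (proj (x t))) (at t within J)"
    unfolding s_def
    using block_solution_derivative_at[OF sol t]
    by (intro ln_hnorm_derivative tJ) (auto simp: J_def intro: continuous_on_subset[OF cont] has_vector_derivative_at_within)
  then have ds: "((\<lambda>r. ln (hn (x r))) has_real_derivative - exp (mu * s) * rho (proj (x t))) (at t)"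
    using at_within_open[OF tJ \<open>open J\<close>] by simp
  have "((\<lambda>r. exp (- mu * ln (hn (x r)))) has_real_derivative
      exp (- mu * s) * (- mu * (- exp (mu * s) * rho (proj (x t))))) (at t)"
    using DERIV_fun_exp[OF DERIV_cmult[OF ds, of "- mu"]] by (simp add: s_def)
  also have "exp (- mu * s) * (- mu * (- exp (mu * s) * rho (proj (x t)))) = mu * rho (proj (x t))"
    by (simp add: exp_minus)
  finally show ?thesis
    by (rule has_field_derivative_transform_within_open[OF _ \<open>open J\<close> tJ])
      (auto simp: J_def powr_def)
qed

text \<open>The rate is \<open>- mu\<close> times the lower bound of \<open>rho\<close>, hence
  common to all solutions; the maximum with 0 accounts for solutions that reach the origin.\<close>

lemma block_solution_decay:
  obtains \<kappa> where "0 < \<kappa>" "\<And>x a b. block_solution {a..b} x \<Longrightarrow> a \<le> b \<Longrightarrow>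
    hn (x b) powr (- mu) \<le> max 0 (hn (x a) powr (- mu) - \<kappa> * (b - a))"
proof -
  obtain c where c: "c > 0" "\<And>y. y \<noteq> 0 \<Longrightarrow> c \<le> rho y" using rho_bounds by metis
  show ?thesis
  proof
    show "0 < - mu * c" using c mu by (simp add: mult_neg_pos)
    fix x a b assume sol: "block_solution {a..b} x" and ab: "a \<le> (b::real)"
    show "hn (x b) powr (- mu) \<le> max 0 (hn (x a) powr (- mu) - (- mu * c) * (b - a))"
    proof (rule decay_to_zero[OF ab])
      have "continuous_on {a..b} x" using sol by (simp add: block_solution_def)
      then show "continuous_on {a..b} (\<lambda>t. hn (x t) powr (- mu))"
        using mu hnorm_nonneg by (intro continuous_on_powr' continuous_intros) auto
      show "0 \<le> - mu * c" using c mu by (simp add: mult_nonpos_nonneg)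
      fix t assume t: "a < t" "t < b" and "hn (x t) powr (- mu) \<noteq> 0"
      then have nz: "x t \<noteq> 0" by auto
      have "mu * rho (proj (x t)) \<le> - (- mu * c)"
        using c(2)[OF proj_nonzero[OF nz]] mu by simp
      then show "\<exists>D\<le>- (- mu * c). ((\<lambda>t. hn (x t) powr (- mu)) has_real_derivative D) (at t)"
        using block_solution_hnorm_derivative[OF sol t nz] by blast
    qed auto
  qed
qed

lemma block_solution_hnorm_le:
  assumes "block_solution {a..b} x" "a \<le> b"
  shows "hn (x b) \<le> hn (x a)"
proof (rule ccontr)
  assume less: "\<not> hn (x b) \<le> hn (x a)"
  obtain \<kappa> where \<kappa>: "0 < \<kappa>"
    "hn (x b) powr (- mu) \<le> max 0 (hn (x a) powr (- mu) - \<kappa> * (b - a))"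
    using block_solution_decay assms by metis
  have "hn (x a) powr (- mu) < hn (x b) powr (- mu)"
    using less mu hnorm_nonneg by (intro powr_less_mono2) auto
  moreover have "0 \<le> \<kappa> * (b - a)" using \<kappa> assms by simp
  moreover have "0 \<le> hn (x a) powr (- mu)" by simp
  ultimately show False using \<kappa>(2) by linarith
qed

lemma block_solution_zero_absorbing:
  assumes "block_solution {a..b} x" "a \<le> b" "x a = 0"
  shows "x b = 0"
  using block_solution_hnorm_le[OF assms(1,2)] hnorm_nonneg[of "x b"] assms(3) by simp

text \<open>After its first zero a solution stays at 0, where the equation holds trivially. Only the
  first zero itself may be a kink, and the fundamental theorem allows one exceptional point.\<close>

lemma block_solution_has_integral:
  assumes sol: "block_solution {a..b} x" and ab: "a \<le> b"
  shows "((\<lambda>r. phi (x r)) has_integral (x b - x a)) {a..b}"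
proof -
  define Z where "Z = {r\<in>{a..b}. x r = 0}"
  have cont: "continuous_on {a..b} x" using sol by (simp add: block_solution_def)
  have "closed Z" unfolding Z_def
    using continuous_closed_preimage_constant[OF cont, of 0] by auto
  then have "compact Z"
    unfolding Z_def by (metis (no_types, lifting) compact_eq_bounded_closed bounded_subset
        bounded_closed_interval mem_Collect_eq subsetI)
  \<comment> \<open>\<open>c\<close> is the first zero; without zeros it is an arbitrary point and
    its exclusion costs nothing.\<close>
  then obtain c where c: "Z \<noteq> {} \<Longrightarrow> c \<in> Z" "\<And>t. t \<in> Z \<Longrightarrow> c \<le> t"
    using compact_attains_inf[of Z] by (cases "Z = {}") auto
  have after: "x t = 0" if "Z \<noteq> {}" "c \<le> t" "t \<le> b" for t
  proof (rule block_solution_zero_absorbing)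
    show "x c = 0" "c \<le> t" using c that by (auto simp: Z_def)
    show "block_solution {c..t} x"
      by (rule block_solution_subset[OF sol]) (use c that in \<open>auto simp: Z_def\<close>)
  qed
  show ?thesis
  proof (rule fundamental_theorem_of_calculus_interior_strong[of "{c}"])
    fix t assume t: "t \<in> {a<..<b} - {c}"
    show "(x has_vector_derivative phi (x t)) (at t)"
    proof (cases "x t = 0")
      case True
      then have Z: "t \<in> Z" using t by (simp add: Z_def)
      have "((\<lambda>_. 0) has_vector_derivative phi (x t)) (at t)" using True by simp
      then show ?thesis
        by (rule has_vector_derivative_transform_within_open[where S="{c<..<b}"])
          (use Z c(2)[OF Z] t after in force)+
    qed (use t block_solution_derivative_at[OF sol] in auto)
  qed (use ab cont in auto)
qed

section \<open>A priori bounds for states and velocities\<close>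

lemma norm_le_hnorm:
  obtains Y where "Y > 0" "\<And>x. hn x \<le> 1 \<Longrightarrow> norm x \<le> Y * hn x"
proof -
  obtain Y where Y: "Y > 0" "\<And>x. norm (proj x) \<le> Y" using proj_bounded by blast
  have "norm x \<le> Y * hn x" if h: "hn x \<le> 1" for x
  proof (cases "x = 0")
    case False
    \<comment> \<open>All grades are at least 1, so a dilation with nonpositive parameter contracts
      at least as much as the scalar \<open>hn x\<close>.\<close>
    have "norm x \<le> exp (ln (hn x)) * norm (proj x)"
      using norm_dil_le[of mu "ln (hn x)" "proj x"] mu h hnorm_pos[OF False]
      by (simp add: dil_proj)
    also have "\<dots> \<le> hn x * Y"
      using Y(2)[of x] hnorm_pos[OF False] by simp
    finally show ?thesis by (simp add: mult.commute)
  qed simp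
  then show ?thesis using Y(1) by (intro that)
qed

lemma bounded_hnorm_sublevel: "bounded {x. hn x \<le> M}"
proof -
  define m where "m = max M 1"
  have m: "m > 0" by (simp add: m_def)
  obtain Y where Y: "Y > 0" "\<And>x. hn x \<le> 1 \<Longrightarrow> norm x \<le> Y * hn x" using norm_le_hnorm by blast
  have "{x. hn x \<le> M} \<subseteq> (*v) (dl (ln m)) ` cball 0 Y"
  proof
    fix x assume "x \<in> {x. hn x \<le> M}"
    then have "hn x \<le> m" by (simp add: m_def)
    define z where "z = dl (- ln m) *v x"
    have hz: "hn z \<le> 1" using m \<open>hn x \<le> m\<close> by (simp add: z_def hnorm_dil exp_minus field_simps)
    then have "norm z \<le> Y * 1"
      using Y by (meson mult_left_mono less_imp_le order_trans)
    moreover have "x = dl (ln m) *v z" by (simp add: z_def dil_dil)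
    ultimately show "x \<in> (*v) (dl (ln m)) ` cball 0 Y" by auto
  qed
  moreover have "bounded ((*v) (dl (ln m)) ` cball 0 Y)"
    by (intro bounded_linear_image bounded_cball matrix_vector_mul_bounded_linear)
  ultimately show ?thesis by (rule bounded_subset[rotated])
qed

lemma control_bound:
  obtains C where "C > 0" "\<And>x. \<bar>control lam mu P x\<bar> \<le> C * hn x powr (1 + mu)"
proof -
  obtain Y where Y: "Y > 0" "\<And>x. norm (proj x) \<le> Y" using proj_bounded by blast
  let ?C = "(norm (K_lin lam :: 'n colvec) + 1) * Y"
  have "\<bar>control lam mu P x\<bar> \<le> ?C * hn x powr (1 + mu)" for x
  proof -
    have "\<bar>K_lin lam \<bullet> proj x\<bar> \<le> norm (K_lin lam :: 'n colvec) * norm (proj x)"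
      by (rule Cauchy_Schwarz_ineq2)
    also have "\<dots> \<le> ?C" using Y by (intro mult_mono) auto
    finally have "\<bar>K_lin lam \<bullet> proj x\<bar> * hn x powr (1 + mu) \<le> ?C * hn x powr (1 + mu)"
      by (rule mult_right_mono) simp
    then show ?thesis by (simp add: control_eq abs_mult mult.commute)
  qed
  then show ?thesis using Y by (intro that[of ?C] mult_pos_pos add_nonneg_pos) auto
qed

text \<open>Since \<open>1 + mu\<close> is nonnegative, the control stays bounded near the origin
  even when it is discontinuous there. This is the source of the Lipschitz bound on
  solutions.\<close>

lemma phi_bound:
  obtains C where "\<And>x. hn x \<le> M \<Longrightarrow> norm (phi x) \<le> C"
proof -
  obtain B where B: "\<And>x. hn x \<le> M \<Longrightarrow> norm x \<le> B"
    using bounded_hnorm_sublevel[of M] by (auto simp: bounded_iff)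
  obtain a where a: "a > 0" "\<And>y. norm ((A_mat :: 'n sqmat) *v y) \<le> norm y * a"
    using bounded_linear.pos_bounded[OF matrix_vector_mul_bounded_linear[of "A_mat :: 'n sqmat"]] by blast
  obtain C where C: "C > 0" "\<And>x. \<bar>control lam mu P x\<bar> \<le> C * hn x powr (1 + mu)"
    using control_bound by blast
  have "norm (phi x) \<le> B * a + C * M powr (1 + mu) * norm (B_vec :: 'n colvec)" if "hn x \<le> M" for x
  proof -
    have "norm (phi x) \<le> norm (A_mat *v x) + \<bar>control lam mu P x\<bar> * norm (B_vec :: 'n colvec)"
      unfolding phi_def by (metis norm_triangle_ineq norm_scaleR real_norm_def)
    moreover have "norm (A_mat *v x) \<le> B * a"
      using a B[OF that] by (meson mult_right_mono less_imp_le order_trans)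
    moreover have "hn x powr (1 + mu) \<le> M powr (1 + mu)"
      using mu hnorm_nonneg that by (intro powr_mono2) auto
    then have "\<bar>control lam mu P x\<bar> \<le> C * M powr (1 + mu)"
      using C by (meson mult_left_mono less_imp_le order_trans)
    then have "\<bar>control lam mu P x\<bar> * norm (B_vec :: 'n colvec) \<le> C * M powr (1 + mu) * norm (B_vec :: 'n colvec)"
      by (rule mult_right_mono) simp
    ultimately show ?thesis by linarith
  qed
  then show ?thesis by (rule that)
qed

text \<open>For \<open>mu > -1\<close> the control is dominated by a positive power of the norm,
  which forces it to 0 at the origin.\<close>

lemma continuous_on_phi_UNIV:
  assumes "mu \<noteq> -1"
  shows "continuous_on UNIV phi"
proof -
  have m: "0 < 1 + mu" using assms mu by simp
  obtain C where C: "C > 0" "\<And>x. \<bar>control lam mu P x\<bar> \<le> C * hn x powr (1 + mu)"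
    using control_bound by blast
  have "(phi \<longlongrightarrow> phi 0) (at 0)"
  proof -
    have h: "(hn \<longlongrightarrow> 0) (at 0)" using isCont_hnorm[of 0] by (simp add: isCont_def)
    have "((\<lambda>x. C * hn x powr (1 + mu)) \<longlongrightarrow> C * 0 powr (1 + mu)) (at 0)"
      using m hnorm_nonneg by (intro tendsto_intros tendsto_powr' h) auto
    then have "(control lam mu P \<longlongrightarrow> 0) (at 0)"
      by (intro Lim_null_comparison[of "control lam mu P"]) (use C in auto)
    moreover have "((\<lambda>x. A_mat *v x) \<longlongrightarrow> (A_mat :: 'n sqmat) *v 0) (at 0)"
      using linear_continuous_at[OF matrix_vector_mul_bounded_linear[of "A_mat :: 'n sqmat"], of 0]
      by (simp add: isCont_def)
    ultimately have "(phi \<longlongrightarrow> A_mat *v 0 + 0 *\<^sub>R B_vec) (at 0)"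
      unfolding phi_def by (intro tendsto_intros)
    then show ?thesis by simp
  qed
  moreover have "isCont phi x" if "x \<noteq> 0" for x
    using continuous_on_phi that by (auto simp: continuous_on_eq_continuous_at[OF open_Compl[OF closed_singleton]])
  ultimately show ?thesis
    by (metis continuous_at_imp_continuous_on isCont_def)
qed

text \<open>The velocity of \<open>proj x\<close> in the time in which it does not depend on \<open>hn x\<close>.\<close>

definition flow :: "'n colvec \<Rightarrow> 'n colvec" where
  "flow y = F *v y + rho y *\<^sub>R (G *v y)"

lemma flow_0 [simp]: "flow 0 = 0" by (simp add: flow_def)

text \<open>The field is positively homogeneous of degree one, which makes it globally Lipschitz although
  \<open>rho\<close> is discontinuous at the origin.\<close>

lemma flow_lipschitz:
  obtains L where "\<And>x y. norm (flow x - flow y) \<le> L * norm (x - y)"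
proof -
  obtain f where f: "f > 0" "\<And>x y. \<bar>x \<bullet> ((P ** F) *v y)\<bar> \<le> f * norm x * norm y"
    using bilinear_form_bound by blast
  obtain g where g: "g > 0" "\<And>x y. \<bar>x \<bullet> ((P ** G) *v y)\<bar> \<le> g * norm x * norm y"
    using bilinear_form_bound by blast
  obtain l where l: "l > 0" "\<And>x. l * (norm x)\<^sup>2 \<le> qG x" using qG_lower by blast
  obtain c R where R: "c > 0" "R > 0" "\<And>y. y \<noteq> 0 \<Longrightarrow> c \<le> rho y" "\<And>y. y \<noteq> 0 \<Longrightarrow> rho y \<le> R"
    using rho_bounds by blast
  obtain nF where nF: "nF > 0" "\<And>y. norm (F *v y) \<le> norm y * nF"
    using bounded_linear.pos_bounded[OF matrix_vector_mul_bounded_linear[of F]] by blast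
  obtain nG where nG: "nG > 0" "\<And>y. norm (G *v y) \<le> norm y * nG"
    using bounded_linear.pos_bounded[OF matrix_vector_mul_bounded_linear[of G]] by blast
  have R': "\<bar>rho y\<bar> \<le> R" for y
    using R(1,2) R(3,4)[of y] by (cases "y = 0") (auto simp: rho_def qF_def)
  define M where "M = (2 * f + 2 * R * g) / l"
  define L where "L = nF + R * nG + M * nG"
  \<comment> \<open>The function \<open>rho\<close> has no limit at the origin in general, but its
    variation is of the order of the distance over the norm. Writing the difference over
    \<open>qG y\<close>, with \<open>y\<close> the longer vector, and weighting by the shorter one
    absorbs this singularity.\<close>
  have drho: "\<bar>rho x - rho y\<bar> * norm x \<le> M * norm (x - y)" if le: "norm x \<le> norm y" for x y
  proof (cases "x = 0")
    case x: False
    then have y: "norm y > 0" "y \<noteq> 0" using le by auto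
    have qx: "qG x > 0" and qy: "qG y > 0" using qG_pos x y by auto
    have "rho x - rho y = ((qF y - qF x) - rho x * (qG x - qG y)) / qG y"
      using qx qy by (simp add: rho_def field_simps)
    also have "\<bar>\<dots>\<bar> = \<bar>(qF y - qF x) - rho x * (qG x - qG y)\<bar> / qG y" using qy by simp
    also have "\<dots> \<le> ((2 * f + 2 * R * g) * norm (x - y) * norm y) / qG y"
    proof (intro divide_right_mono)
      have "\<bar>qF y - qF x\<bar> \<le> f * norm (y - x) * (norm x + norm y)"
        using quadratic_form_diff_bound[OF f(2), of y x] by (simp add: qF_def matrix_vector_mul_assoc)
      also have "\<dots> \<le> f * norm (y - x) * (2 * norm y)" using f le by (intro mult_left_mono) auto
      finally have 1: "\<bar>qF y - qF x\<bar> \<le> 2 * f * norm (x - y) * norm y"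
        by (simp add: norm_minus_commute)
      have "\<bar>qG y - qG x\<bar> \<le> g * norm (y - x) * (norm x + norm y)"
        using quadratic_form_diff_bound[OF g(2), of y x] by (simp add: qG_def matrix_vector_mul_assoc)
      also have "\<dots> \<le> g * norm (y - x) * (2 * norm y)" using g le by (intro mult_left_mono) auto
      finally have "\<bar>rho x\<bar> * \<bar>qG y - qG x\<bar> \<le> R * (g * norm (y - x) * (2 * norm y))"
        using R'[of x] by (intro mult_mono) auto
      then have 2: "\<bar>rho x * (qG x - qG y)\<bar> \<le> 2 * R * g * norm (x - y) * norm y"
        by (simp add: abs_mult abs_minus_commute norm_minus_commute mult_ac)
      show "\<bar>(qF y - qF x) - rho x * (qG x - qG y)\<bar> \<le> (2 * f + 2 * R * g) * norm (x - y) * norm y"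
        using 1 2 by (simp add: distrib_right)
    qed (use qy in simp)
    also have "\<dots> \<le> ((2 * f + 2 * R * g) * norm (x - y) * norm y) / (l * (norm y)\<^sup>2)"
      using l(1) l(2)[of y] y f g R qy by (intro divide_left_mono) auto
    also have "\<dots> = M * norm (x - y) / norm y"
      using y by (simp add: M_def power2_eq_square)
    finally have "\<bar>rho x - rho y\<bar> * norm x \<le> (M * norm (x - y) / norm y) * norm x"
      by (rule mult_right_mono) simp
    also have "\<dots> \<le> (M * norm (x - y) / norm y) * norm y"
      using le f g R l by (intro mult_left_mono) (auto simp: M_def)
    also have "\<dots> = M * norm (x - y)" using y by simp
    finally show ?thesis .
  qed (use f g R l in \<open>auto simp: M_def\<close>)
  have half: "norm (flow x - flow y) \<le> L * norm (x - y)" if "norm x \<le> norm y" for x y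
  proof -
    \<comment> \<open>The splitting lets the difference of \<open>rho\<close> multiply the shorter
      vector \<open>x\<close>; the opposite case follows by symmetry.\<close>
    have "flow x - flow y = F *v (x - y) + rho y *\<^sub>R (G *v (x - y)) + (rho x - rho y) *\<^sub>R (G *v x)"
      by (simp add: flow_def matrix_vector_mult_diff_distrib algebra_simps)
    also have "norm \<dots> \<le> norm (F *v (x - y)) + norm (rho y *\<^sub>R (G *v (x - y)))
        + norm ((rho x - rho y) *\<^sub>R (G *v x))"
      by (intro order_trans[OF norm_triangle_ineq] add_mono norm_triangle_ineq order_refl)
    also have "\<dots> \<le> norm (x - y) * nF + R * (norm (x - y) * nG) + \<bar>rho x - rho y\<bar> * (norm x * nG)"
      unfolding norm_scaleR
      using R'[of y] R(2) nF(2)[of "x - y"] nG(2)[of "x - y"] nG(2)[of x] by (intro add_mono mult_mono) auto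
    also have "\<bar>rho x - rho y\<bar> * (norm x * nG) \<le> M * norm (x - y) * nG"
      using mult_right_mono[OF drho[OF that], of nG] nG(1) by (simp add: mult.assoc)
    finally show ?thesis by (simp add: L_def algebra_simps)
  qed
  have "norm (flow x - flow y) \<le> L * norm (x - y)" for x y
    using half[of x y] half[of y x] by (cases "norm x \<le> norm y") (auto simp: norm_minus_commute)
  then show ?thesis by (rule that)
qed

section \<open>Invariance of one block of the homogeneous cone\<close>

definition cone :: "'n colvec set" where
  "cone = {x. \<forall>k<CARD('n). chain_row lam k \<bullet> proj x \<le> 0}"

text \<open>With \<open>z\<close> the negated products, the right-hand side is a combination of the
  entries \<open>k\<close> and \<open>k - 1\<close> of \<open>z\<close> with nonnegative
  coefficients, at most \<open>1 - mu * CARD('n)\<close> and \<open>- mu * CARD('n) * lam\<close>.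
  Each entry is at least the sum \<open>S\<close> of all negative parts. The bound serves both the
  solutions and the dilation flow.\<close>

lemma grade_part_lower_bound:
  fixes y :: "'n colvec"
  assumes k: "k < CARD('n)" and neg: "0 < chain_row lam k \<bullet> y"
    and S: "S = (\<Sum>l<CARD('n). min 0 (- (chain_row lam l \<bullet> y)))"
  shows "(1 - mu * CARD('n) - mu * CARD('n) * lam) * S \<le> - (chain_row lam k \<bullet> (G *v y))"
proof -
  let ?z = "\<lambda>l. - (chain_row lam l \<bullet> y)"
  have zS: "S \<le> min 0 (?z l)" if "l < CARD('n)" for l
  proof -
    have "(\<Sum>l\<in>{..<CARD('n)} - {l}. min 0 (?z l)) \<le> 0" by (intro sum_nonpos) auto
    moreover have "S = min 0 (?z l) + (\<Sum>l\<in>{..<CARD('n)} - {l}. min 0 (?z l))"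
      using that unfolding S by (subst sum.remove[of _ l]) auto
    ultimately show ?thesis by linarith
  qed
  have S0: "S \<le> 0" unfolding S by (intro sum_nonpos) auto
  define g where "g = 1 - mu * (real CARD('n) - real (Suc k))"
  have "mu * (real CARD('n) - real (Suc k)) \<le> 0" "mu * real (Suc k) \<le> 0"
    using k mu by (intro mult_nonpos_nonneg; simp)+
  then have g: "0 \<le> g" "g \<le> 1 - mu * CARD('n)"
    unfolding g_def right_diff_distrib by linarith+
  have "(1 - mu * CARD('n)) * S \<le> g * S" using g S0 by (intro mult_right_mono_neg) auto
  also have "\<dots> \<le> g * ?z k" using g zS[OF k] by (intro mult_left_mono) auto
  finally have 1: "(1 - mu * CARD('n)) * S \<le> g * ?z k" .
  have c: "0 \<le> - mu * real k * lam" "- mu * real k * lam \<le> - mu * CARD('n) * lam"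
    using mu lam k by (auto intro!: mult_right_mono simp: mult_nonpos_nonneg mult_le_0_iff)
  have "(- mu * CARD('n) * lam) * S \<le> (- mu * real k * lam) * S"
    by (rule mult_right_mono_neg[OF c(2) S0])
  also have "\<dots> \<le> (- mu * real k * lam) * ?z (k - 1)"
    using c zS[of "k - 1"] k by (intro mult_left_mono) auto
  finally have 2: "(- mu * CARD('n) * lam) * S \<le> (- mu * real k * lam) * ?z (k - 1)" .
  have "- (chain_row lam k \<bullet> (G *v y)) = g * ?z k + (- mu * real k * lam) * ?z (k - 1)"
    unfolding chain_row_G_mat g_def by (simp add: algebra_simps)
  with 1 2 show ?thesis by (simp add: algebra_simps)
qed

lemma grade_part_constant_nonneg: "0 \<le> 1 - mu * CARD('n) - mu * CARD('n) * lam"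
proof -
  have "mu * CARD('n) \<le> 0" "mu * CARD('n) * lam \<le> 0"
    using mu lam by (intro mult_nonpos_nonneg; simp add: mult_nonpos_nonneg)+
  then show ?thesis by linarith
qed

lemma block_solution_cone_invariant:
  assumes sol: "block_solution {0..t} x" and t: "0 \<le> t" and init: "x 0 \<in> cone"
  shows "x t \<in> cone"
proof (cases "x t = 0")
  case False
  \<comment> \<open>Otherwise the solution would have stayed at the origin; so the projection is
    defined on all of \<open>{0..t}\<close>.\<close>
  have nz: "x r \<noteq> 0" if "r \<in> {0..t}" for r
    using block_solution_zero_absorbing[of r t x] block_solution_subset[OF sol, of "{r..t}"] that False by auto
  have cont: "continuous_on {0..t} x" using sol by (simp add: block_solution_def)
  obtain c R where R: "c > 0" "R > 0" "\<And>y. y \<noteq> 0 \<Longrightarrow> c \<le> rho y" "\<And>y. y \<noteq> 0 \<Longrightarrow> rho y \<le> R"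
    using rho_bounds by blast
  define m where "m = 1 - mu * CARD('n) - mu * CARD('n) * lam"
  have m: "0 \<le> m" using grade_part_constant_nonneg by (simp add: m_def)
  \<comment> \<open>The exponential is the largest speed factor on \<open>{0..t}\<close>, because
    the norm is smallest at \<open>t\<close> and \<open>mu < 0\<close>. The summands 1 and
    \<open>R * m\<close> bound the parts with \<open>F\<close> and \<open>G\<close>.\<close>
  define C where "C = exp (mu * ln (hn (x t))) * (1 + R * m)"
  define z where "z = (\<lambda>k r. - (chain_row lam k \<bullet> proj (x r)))"
  define D where "D = (\<lambda>k r. - (chain_row lam k \<bullet> (exp (mu * ln (hn (x r))) *\<^sub>R flow (proj (x r)))))"
  have "0 \<le> z k t" if "k < CARD('n)" for k
  proof (rule orthant_invariance[where I = "{..<CARD('n)}" and C = C and z = z and D = D and T = t])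
    show "0 \<le> C" using m R by (simp add: C_def)
    show "0 \<le> z k 0" if "k \<in> {..<CARD('n)}" for k
      using init that by (simp add: z_def cone_def)
    fix k r assume k: "k \<in> {..<CARD('n)}" and r: "r \<in> {0..t}"
    have "((\<lambda>r. proj (x r)) has_vector_derivative exp (mu * ln (hn (x r))) *\<^sub>R flow (proj (x r)))
        (at r within {0..t})"
      unfolding flow_def using sol nz r by (intro proj_derivative cont) (auto simp: block_solution_def)
    then show "(z k has_real_derivative D k r) (at r within {0..t})"
      unfolding z_def D_def has_real_derivative_iff_has_vector_derivative
      by (intro has_vector_derivative_minus bounded_linear.has_vector_derivative[OF bounded_linear_inner_right])
    assume neg: "z k r < 0"
    let ?y = "proj (x r)"
    define S where "S = (\<Sum>l\<in>{..<CARD('n)}. min 0 (z l r))"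
    have S0: "S \<le> 0" unfolding S_def by (intro sum_nonpos) auto
    have zS: "S \<le> z l r" if "l < CARD('n)" for l
    proof -
      have "(\<Sum>l\<in>{..<CARD('n)} - {l}. min 0 (z l r)) \<le> 0" by (intro sum_nonpos) auto
      moreover have "S = min 0 (z l r) + (\<Sum>l\<in>{..<CARD('n)} - {l}. min 0 (z l r))"
        using that unfolding S_def by (subst sum.remove[of _ l]) auto
      ultimately show ?thesis by linarith
    qed
    have y0: "?y \<noteq> 0" by (rule proj_nonzero[OF nz[OF r]])
    \<comment> \<open>The diagonal term \<open>- lam * z k r\<close> is positive because the
      coordinate is negative, so only the next coordinate can pull downwards.\<close>
    have "S \<le> - (chain_row lam k \<bullet> (F *v ?y))"
    proof -
      have "0 \<le> lam * (chain_row lam k \<bullet> ?y)" using lam neg by (simp add: z_def)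
      then show ?thesis
        using k zS[of "Suc k"] S0
        by (cases "Suc k < CARD('n)") (auto simp: chain_row_closed_loop z_def)
    qed
    moreover have "R * (m * S) \<le> rho ?y * (- (chain_row lam k \<bullet> (G *v ?y)))"
    proof -
      have mS: "m * S \<le> - (chain_row lam k \<bullet> (G *v ?y))"
        unfolding m_def using k neg by (intro grade_part_lower_bound) (auto simp: z_def S_def)
      have "R * (m * S) \<le> rho ?y * (m * S)"
        using R(4)[OF y0] m S0 by (intro mult_right_mono_neg) (auto simp: mult_nonneg_nonpos)
      also have "\<dots> \<le> rho ?y * (- (chain_row lam k \<bullet> (G *v ?y)))"
        using mS rho_pos[OF y0] by (intro mult_left_mono) auto
      finally show ?thesis .
    qed
    ultimately have low: "(1 + R * m) * S \<le> - (chain_row lam k \<bullet> flow ?y)"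
      by (simp add: flow_def inner_add_right algebra_simps)
    have "exp (mu * ln (hn (x r))) \<le> exp (mu * ln (hn (x t)))"
    proof -
      have "hn (x t) \<le> hn (x r)"
        using r by (intro block_solution_hnorm_le block_solution_subset[OF sol]) auto
      then show ?thesis using mu hnorm_pos[OF nz[of t]] hnorm_pos[OF nz[OF r]] t
        by (simp add: mult_le_cancel_left)
    qed
    then have "C * S \<le> exp (mu * ln (hn (x r))) * ((1 + R * m) * S)"
      using m R S0 by (simp add: C_def mult.assoc mult_right_mono_neg mult_nonneg_nonpos)
    also have "\<dots> \<le> exp (mu * ln (hn (x r))) * - (chain_row lam k \<bullet> flow ?y)"
      using low by (intro mult_left_mono) auto
    finally show "C * (\<Sum>l\<in>{..<CARD('n)}. min 0 (z l r)) \<le> D k r"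
      by (simp add: S_def D_def)
  qed (use that t in auto)
  then show ?thesis by (simp add: cone_def z_def)
qed (simp add: cone_def proj_def)

text \<open>The expanding dilation is the linear flow of \<open>G\<close>, whose action on the
  coordinates has nonnegative off-diagonal entries. This carries points of the orthant outwards to
  the unit sphere.\<close>

lemma dil_preserves_chain_orthant:
  assumes init: "\<And>k. k < CARD('n) \<Longrightarrow> chain_row lam k \<bullet> x \<le> 0" and t: "0 \<le> t" and k: "k < CARD('n)"
  shows "chain_row lam k \<bullet> (dl t *v x) \<le> 0"
proof -
  define z where "z = (\<lambda>k r. - (chain_row lam k \<bullet> (dl r *v x)))"
  define D where "D = (\<lambda>k r. - (chain_row lam k \<bullet> (G *v (dl r *v x))))"
  have "0 \<le> z k t"
  proof (rule orthant_invariance[where I = "{..<CARD('n)}" and z = z and D = D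
        and C = "1 - mu * CARD('n) - mu * CARD('n) * lam" and T = t])
    show "0 \<le> 1 - mu * CARD('n) - mu * CARD('n) * lam" by (rule grade_part_constant_nonneg)
    show "0 \<le> z k 0" if "k \<in> {..<CARD('n)}" for k using init that by (simp add: z_def)
    fix k r assume k: "k \<in> {..<CARD('n)}" and r: "r \<in> {0..t}"
    have "((\<lambda>r. dl r *v x) has_vector_derivative 1 *\<^sub>R (G *v (dl r *v x)) + dl r *v 0) (at r within {0..t})"
      by (rule has_vector_derivative_dil) (auto intro!: derivative_eq_intros)
    then show "(z k has_real_derivative D k r) (at r within {0..t})"
      unfolding z_def D_def has_real_derivative_iff_has_vector_derivative
      by (intro has_vector_derivative_minus bounded_linear.has_vector_derivative[OF bounded_linear_inner_right]) simp
    assume "z k r < 0"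
    then show "(1 - mu * CARD('n) - mu * CARD('n) * lam) * (\<Sum>l\<in>{..<CARD('n)}. min 0 (z l r)) \<le> D k r"
      unfolding D_def using k by (intro grade_part_lower_bound) (auto simp: z_def)
  qed (use k t in auto)
  then show ?thesis by (simp add: z_def)
qed

end

section \<open>Existence and continuation\<close>

lemma G_mat_dil: "G_mat mu *v (dil mu s *v x) = dil mu s *v (G_mat mu *v x)"
  by (simp add: vec_eq_iff G_mat_nth dil_nth)

context homogeneous_chain
begin

text \<open>The defining equation of \<open>rho\<close> says that \<open>flow\<close> is tangent to
  the level sets of \<open>Q\<close>.\<close>

lemma flow_Q_constant:
  assumes der: "\<And>t. 0 \<le> t \<Longrightarrow> (y has_vector_derivative flow (y t)) (at t within {0..})" and "0 \<le> t"
  shows "Q (y t) = Q (y 0)"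
proof -
  have "((\<lambda>t. Q (y t)) has_vector_derivative 0) (at r within {0..})" if "r \<in> {0..}" for r
  proof -
    have "y r \<bullet> (P *v flow (y r)) = 0"
    proof -
      have "y r \<bullet> (P *v flow (y r)) = qF (y r) + rho (y r) * qG (y r)"
        unfolding flow_def qF_def qG_def
        by (simp only: matrix_vector_right_distrib inner_add_right matrix_vector_mult_scaleR inner_scaleR_right)
      then show ?thesis using qG_pos[of "y r"] by (cases "y r = 0") (auto simp: rho_def)
    qed
    then show ?thesis
      using Q_derivative[OF der, of r] that by (simp add: has_real_derivative_iff_has_vector_derivative)
  qed
  then obtain c where "\<And>r. r \<in> {0..} \<Longrightarrow> Q (y r) = c"
    using has_vector_derivative_zero_constant[of "{0..}" "\<lambda>t. Q (y t)"] by auto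
  then show ?thesis using \<open>0 \<le> t\<close> by simp
qed

lemma hnorm_eq_1: "Q y = 1 \<Longrightarrow> hn y = 1"
  using hnorm_eqI[of y 0] by (cases "y = 0") auto

text \<open>The solution is \<open>dl (\<sigma> \<tau>) *v y \<tau>\<close> in the new time \<open>\<tau>\<close>, where \<open>y\<close> moves on the unit sphere of
  \<open>P\<close>, \<open>\<sigma>\<close> is the logarithm of the homogeneous norm and \<open>\<theta>\<close> expresses the old time by the new one.\<close>

lemma block_solution_exists: "\<exists>x. block_solution {0..} x \<and> x 0 = x0"
proof (cases "x0 = 0")
  case True
  then show ?thesis by (intro exI[of _ "\<lambda>_. 0"]) (simp add: block_solution_def)
next
  case False
  obtain L where "\<And>x y. norm (flow x - flow y) \<le> L * norm (x - y)" using flow_lipschitz by blast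
  then obtain y where y0: "y 0 = proj x0"
    and y: "\<And>t. 0 \<le> t \<Longrightarrow> (y has_vector_derivative flow (y t)) (at t within {0..})"
    using lipschitz_ode_solution[of flow L] flow_0 by blast
  have Qy: "Q (y t) = 1" if "0 \<le> t" for t
    using flow_Q_constant[OF y that] Q_proj[OF False] y0 by simp
  have ynz: "y t \<noteq> 0" if "0 \<le> t" for t using Qy[OF that] by auto
  have hy: "hn (y t) = 1" "proj (y t) = y t" if "0 \<le> t" for t
    using hnorm_eq_1[OF Qy[OF that]] by (auto simp: proj_def)
  have conty: "continuous_on {0..} y"
    using y by (auto simp: continuous_on_eq_continuous_within intro: has_vector_derivative_continuous)
  \<comment> \<open>\<open>max 0 t\<close> extends the rate to negative times, so that
    antiderivatives on the whole line are available.\<close>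
  have contr: "continuous_on UNIV (\<lambda>t. rho (y (max 0 t)))"
  proof -
    have "continuous_on UNIV (\<lambda>t. y (max 0 t))"
      by (rule continuous_on_compose2[OF conty]) (auto intro!: continuous_intros)
    moreover have "qG (y (max 0 t)) \<noteq> 0" for t using qG_pos[OF ynz, of "max 0 t"] by simp
    ultimately show ?thesis unfolding rho_def by (intro continuous_intros) auto
  qed
  then obtain R where R0: "R 0 = 0" and R: "\<And>t. (R has_vector_derivative rho (y (max 0 t))) (at t)"
    using antiderivative_exists by blast
  define \<sigma> where "\<sigma> = (\<lambda>t. ln (hn x0) - R t)"
  have \<sigma>': "(\<sigma> has_real_derivative - rho (y (max 0 t))) (at t)" for t
    unfolding \<sigma>_def using R[of t]
    by (auto intro!: derivative_eq_intros simp: has_real_derivative_iff_has_vector_derivative[symmetric])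
  have cont\<sigma>: "continuous_on UNIV \<sigma>"
    using \<sigma>' by (meson DERIV_isCont continuous_at_imp_continuous_on)
  \<comment> \<open>The derivative of the old time with respect to the new one, reciprocal to the
    factor \<open>exp (mu * s)\<close>.\<close>
  define g where "g = (\<lambda>t. exp (- mu * \<sigma> t))"
  have "continuous_on UNIV g" unfolding g_def by (intro continuous_intros cont\<sigma>)
  then obtain \<theta> where \<theta>0: "\<theta> 0 = 0" and \<theta>v: "\<And>t. (\<theta> has_vector_derivative g t) (at t)"
    using antiderivative_exists by blast
  then have \<theta>': "(\<theta> has_real_derivative g t) (at t)" for t
    by (simp add: has_real_derivative_iff_has_vector_derivative)
  have cont\<theta>: "continuous_on S \<theta>" for S
    using \<theta>' by (meson DERIV_isCont continuous_at_imp_continuous_on)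
  have mono: "\<theta> s < \<theta> t" if "s < t" for s t
  proof (rule DERIV_pos_imp_increasing[OF that])
    show "\<exists>D. (\<theta> has_real_derivative D) (at r) \<and> 0 < D" for r
      using \<theta>'[of r] by (intro exI[of _ "g r"]) (simp add: g_def)
  qed
  have mono_iff: "\<theta> s < \<theta> t \<longleftrightarrow> s < t" for s t using mono by (metis linorder_neqE less_asym)
  have "inj \<theta>" using mono by (intro injI) (metis linorder_neqE less_irrefl)
  define \<iota> where "\<iota> = inv \<theta>"
  have \<iota>: "\<iota> (\<theta> t) = t" for t unfolding \<iota>_def using \<open>inj \<theta>\<close> by simp
  have \<iota>': "(\<iota> has_real_derivative exp (mu * \<sigma> t)) (at (\<theta> t))" for t
  proof -
    have "(\<iota> has_derivative (\<lambda>h. h / g t)) (at (\<theta> t))"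
      by (rule has_derivative_inverse_strong[of UNIV t \<theta> \<iota> "\<lambda>h. g t * h"])
        (use \<theta>'[of t] cont\<theta> \<iota> in \<open>auto simp: has_field_derivative_def g_def fun_eq_iff\<close>)
    then show ?thesis
      by (rule has_derivative_imp_has_field_derivative) (simp add: g_def exp_minus field_simps)
  qed
  define Z where "Z = (\<lambda>t. dl (\<sigma> t) *v y t)"
  have hZ: "hn (Z t) = exp (\<sigma> t)" "proj (Z t) = y t" "Z t \<noteq> 0" if "0 \<le> t" for t
    using hy[OF that] ynz[OF that] by (auto simp: Z_def hnorm_dil proj_dil)
  have Z': "(Z has_vector_derivative dl (\<sigma> t) *v (F *v y t)) (at t within {0..})" if "0 \<le> t" for t
  proof -
    have "(Z has_vector_derivative (- rho (y t)) *\<^sub>R (G *v (dl (\<sigma> t) *v y t)) + dl (\<sigma> t) *v flow (y t))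
        (at t within {0..})"
      unfolding Z_def using \<sigma>'[of t] that
      by (intro has_vector_derivative_dil y) (auto intro: has_field_derivative_at_within)
    also have "(- rho (y t)) *\<^sub>R (G *v (dl (\<sigma> t) *v y t)) + dl (\<sigma> t) *v flow (y t) = dl (\<sigma> t) *v (F *v y t)"
      by (simp add: flow_def G_mat_dil matrix_vector_right_distrib matrix_vector_mult_scaleR)
    finally show ?thesis .
  qed
  have range: "t \<in> \<theta> ` {0..}" if t: "0 \<le> t" "t \<le> \<theta> r" for t r
  proof -
    have "0 \<le> r" using t \<theta>0 mono_iff[of r 0] by linarith
    then obtain s where "0 \<le> s" "s \<le> r" "\<theta> s = t"
      using IVT'[of \<theta> 0 t r] t \<theta>0 cont\<theta> by auto
    then show ?thesis by auto
  qed
  \<comment> \<open>The new time may exhaust only a bounded interval of the old one; from its end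
    on, the solution is continued by 0.\<close>
  define x where "x = (\<lambda>t. if t \<in> \<theta> ` {0..} then Z (\<iota> t) else 0)"
  have x\<theta>: "x (\<theta> t) = Z t" if "0 \<le> t" for t using that by (simp add: x_def \<iota>)
  have x': "(x has_vector_derivative phi (x (\<theta> t))) (at (\<theta> t) within {0..})" if t: "0 \<le> t" for t
  proof -
    define S where "S = {0..<\<theta> (t + 1)}"
    have \<theta>t: "0 \<le> \<theta> t" "\<theta> t < \<theta> (t + 1)" using t mono[of 0 t] mono[of t "t + 1"] \<theta>0 by (cases "t = 0"; simp)+
    have SR: "S \<subseteq> \<theta> ` {0..}" unfolding S_def using range[of _ "t + 1"] by force
    then have "\<iota> ` S \<subseteq> {0..}" using \<iota> by fastforce
    have "((Z \<circ> \<iota>) has_vector_derivative exp (mu * \<sigma> t) *\<^sub>R (dl (\<sigma> t) *v (F *v y t))) (at (\<theta> t) within S)"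
    proof (rule vector_diff_chain_within)
      show "(\<iota> has_vector_derivative exp (mu * \<sigma> t)) (at (\<theta> t) within S)"
        using \<iota>'[of t] by (auto simp: has_real_derivative_iff_has_vector_derivative[symmetric]
            intro: has_field_derivative_at_within)
      show "(Z has_vector_derivative dl (\<sigma> t) *v (F *v y t)) (at (\<iota> (\<theta> t)) within \<iota> ` S)"
        unfolding \<iota> by (rule has_vector_derivative_within_subset[OF Z'[OF t] \<open>\<iota> ` S \<subseteq> {0..}\<close>])
    qed
    also have "exp (mu * \<sigma> t) *\<^sub>R (dl (\<sigma> t) *v (F *v y t)) = phi (x (\<theta> t))"
      using phi_eq[OF hZ(3)[OF t]] hZ[OF t] x\<theta>[OF t] by simp
    finally have "(x has_vector_derivative phi (x (\<theta> t))) (at (\<theta> t) within S)"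
      by (rule has_vector_derivative_transform[rotated 2]) (use SR \<theta>t in \<open>auto simp: S_def x_def\<close>)
    moreover have "at (\<theta> t) within S = at (\<theta> t) within {0..}"
      by (rule at_within_nhd[of _ "{..<\<theta> (t + 1)}"]) (use \<theta>t in \<open>auto simp: S_def\<close>)
    ultimately show ?thesis by simp
  qed
  obtain c where c: "c > 0" "\<And>y. y \<noteq> 0 \<Longrightarrow> c \<le> rho y" using rho_bounds by metis
  have \<sigma>le: "\<sigma> t \<le> ln (hn x0) + (- c) * t" if "0 \<le> t" for t
  proof -
    have "\<sigma> t \<le> \<sigma> 0 + (- c) * (t - 0)"
    proof (rule nonincreasing_of_derivative_le[OF that])
      show "continuous_on {0..t} \<sigma>" by (rule continuous_on_subset[OF cont\<sigma>]) simp
      show "\<exists>D\<le>- c. (\<sigma> has_real_derivative D) (at r)" if "0 < r" for r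
        using \<sigma>'[of r] c(2)[OF ynz[of r]] that by (intro exI[of _ "- rho (y r)"]) auto
    qed
    then show ?thesis by (simp add: \<sigma>_def R0)
  qed
  obtain Y where Y: "Y > 0" "\<And>x. hn x \<le> 1 \<Longrightarrow> norm x \<le> Y * hn x" using norm_le_hnorm by blast
  \<comment> \<open>As \<sigma> decreases without bound, the curve tends to the origin. This gives
    continuity where the continuation by 0 begins.\<close>
  have small: "\<exists>s\<ge>0. \<forall>t\<ge>s. norm (Z t) < e" if e: "0 < e" for e
  proof -
    define b where "b = min 0 (ln (e / (2 * Y)))"
    define s where "s = max 0 ((ln (hn x0) - b) / c)"
    have "norm (Z t) < e" if "t \<ge> s" for t
    proof -
      have t: "0 \<le> t" "(ln (hn x0) - b) / c \<le> t" using that by (auto simp: s_def)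
      then have "\<sigma> t \<le> b" using \<sigma>le[OF t(1)] c(1) by (simp add: field_simps)
      then have "exp (\<sigma> t) \<le> exp b" by simp
      moreover have "exp b \<le> 1" by (simp add: b_def)
      moreover have "exp b \<le> e / (2 * Y)"
      proof -
        have "exp b \<le> exp (ln (e / (2 * Y)))" by (simp add: b_def)
        then show ?thesis using e Y(1) by simp
      qed
      ultimately have "hn (Z t) \<le> 1" "hn (Z t) \<le> e / (2 * Y)" using hZ(1)[OF t(1)] by linarith+
      then have "norm (Z t) \<le> Y * (e / (2 * Y))"
        using Y by (meson mult_left_mono less_imp_le order_trans)
      then show ?thesis using Y(1) e by simp
    qed
    then show ?thesis by (intro exI[of _ s]) (simp add: s_def)
  qed
  have "continuous_on {0..} x"
    unfolding continuous_on_eq_continuous_within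
  proof
    fix t :: real assume "t \<in> {0..}"
    show "continuous (at t within {0..}) x"
    proof (cases "t \<in> \<theta> ` {0..}")
      case True
      then show ?thesis using x' has_vector_derivative_continuous by blast
    next
      case out: False
      have out': "\<theta> r < t" for r using range[of t r] out \<open>t \<in> {0..}\<close> by (meson atLeast_iff not_le)
      show ?thesis
        unfolding continuous_within_eps_delta
      proof (intro allI impI)
        fix e :: real assume "e > 0"
        then obtain s where s: "s \<ge> 0" "\<And>r. r \<ge> s \<Longrightarrow> norm (Z r) < e" using small by blast
        \<comment> \<open>Within this distance of \<open>t\<close>, a time is either outside the
          image of \<theta>, where \<open>x\<close> is 0, or comes from a parameter beyond
          \<open>s\<close>, where \<open>Z\<close> is already small.\<close>
        have "norm (x r) < e" if "r \<in> {0..}" "dist r t < t - \<theta> s" for r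
        proof (cases "r \<in> \<theta> ` {0..}")
          case True
          then obtain q where q: "q \<ge> 0" "r = \<theta> q" by auto
          have "\<theta> s < \<theta> q" using that q by (auto simp: dist_real_def)
          then show ?thesis using q s(2)[of q] x\<theta>[of q] mono_iff by simp
        qed (use \<open>e > 0\<close> in \<open>simp add: x_def\<close>)
        moreover have "x t = 0" using out by (simp add: x_def)
        ultimately show "\<exists>d>0. \<forall>r\<in>{0..}. dist r t < d \<longrightarrow> dist (x r) (x t) < e"
          using out'[of s] by (intro exI[of _ "t - \<theta> s"]) auto
      qed
    qed
  qed
  moreover have "(x has_vector_derivative phi (x t)) (at t within {0..})" if "t \<in> {0..}" "x t \<noteq> 0" for t
  proof -
    have "t \<in> \<theta> ` {0..}" using that by (metis x_def)
    then show ?thesis using x' by auto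
  qed
  moreover have "x 0 = x0"
    using x\<theta>[of 0] y0 \<theta>0 dil_proj[of x0] by (simp add: Z_def \<sigma>_def R0)
  ultimately show ?thesis by (auto simp: block_solution_def)
qed

text \<open>Integral representation with a velocity bounded on sublevels of the norm. It gives the
  limit at the end of a bounded time interval as well as absolute continuity.\<close>

lemma block_solution_lipschitz:
  assumes sol: "\<And>a b. a \<in> J \<Longrightarrow> b \<in> J \<Longrightarrow> a \<le> b \<Longrightarrow> block_solution {a..b} x"
    and bound: "\<And>t. t \<in> J \<Longrightarrow> hn (x t) \<le> M"
  obtains C where "C-lipschitz_on J x"
proof -
  obtain C where C: "\<And>x. hn x \<le> M \<Longrightarrow> norm (phi x) \<le> C" using phi_bound by blast
  have C': "norm (phi x) \<le> max 0 C" if "hn x \<le> M" for x using C[OF that] by simp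
  have le: "norm (x b - x a) \<le> max 0 C * (b - a)" if "a \<in> J" "b \<in> J" "a \<le> b" for a b
  proof -
    have "norm (x b - x a) \<le> max 0 C * measure lborel (cbox a b)"
    proof (rule has_integral_bound)
      show "((\<lambda>r. phi (x r)) has_integral (x b - x a)) (cbox a b)"
        using block_solution_has_integral[OF sol] that by simp
      fix r assume r: "r \<in> cbox a b"
      have "hn (x r) \<le> hn (x a)"
        using block_solution_hnorm_le[of a r x] block_solution_subset[OF sol[OF that], of "{a..r}"] r by auto
      then show "norm (phi (x r)) \<le> max 0 C" using bound[OF that(1)] by (intro C') simp
    qed simp
    then show ?thesis using that by simp
  qed
  have "(max 0 C)-lipschitz_on J x"
  proof (rule lipschitz_onI)
    fix a b assume "a \<in> J" "b \<in> J"
    then show "dist (x a) (x b) \<le> max 0 C * dist a b"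
      using le[of a b] le[of b a] by (cases "a \<le> b") (auto simp: dist_norm norm_minus_commute)
  qed simp
  then show ?thesis by (rule that)
qed

text \<open>The Lipschitz bound provides a limit at \<tau>, from which a new solution is started and
  appended.\<close>

lemma block_solution_extend:
  assumes sol: "block_solution {0..<\<tau>} x" and \<tau>: "0 < \<tau>"
  shows "\<exists>x'. block_solution {0..} x' \<and> (\<forall>t\<in>{0..<\<tau>}. x' t = x t)"
proof -
  have sub: "block_solution {a..b} x" if "a \<in> {0..<\<tau>}" "b \<in> {0..<\<tau>}" for a b
    by (rule block_solution_subset[OF sol]) (use that in auto)
  have "hn (x t) \<le> hn (x 0)" if "t \<in> {0..<\<tau>}" for t
    using block_solution_hnorm_le[OF sub, of 0 t] that by auto
  then obtain C where "C-lipschitz_on {0..<\<tau>} x"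
    using block_solution_lipschitz[of "{0..<\<tau>}" x] sub by blast
  then have "uniformly_continuous_on {0..<\<tau>} x" by (rule lipschitz_on_uniformly_continuous)
  moreover have "\<tau> \<in> closure {0..<\<tau>}" using \<tau> by simp
  ultimately obtain l where l: "(x \<longlongrightarrow> l) (at \<tau> within {0..<\<tau>})"
    using uniformly_continuous_on_extension_at_closure by blast
  obtain z where z: "block_solution {0..} z" "z 0 = l" using block_solution_exists by blast
  define w where "w = (\<lambda>t. if t < \<tau> then x t else z (t - \<tau>))"
  have wx: "w t = x t" if "t < \<tau>" for t using that by (simp add: w_def)
  have wz: "w t = z (t - \<tau>)" if "\<tau> \<le> t" for t using that by (simp add: w_def)
  have left: "at t within {0..} = at t within {0..<\<tau>}" if "t < \<tau>" for t
    by (rule at_within_nhd[of _ "{..<\<tau>}"]) (use that in auto)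
  have "continuous_on {0..\<tau>} w"
    unfolding continuous_on_def
  proof
    fix t assume t: "t \<in> {0..\<tau>}"
    show "(w \<longlongrightarrow> w t) (at t within {0..\<tau>})"
    proof (cases "t < \<tau>")
      case True
      have "(x \<longlongrightarrow> x t) (at t within {0..<\<tau>})"
        using sol t True by (auto simp: block_solution_def continuous_on_def)
      then have "(w \<longlongrightarrow> x t) (at t within {0..<\<tau>})"
        by (rule Lim_transform_eventually) (auto simp: eventually_at_filter wx)
      moreover have "at t within {0..\<tau>} = at t within {0..<\<tau>}"
        by (rule at_within_nhd[of _ "{..<\<tau>}"]) (use True in auto)
      ultimately show ?thesis using wx[OF True] by simp
    next
      case False
      then have [simp]: "t = \<tau>" using t by simp
      have "(w \<longlongrightarrow> l) (at \<tau> within {0..<\<tau>})"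
        by (rule Lim_transform_eventually[OF l]) (auto simp: eventually_at_filter wx)
      moreover have "at \<tau> within {0..\<tau>} = at \<tau> within {0..<\<tau>}"
        by (rule at_within_nhd[of _ UNIV]) auto
      ultimately show ?thesis using wz[of \<tau>] z(2) by simp
    qed
  qed
  moreover have "continuous_on {\<tau>..} w"
  proof -
    have "continuous_on {\<tau>..} (\<lambda>t. z (t - \<tau>))"
    proof (rule continuous_on_compose2[where g = z and f = "\<lambda>t. t - \<tau>"])
      show "continuous_on {0..} z" using z(1) by (simp add: block_solution_def)
    qed (auto intro!: continuous_intros)
    then show ?thesis by (rule continuous_on_eq) (simp add: wz)
  qed
  ultimately have "continuous_on ({0..\<tau>} \<union> {\<tau>..}) w"
    by (intro continuous_on_closed_Un) auto
  moreover have "{0..\<tau>} \<union> {\<tau>..} = {0..}" using \<tau> by auto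
  ultimately have contw: "continuous_on {0..} w" by simp
  have less: "(w has_vector_derivative phi (w t)) (at t within {0..})"
    if "t \<in> {0..<\<tau>}" "w t \<noteq> 0" for t
  proof -
    have "(x has_vector_derivative phi (x t)) (at t within {0..<\<tau>})"
      using sol that wx[of t] by (auto simp: block_solution_def)
    then have "(w has_vector_derivative phi (x t)) (at t within {0..<\<tau>})"
      by (rule has_vector_derivative_transform[rotated 2]) (use that wx in auto)
    then show ?thesis using left[of t] wx[of t] that by simp
  qed
  have greater: "(w has_vector_derivative phi (w t)) (at t within {0..})"
    if "\<tau> < t" "w t \<noteq> 0" for t
  proof -
    have "(z has_vector_derivative phi (z (t - \<tau>))) (at (t - \<tau>) within {0..})"
      using z(1) that wz[of t] by (auto simp: block_solution_def)
    then have "(z has_vector_derivative phi (z (t - \<tau>))) (at (t - \<tau>) within (\<lambda>t. t - \<tau>) ` {\<tau>..})"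
      by (rule has_vector_derivative_within_subset) auto
    then have "((z \<circ> (\<lambda>t. t - \<tau>)) has_vector_derivative 1 *\<^sub>R phi (z (t - \<tau>))) (at t within {\<tau>..})"
      by (intro vector_diff_chain_within) (auto intro!: derivative_eq_intros)
    then have "(w has_vector_derivative phi (w t)) (at t within {\<tau>..})"
      using wz[of t] that by (intro has_vector_derivative_transform[of t "{\<tau>..}" w "z \<circ> (\<lambda>t. t - \<tau>)"]) (auto simp: wz)
    moreover have "at t within {0..} = at t within {\<tau>..}"
      by (rule at_within_nhd[of _ "{\<tau><..}"]) (use that \<tau> in auto)
    ultimately show ?thesis by simp
  qed
  \<comment> \<open>Near a nonzero joint the curve avoids the origin, so \<open>phi\<close> is
    continuous along it and the single exceptional point is removable. At a zero joint there is
    nothing to verify.\<close>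
  have joint: "(w has_vector_derivative phi (w \<tau>)) (at \<tau> within {0..})" if "w \<tau> \<noteq> 0"
  proof -
    have "(w \<longlongrightarrow> w \<tau>) (at \<tau> within {0..})" using contw \<tau> by (simp add: continuous_on_def)
    then have "\<forall>\<^sub>F t in at \<tau> within {0..}. w t \<noteq> 0" using that by (rule tendsto_imp_eventually_ne)
    then obtain d where d: "d > 0" "\<And>t. t \<in> {0..} \<Longrightarrow> t \<noteq> \<tau> \<Longrightarrow> dist t \<tau> < d \<Longrightarrow> w t \<noteq> 0"
      by (auto simp: eventually_at)
    define h where "h = min (d / 2) \<tau>"
    have h: "0 < h" "h \<le> \<tau>" "h < d" using d \<tau> by (auto simp: h_def)
    have nz: "w t \<noteq> 0" if "t \<in> {\<tau> - h..\<tau> + h}" for t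
    proof -
      have "\<bar>t - \<tau>\<bar> \<le> h" using that by (simp add: abs_le_iff)
      then show ?thesis using that h d(2)[of t] \<open>w \<tau> \<noteq> 0\<close> by (cases "t = \<tau>") (auto simp: dist_real_def)
    qed
    have cw: "continuous_on {\<tau> - h..\<tau> + h} w"
      by (rule continuous_on_subset[OF contw]) (use h in auto)
    have "(w has_vector_derivative phi (w \<tau>)) (at \<tau> within {\<tau> - h..\<tau> + h})"
    proof (rule has_vector_derivative_removable[where S = "{\<tau>}" and g = "\<lambda>t. phi (w t)"])
      show "continuous_on {\<tau> - h..\<tau> + h} (\<lambda>t. phi (w t))"
        by (rule continuous_on_compose2[OF continuous_on_phi cw]) (use nz in auto)
      fix t assume t: "t \<in> {\<tau> - h<..<\<tau> + h} - {\<tau>}"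
      then have "(w has_vector_derivative phi (w t)) (at t within {0..})"
        using less[of t] greater[of t] nz[of t] h by (cases "t < \<tau>") auto
      moreover have "at t within {0..} = at t"
        using t h by (intro at_within_interior) auto
      ultimately show "(w has_vector_derivative phi (w t)) (at t)" by simp
    qed (use h cw in auto)
    moreover have "at \<tau> within {\<tau> - h..\<tau> + h} = at \<tau>"
      using h by (intro at_within_interior) auto
    ultimately show ?thesis by (auto intro: has_vector_derivative_at_within)
  qed
  have "block_solution {0..} w"
    unfolding block_solution_def
  proof (intro conjI ballI impI contw)
    fix t :: real assume "t \<in> {0..}" "w t \<noteq> 0"
    then show "(w has_vector_derivative phi (w t)) (at t within {0..})"
      using less[of t] greater[of t] joint by (cases t \<tau> rule: linorder_cases) auto
  qed
  then show ?thesis using wx by (intro exI[of _ w]) auto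
qed

end

section \<open>Classical and Filippov solutions\<close>

lemma lipschitz_imp_abs_continuous_on:
  fixes g :: "real \<Rightarrow> 'a::euclidean_space"
  assumes "C-lipschitz_on S g"
  shows "abs_continuous_on S g"
  unfolding abs_continuous_on_def
proof (intro allI impI)
  fix \<epsilon> :: real assume "\<epsilon> > 0"
  have C: "0 \<le> C" using assms by (rule lipschitz_on_nonneg)
  have "(\<Sum>k\<in>D. norm (g (Sup k) - g (Inf k))) < \<epsilon>"
    if D: "D division_of T" and T: "T \<subseteq> S" and sum: "(\<Sum>k\<in>D. measure lborel k) < \<epsilon> / (C + 1)" for D T
  proof -
    have "norm (g (Sup k) - g (Inf k)) \<le> C * measure lborel k" if kD: "k \<in> D" for k
    proof -
      obtain u v where "k = cbox u v" "k \<noteq> {}" "k \<subseteq> T"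
        using division_ofD(2,3,4)[OF D kD] by blast
      then have "k = {u..v}" "u \<le> v" "u \<in> S" "v \<in> S" using T by auto
      then show ?thesis using lipschitz_onD[OF assms, of v u] by (simp add: dist_norm)
    qed
    then have "(\<Sum>k\<in>D. norm (g (Sup k) - g (Inf k))) \<le> C * (\<Sum>k\<in>D. measure lborel k)"
      unfolding sum_distrib_left by (rule sum_mono)
    also have "\<dots> \<le> C * (\<epsilon> / (C + 1))" using C sum by (intro mult_left_mono) auto
    also have "\<dots> < \<epsilon>" using C \<open>\<epsilon> > 0\<close> by (simp add: field_simps)
    finally show ?thesis .
  qed
  then show "\<exists>\<delta>>0. \<forall>D T. D division_of T \<and> T \<subseteq> S \<and> (\<Sum>k\<in>D. measure lborel k) < \<delta> \<longrightarrow>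
      (\<Sum>k\<in>D. norm (g (Sup k) - g (Inf k))) < \<epsilon>"
    using C \<open>\<epsilon> > 0\<close> by (intro exI[of _ "\<epsilon> / (C + 1)"]) auto
qed

lemma abs_continuous_on_diff:
  assumes "abs_continuous_on S f" "abs_continuous_on S g"
  shows "abs_continuous_on S (\<lambda>t. f t - g t)"
  unfolding abs_continuous_on_def
proof (intro allI impI)
  fix \<epsilon> :: real assume "\<epsilon> > 0"
  then have "\<epsilon> / 2 > 0" by simp
  obtain d1 where "d1 > 0"
    and d1: "\<And>D T. D division_of T \<Longrightarrow> T \<subseteq> S \<Longrightarrow> (\<Sum>k\<in>D. measure lborel k) < d1 \<Longrightarrow>
      (\<Sum>k\<in>D. norm (f (Sup k) - f (Inf k))) < \<epsilon> / 2"
    using assms(1) \<open>\<epsilon> / 2 > 0\<close> unfolding abs_continuous_on_def by meson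
  obtain d2 where "d2 > 0"
    and d2: "\<And>D T. D division_of T \<Longrightarrow> T \<subseteq> S \<Longrightarrow> (\<Sum>k\<in>D. measure lborel k) < d2 \<Longrightarrow>
      (\<Sum>k\<in>D. norm (g (Sup k) - g (Inf k))) < \<epsilon> / 2"
    using assms(2) \<open>\<epsilon> / 2 > 0\<close> unfolding abs_continuous_on_def by meson
  have "(\<Sum>k\<in>D. norm (f (Sup k) - g (Sup k) - (f (Inf k) - g (Inf k)))) < \<epsilon>"
    if "D division_of T" "T \<subseteq> S" "(\<Sum>k\<in>D. measure lborel k) < min d1 d2" for D T
  proof -
    have "(\<Sum>k\<in>D. norm (f (Sup k) - g (Sup k) - (f (Inf k) - g (Inf k))))
        \<le> (\<Sum>k\<in>D. norm (f (Sup k) - f (Inf k)) + norm (g (Sup k) - g (Inf k)))"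
      by (intro sum_mono order_trans[OF _ norm_triangle_ineq4]) (simp add: algebra_simps)
    then show ?thesis
      using d1[OF that(1,2)] d2[OF that(1,2)] that(3) by (simp add: sum.distrib)
  qed
  then show "\<exists>\<delta>>0. \<forall>D T. D division_of T \<and> T \<subseteq> S \<and> (\<Sum>k\<in>D. measure lborel k) < \<delta> \<longrightarrow>
      (\<Sum>k\<in>D. norm (f (Sup k) - g (Sup k) - (f (Inf k) - g (Inf k)))) < \<epsilon>"
    using \<open>d1 > 0\<close> \<open>d2 > 0\<close> by (intro exI[of _ "min d1 d2"]) auto
qed

lemma abs_continuous_on_component:
  fixes g :: "real \<Rightarrow> 'a::euclidean_space ^ 'k"
  assumes "abs_continuous_on S g"
  shows "abs_continuous_on S (\<lambda>t. g t $ i)"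
proof -
  have "(\<Sum>k\<in>D. norm (g (Sup k) $ i - g (Inf k) $ i)) \<le> (\<Sum>k\<in>D. norm (g (Sup k) - g (Inf k)))" for D
    by (intro sum_mono) (metis Finite_Cartesian_Product.norm_nth_le vector_minus_component)
  then show ?thesis
    using assms unfolding abs_continuous_on_def by (meson le_less_trans)
qed

lemma abs_continuous_on_subset:
  "abs_continuous_on S g \<Longrightarrow> T \<subseteq> S \<Longrightarrow> abs_continuous_on T g"
  unfolding abs_continuous_on_def by (meson subset_trans)

lemma abs_continuous_on_imp_continuous_on:
  assumes "abs_continuous_on {a..b} g"
  shows "continuous_on {a..b} g"
  unfolding continuous_on_iff
proof (intro ballI allI impI)
  fix t e :: real assume t: "t \<in> {a..b}" and "e > 0"
  then obtain d where "d > 0" and d: "\<And>D T. D division_of T \<Longrightarrow> T \<subseteq> {a..b} \<Longrightarrow>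
      (\<Sum>k\<in>D. measure lborel k) < d \<Longrightarrow> (\<Sum>k\<in>D. norm (g (Sup k) - g (Inf k))) < e"
    using assms unfolding abs_continuous_on_def by meson
  have le: "norm (g v - g u) < e" if "u \<in> {a..b}" "v \<in> {a..b}" "u \<le> v" "v - u < d" for u v
    using d[of "{{u..v}}" "{u..v}"] division_of_self[of u v] that by (auto simp: cbox_interval)
  have "dist (g r) (g t) < e" if "r \<in> {a..b}" "dist r t < d" for r
    using le[of r t] le[of t r] that t
    by (cases "r \<le> t") (auto simp: dist_norm norm_minus_commute abs_if split: if_splits)
  then show "\<exists>d>0. \<forall>r\<in>{a..b}. dist r t < d \<longrightarrow> dist (g r) (g t) < e" using \<open>d > 0\<close> by blast
qed

text \<open>The two shapes of domain on which completeness speaks about solutions.\<close>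

definition time_interval :: "real set \<Rightarrow> bool" where
  "time_interval J \<longleftrightarrow> J = {0..} \<or> (\<exists>\<tau>>0. J = {0..<\<tau>})"

lemma time_interval_cases:
  assumes "time_interval J" "t \<in> J"
  obtains h where "h > 0" "{0..t + h} \<subseteq> J" "0 \<le> t" "J \<subseteq> {0..}"
proof (cases "J = {0..}")
  case True
  then show ?thesis using assms(2) by (intro that[of 1]) auto
next
  case False
  then obtain \<tau> where "J = {0..<\<tau>}" using assms(1) by (auto simp: time_interval_def)
  then show ?thesis using assms(2) by (intro that[of "(\<tau> - t) / 2"]) (auto simp: field_simps)
qed

lemma time_interval_Icc:
  assumes "time_interval J" "a \<in> J" "b \<in> J"
  shows "{a..b} \<subseteq> J"
  using assms unfolding time_interval_def by auto

lemma at_within_time_interval: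
  fixes J :: "real set"
  assumes "{0..t + h} \<subseteq> J" "J \<subseteq> {0..}" "h > 0" "a \<le> t" "0 \<le> a" "a = 0 \<or> a < t" "0 \<le> t"
  shows "at t within J = at t within {a..t + h}"
proof (cases "a = 0")
  case True
  then show ?thesis
    by (intro at_within_nhd[of _ "{..<t + h}"]) (use assms in auto)
next
  case False
  then show ?thesis
    by (intro at_within_nhd[of _ "{a<..<t + h}"]) (use assms in auto)
qed

lemma continuous_on_time_intervalI:
  assumes J: "time_interval J" and cont: "\<And>b. b \<in> J \<Longrightarrow> continuous_on {0..b} f"
  shows "continuous_on J f"
  unfolding continuous_on_eq_continuous_within
proof
  fix t assume "t \<in> J"
  then obtain h where h: "h > 0" "{0..t + h} \<subseteq> J" "0 \<le> t" "J \<subseteq> {0..}"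
    using time_interval_cases[OF J] by blast
  have "t + h \<in> J" using h by (intro subsetD[OF h(2)]) auto
  then have "continuous (at t within {0..t + h}) f"
    using cont[of "t + h"] h by (auto simp: continuous_on_eq_continuous_within)
  then show "continuous (at t within J) f"
    using at_within_time_interval[OF h(2,4,1), of 0] h by simp
qed

context homogeneous_chain
begin

definition field :: "('n, 'N::finite) stacked \<Rightarrow> ('n, 'N) stacked" where
  "field e = (\<chi> i. phi (e $ i))"

text \<open>Continuity of \<open>phi\<close> at a nonzero block traps the nearby values in a closed
  convex cylinder over a small ball, which then contains the closed convex hull. The empty null set
  suffices for this inclusion.\<close>

lemma filippov_field_component:
  assumes y: "y \<in> filippov field (e :: ('n, 'N::finite) stacked)" and nz: "e $ i \<noteq> 0"
  shows "y $ i = phi (e $ i)"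
proof -
  have "dist (y $ i) (phi (e $ i)) \<le> \<epsilon>" if pos: "\<epsilon> > 0" for \<epsilon>
  proof -
    have "isCont phi (e $ i)"
      using continuous_on_phi nz by (auto simp: continuous_on_eq_continuous_at[OF open_Compl[OF closed_singleton]])
    then obtain \<delta> where \<delta>: "\<delta> > 0" "\<And>w. dist w (e $ i) < \<delta> \<Longrightarrow> dist (phi w) (phi (e $ i)) < \<epsilon>"
      using pos unfolding continuous_at_eps_delta by blast
    let ?C = "(\<lambda>p. p $ i) -` cball (phi (e $ i)) \<epsilon> :: ('n, 'N) stacked set"
    have "y \<in> closure (convex hull (field ` (ball e \<delta> - {})))"
      using y \<delta>(1) unfolding filippov_def by blast
    also have "\<dots> \<subseteq> ?C"
    proof (intro closure_minimal hull_minimal)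
      show "field ` (ball e \<delta> - {}) \<subseteq> ?C"
      proof
        fix p assume "p \<in> field ` (ball e \<delta> - {})"
        then obtain w where w: "p = field w" "dist w e < \<delta>" by (auto simp: dist_commute)
        then have "dist (w $ i) (e $ i) < \<delta>" using dist_vec_nth_le[of w i e] by linarith
        then show "p \<in> ?C" using \<delta>(2)[of "w $ i"] w by (simp add: field_def dist_commute)
      qed
      show "convex ?C"
        by (rule convex_linear_vimage[OF bounded_linear.linear[OF bounded_linear_vec_nth] convex_cball])
      show "closed ?C"
        by (rule closed_vimage[OF closed_cball]) (intro continuous_intros)
    qed
    finally show ?thesis by (simp add: dist_commute)
  qed
  then have "dist (y $ i) (phi (e $ i)) \<le> 0" by (rule field_le_epsilon) simp
  then show ?thesis by simp
qed

text \<open>Reflecting the blocks that vanish at \<open>e\<close> averages the odd map \<open>phi\<close> to \<open>0\<close> in these blocks.\<close>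

lemma field_in_filippov: "field e \<in> filippov field (e :: ('n, 'N::finite) stacked)"
  unfolding filippov_def
proof (intro INT_I)
  fix \<delta> :: real and Z :: "('n, 'N) stacked set"
  assume "\<delta> \<in> {0<..}" and "Z \<in> null_sets lebesgue"
  define R where "R = (\<lambda>z :: ('n, 'N) stacked. (\<chi> i. if e $ i = 0 then - z $ i else z $ i))"
  have RR: "R (R z) = z" for z by (simp add: R_def vec_eq_iff)
  have linR: "linear R"
    by (rule linearI) (auto simp: R_def vec_eq_iff)
  have distR: "dist (R z) e = dist z e" for z
    unfolding dist_vec_def R_def by (intro L2_set_cong) (auto simp: dist_norm)
  \<comment> \<open>Both \<open>z\<close> and its reflection must avoid \<open>Z\<close>; the
    reflection is linear, so the union to be avoided is still negligible.\<close>
  have neg: "negligible (Z \<union> R ` Z)"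
    using \<open>Z \<in> null_sets lebesgue\<close> linear_imp_differentiable_on[OF linR]
    by (intro negligible_Un negligible_differentiable_image_negligible[OF order_refl])
      (auto simp: negligible_iff_null_sets)
  define q where "q = (\<lambda>z. (1/2) *\<^sub>R field z + (1/2) *\<^sub>R field (R z))"
  have q: "q z $ i = (if e $ i = 0 then 0 else phi (z $ i))" for z i
    by (simp add: q_def field_def R_def phi_minus flip: scaleR_add_left)
  have "(q \<longlongrightarrow> field e) (nhds e)"
  proof (rule vec_tendstoI)
    fix i
    show "((\<lambda>z. q z $ i) \<longlongrightarrow> field e $ i) (nhds e)"
    proof (cases "e $ i = 0")
      case False
      have "isCont phi (e $ i)"
        using continuous_on_phi False by (auto simp: continuous_on_eq_continuous_at[OF open_Compl[OF closed_singleton]])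
      moreover have "((\<lambda>z. z $ i) \<longlongrightarrow> e $ i) (nhds e)"
        by (rule tendsto_vec_nth) (simp add: filterlim_def)
      ultimately have "((\<lambda>z. phi (z $ i)) \<longlongrightarrow> phi (e $ i)) (nhds e)"
        using isCont_tendsto_compose by blast
      then show ?thesis using False by (simp add: q field_def)
    qed (simp add: q field_def)
  qed
  show "field e \<in> closure (convex hull (field ` (ball e \<delta> - Z)))"
    unfolding closure_approachable
  proof (intro allI impI)
    fix \<epsilon> :: real assume "\<epsilon> > 0"
    then have "\<forall>\<^sub>F z in nhds e. dist (q z) (field e) < \<epsilon>"
      using \<open>(q \<longlongrightarrow> field e) (nhds e)\<close> by (simp add: tendstoD)
    then obtain \<eta> where \<eta>: "\<eta> > 0" "\<And>z. dist z e < \<eta> \<Longrightarrow> dist (q z) (field e) < \<epsilon>"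
      by (auto simp: eventually_nhds_metric)
    \<comment> \<open>A ball has positive measure, hence contains an admissible
      \<open>z\<close>.\<close>
    have "\<not> negligible (ball e (min \<delta> \<eta>))"
    proof -
      have "0 < measure lborel (ball e (min \<delta> \<eta>))"
        using \<open>\<delta> \<in> {0<..}\<close> \<eta>(1) by (intro content_ball_pos) auto
      then show ?thesis using negligible_imp_measure0 by fastforce
    qed
    then obtain z where z: "z \<in> ball e (min \<delta> \<eta>)" "z \<notin> Z \<union> R ` Z"
      using neg negligible_subset by (metis subsetI)
    then have "z \<in> ball e \<delta> - Z" "R z \<in> ball e \<delta> - Z"
      using distR[of z] RR[of z] by (auto simp: dist_commute) (metis imageI)
    then have "q z \<in> convex hull (field ` (ball e \<delta> - Z))"
      unfolding q_def by (intro convexD[OF convex_convex_hull] hull_inc) auto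
    moreover have "dist (q z) (field e) < \<epsilon>" using z \<eta>(2)[of z] by (simp add: dist_commute)
    ultimately show "\<exists>p\<in>convex hull (field ` (ball e \<delta> - Z)). dist p (field e) < \<epsilon>" by blast
  qed
qed

text \<open>At a later zero the block vanishes in a whole neighbourhood within \<open>J\<close>, by
  absorption. So each block contributes at most one exceptional time; if it has no zero, the infimum
  is an arbitrary point.\<close>

lemma block_solution_derivative_off_first_zero:
  assumes sol: "block_solution J x" and J: "time_interval J" and t: "t \<in> J"
    and off: "t \<noteq> Inf {r\<in>J. x r = 0}"
  shows "(x has_vector_derivative phi (x t)) (at t within J)"
proof (cases "x t = 0")
  case True
  have "\<exists>r\<in>J. x r = 0 \<and> r < t"
  proof (rule ccontr)
    assume "\<not> (\<exists>r\<in>J. x r = 0 \<and> r < t)"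
    then have "Inf {r\<in>J. x r = 0} = t"
      using t True by (intro cInf_eq_minimum) (auto simp: not_less)
    then show False using off by simp
  qed
  then obtain r where r: "r \<in> J" "x r = 0" "r < t" by blast
  have zero: "x u = 0" if "u \<in> J" "r \<le> u" for u
    using block_solution_zero_absorbing[OF block_solution_subset[OF sol time_interval_Icc[OF J r(1) that(1)]]]
      that r by simp
  have "((\<lambda>_. 0) has_vector_derivative phi (x t)) (at t within J)" using True by simp
  then show ?thesis
    by (rule has_vector_derivative_transform_within[where d = "t - r"])
      (use r t zero in \<open>auto simp: dist_real_def\<close>)
qed (use sol t in \<open>auto simp: block_solution_def\<close>)

text \<open>For \<open>mu > -1\<close> the integrand of the integral representation is continuous,
  which gives the derivative also at the first zero.\<close>

lemma blocks_imp_classical_solution: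
  fixes e :: "real \<Rightarrow> ('n, 'N::finite) stacked"
  assumes "mu \<noteq> -1" and J: "time_interval J" and sol: "\<And>i. block_solution J (\<lambda>t. e t $ i)"
  shows "classical_solution field J e"
  unfolding classical_solution_def
proof
  fix t assume "t \<in> J"
  then obtain h where h: "h > 0" "{0..t + h} \<subseteq> J" "0 \<le> t" "J \<subseteq> {0..}"
    using time_interval_cases[OF J] by blast
  show "(e has_vector_derivative field (e t)) (at t within J)"
  proof (rule has_vector_derivative_vecI)
    fix i
    let ?x = "\<lambda>t. e t $ i"
    have "(?x has_vector_derivative phi (?x t)) (at t within {0..t + h})"
    proof (rule has_vector_derivative_transform)
      have cont: "continuous_on {0..t + h} (\<lambda>t. phi (?x t))"
        by (rule continuous_on_compose2[OF continuous_on_phi_UNIV[OF assms(1)]])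
          (use sol[of i] h in \<open>auto simp: block_solution_def intro: continuous_on_subset\<close>)
      show "((\<lambda>u. ?x 0 + integral {0..u} (\<lambda>t. phi (?x t))) has_vector_derivative phi (?x t))
          (at t within {0..t + h})"
        using integral_has_vector_derivative[OF cont, of t] h by (auto intro!: derivative_eq_intros)
      show "?x u = ?x 0 + integral {0..u} (\<lambda>t. phi (?x t))" if "u \<in> {0..t + h}" for u
      proof -
        have "{0..u} \<subseteq> J" using h(2) that by (meson atLeastAtMost_iff atLeastatMost_subset_iff order_refl order_trans)
        then show ?thesis
          using integral_unique[OF block_solution_has_integral[OF block_solution_subset[OF sol[of i]], of 0 u]]
            that by simp
      qed
    qed (use h in auto)
    then show "(?x has_vector_derivative field (e t) $ i) (at t within J)"
      using at_within_time_interval[OF h(2,4,1), of 0] h by (simp add: field_def)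
  qed
qed

lemma classical_solution_imp_blocks:
  fixes e :: "real \<Rightarrow> ('n, 'N::finite) stacked"
  assumes "classical_solution field J e"
  shows "block_solution J (\<lambda>t. e t $ i)"
proof -
  have "((\<lambda>t. e t $ i) has_vector_derivative phi (e t $ i)) (at t within J)" if "t \<in> J" for t
    using bounded_linear.has_vector_derivative[OF bounded_linear_vec_nth, of e "field (e t)" _ i] assms that
    by (simp add: classical_solution_def field_def)
  then show ?thesis
    unfolding block_solution_def continuous_on_eq_continuous_within
    by (auto intro: has_vector_derivative_continuous)
qed

lemma blocks_imp_filippov_solution:
  fixes e :: "real \<Rightarrow> ('n, 'N::finite) stacked"
  assumes J: "time_interval J" and sol: "\<And>i. block_solution J (\<lambda>t. e t $ i)"
  shows "filippov_solution field J e"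
  unfolding filippov_solution_def
proof (intro conjI allI impI)
  fix a b :: real assume ab: "{a..b} \<subseteq> J"
  have "\<exists>C. C-lipschitz_on {a..b} (\<lambda>t. e t $ i)" for i
  proof -
    have sub: "block_solution {u..v} (\<lambda>t. e t $ i)" if "u \<in> {a..b}" "v \<in> {a..b}" for u v
      by (rule block_solution_subset[OF sol]) (use that ab in auto)
    have "hn (e t $ i) \<le> hn (e a $ i)" if "t \<in> {a..b}" for t
      using block_solution_hnorm_le[OF sub, of a t] that by auto
    then show ?thesis
      using block_solution_lipschitz[of "{a..b}" "\<lambda>t. e t $ i"] sub by metis
  qed
  then obtain C where C: "\<And>i. (C i)-lipschitz_on {a..b} (\<lambda>t. e t $ i)" by metis
  have "(\<Sum>i\<in>UNIV. C i)-lipschitz_on {a..b} e"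
  proof (rule lipschitz_onI)
    fix u v assume uv: "u \<in> {a..b}" "v \<in> {a..b}"
    have "dist (e u) (e v) \<le> (\<Sum>i\<in>UNIV. dist (e u $ i) (e v $ i))"
      unfolding dist_vec_def by (rule L2_set_le_sum) simp
    also have "\<dots> \<le> (\<Sum>i\<in>UNIV. C i * dist u v)"
      using lipschitz_onD[OF C] uv by (intro sum_mono) auto
    finally show "dist (e u) (e v) \<le> (\<Sum>i\<in>UNIV. C i) * dist u v" by (simp add: sum_distrib_right)
  qed (intro sum_nonneg lipschitz_on_nonneg[OF C])
  then show "abs_continuous_on {a..b} e" by (rule lipschitz_imp_abs_continuous_on)
next
  define S where "S = range (\<lambda>i. Inf {r\<in>J. e r $ i = 0})"
  have "finite S" by (simp add: S_def)
  then have "negligible S" by (rule negligible_finite)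
  show "AE t in lebesgue. t \<in> J \<longrightarrow> (\<exists>y\<in>filippov field (e t). (e has_vector_derivative y) (at t within J))"
  proof (rule AE_I'[of S])
    show "S \<in> null_sets lebesgue" using \<open>negligible S\<close> by (simp add: negligible_iff_null_sets)
    have "(e has_vector_derivative field (e t)) (at t within J)" if "t \<in> J" "t \<notin> S" for t
    proof (rule has_vector_derivative_vecI)
      fix i
      show "((\<lambda>t. e t $ i) has_vector_derivative field (e t) $ i) (at t within J)"
        using block_solution_derivative_off_first_zero[OF sol[of i] J that(1)] that(2)
        by (auto simp: field_def S_def)
    qed
    then show "{t \<in> space lebesgue. \<not> (t \<in> J \<longrightarrow>
        (\<exists>y\<in>filippov field (e t). (e has_vector_derivative y) (at t within J)))} \<subseteq> S"
      using field_in_filippov by blast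
  qed
qed

text \<open>Near a time at which the block is nonzero, the inclusion determines its derivative
  almost everywhere as a continuous function of time. Comparison with the integral of that function,
  by absolute continuity, upgrades this to every time.\<close>

lemma filippov_solution_imp_blocks:
  fixes e :: "real \<Rightarrow> ('n, 'N::finite) stacked"
  assumes J: "time_interval J" and sol: "filippov_solution field J e"
  shows "block_solution J (\<lambda>t. e t $ i)"
proof -
  let ?x = "\<lambda>t. e t $ i"
  have ac: "abs_continuous_on {a..b} e" if "{a..b} \<subseteq> J" for a b
    using sol that by (simp add: filippov_solution_def)
  have "continuous_on J e"
  proof (rule continuous_on_time_intervalI[OF J])
    fix b assume "b \<in> J"
    then show "continuous_on {0..b} e"
      using J time_interval_Icc[OF J, of 0 b]
      by (intro abs_continuous_on_imp_continuous_on ac) (auto simp: time_interval_def)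
  qed
  then have contx: "continuous_on J ?x" by (intro continuous_intros)
  have "(?x has_vector_derivative phi (?x t)) (at t within J)" if t: "t \<in> J" and nz: "?x t \<noteq> 0" for t
  proof -
    obtain h where h: "h > 0" "{0..t + h} \<subseteq> J" "0 \<le> t" "J \<subseteq> {0..}"
      using time_interval_cases[OF J t] by blast
    have "(?x \<longlongrightarrow> ?x t) (at t within J)" using contx t by (simp add: continuous_on_def)
    then have "\<forall>\<^sub>F r in at t within J. ?x r \<noteq> 0" using nz by (rule tendsto_imp_eventually_ne)
    then obtain d where d: "d > 0" "\<And>r. r \<in> J \<Longrightarrow> r \<noteq> t \<Longrightarrow> dist r t < d \<Longrightarrow> ?x r \<noteq> 0"
      by (auto simp: eventually_at)
    define k where "k = min (d / 2) h"
    \<comment> \<open>At the initial time the neighbourhood is one-sided.\<close>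
    define a where "a = max 0 (t - k)"
    define b where "b = t + k"
    have k: "0 < k" "k < d" "k \<le> h" using d(1) h(1) by (auto simp: k_def)
    have a: "0 \<le> a" "a \<le> t" "a = 0 \<or> a < t" "a \<le> b" using k h(3) by (auto simp: a_def b_def)
    have abJ: "{a..b} \<subseteq> J" using h(2) k a by (force simp: b_def)
    have nz: "?x r \<noteq> 0" if "r \<in> {a..b}" for r
    proof -
      have "r \<in> J" using that abJ by blast
      moreover have "dist r t < d" using that k by (auto simp: a_def b_def dist_real_def abs_less_iff)
      ultimately show ?thesis using d(2)[of r] nz by (cases "r = t") auto
    qed
    have contp: "continuous_on {a..b} (\<lambda>r. phi (?x r))"
      by (rule continuous_on_compose2[OF continuous_on_phi continuous_on_subset[OF contx abJ]])
        (use nz in auto)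
    define I where "I = (\<lambda>u. integral {a..u} (\<lambda>r. phi (?x r)))"
    have I': "(I has_vector_derivative phi (?x r)) (at r within {a..b})" if "r \<in> {a..b}" for r
      unfolding I_def by (rule integral_has_vector_derivative[OF contp that])
    have "bounded ((\<lambda>r. phi (?x r)) ` {a..b})"
      using contp by (intro compact_imp_bounded compact_continuous_image) auto
    then obtain C where C: "C > 0" "\<And>r. r \<in> {a..b} \<Longrightarrow> norm (phi (?x r)) \<le> C"
      by (auto simp: bounded_pos)
    \<comment> \<open>This makes \<open>?x - I\<close> absolutely continuous; its derivative
      vanishes almost everywhere, so it is constant.\<close>
    have "C-lipschitz_on {a..b} I"
    proof (rule bounded_derivative_imp_lipschitz)
      show "(I has_derivative (\<lambda>s. s *\<^sub>R phi (?x r))) (at r within {a..b})" if "r \<in> {a..b}" for r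
        using I'[OF that] by (simp add: has_vector_derivative_def)
      show "onorm (\<lambda>s. s *\<^sub>R phi (?x r)) \<le> C" if "r \<in> {a..b}" for r
      proof (rule onorm_bound)
        show "norm (s *\<^sub>R phi (?x r)) \<le> C * norm s" for s
          using mult_left_mono[OF C(2)[OF that], of "\<bar>s\<bar>"] by (simp add: mult.commute)
      qed (use C in simp)
    qed (use C in auto)
    then have acd: "abs_continuous_on {a..b} (\<lambda>r. ?x r - I r)"
      by (intro abs_continuous_on_diff abs_continuous_on_component ac abJ lipschitz_imp_abs_continuous_on)
    have "AE r in lebesgue. r \<in> J \<longrightarrow> (\<exists>y\<in>filippov field (e r). (e has_vector_derivative y) (at r within J))"
      using sol by (simp add: filippov_solution_def)
    then have ae: "AE r in lebesgue. r \<in> {a..b} \<longrightarrow>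
        ((\<lambda>r. ?x r - I r) has_vector_derivative 0) (at r within {a..b})"
    proof (rule eventually_mono, intro impI)
      fix r assume "r \<in> J \<longrightarrow> (\<exists>y\<in>filippov field (e r). (e has_vector_derivative y) (at r within J))"
        and r: "r \<in> {a..b}"
      then obtain y where y: "y \<in> filippov field (e r)" "(e has_vector_derivative y) (at r within J)"
        using abJ by blast
      have "(?x has_vector_derivative y $ i) (at r within J)"
        by (rule bounded_linear.has_vector_derivative[OF bounded_linear_vec_nth y(2)])
      then have "(?x has_vector_derivative phi (?x r)) (at r within {a..b})"
        using filippov_field_component[OF y(1) nz[OF r]] abJ has_vector_derivative_within_subset by metis
      from has_vector_derivative_diff[OF this I'[OF r]]
      show "((\<lambda>r. ?x r - I r) has_vector_derivative 0) (at r within {a..b})" by simp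
    qed
    have xI: "?x u = ?x a + I u" if u: "u \<in> {a..b}" for u
    proof -
      have "(\<lambda>r. ?x r - I r) u = (\<lambda>r. ?x r - I r) a"
      proof (rule abs_continuous_derivative_zero_imp_constant)
        show "abs_continuous_on {a..u} (\<lambda>r. ?x r - I r)"
          by (rule abs_continuous_on_subset[OF acd]) (use u in auto)
        show "AE r in lebesgue. r \<in> {a..u} \<longrightarrow>
            ((\<lambda>r. ?x r - I r) has_vector_derivative 0) (at r within {a..u})"
          using ae by (rule eventually_mono)
            (use u in \<open>auto intro: has_vector_derivative_within_subset\<close>)
      qed (use u in simp)
      then show ?thesis by (simp add: I_def algebra_simps)
    qed
    have "((\<lambda>u. ?x a + I u) has_vector_derivative phi (?x t)) (at t within {a..b})"
      using I'[of t] a k by (auto intro!: derivative_eq_intros simp: b_def)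
    then have "(?x has_vector_derivative phi (?x t)) (at t within {a..b})"
    proof (rule has_vector_derivative_transform[rotated 2])
      show "t \<in> {a..b}" using a k by (simp add: b_def)
    qed (rule xI)
    moreover have "at t within J = at t within {a..t + k}"
      by (rule at_within_time_interval) (use h k a in auto)
    ultimately show ?thesis by (simp add: b_def)
  qed
  then show ?thesis using contx by (simp add: block_solution_def)
qed

lemma error_solution_iff_blocks:
  fixes e :: "real \<Rightarrow> ('n, 'N::finite) stacked"
  assumes "comm_graph E" "time_interval J"
  shows "error_solution E lam mu P J e \<longleftrightarrow> (\<forall>i. block_solution J (\<lambda>t. e t $ i))"
proof -
  have "error_field E lam mu P = (field :: ('n, 'N) stacked \<Rightarrow> _)"
    by (simp add: fun_eq_iff error_field_eq[OF assms(1)] field_def phi_def)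
  then show ?thesis
    unfolding error_solution_def
    using blocks_imp_filippov_solution[OF assms(2)] filippov_solution_imp_blocks[OF assms(2)]
      blocks_imp_classical_solution[OF _ assms(2)] classical_solution_imp_blocks
    by (cases "mu = -1") auto
qed

end

section \<open>Stability and invariance\<close>

lemma H_mat_nonneg_iff:
  fixes y :: "'n::{finite,linorder} colvec"
  shows "0 \<le> H_mat lam *v y \<longleftrightarrow> (\<forall>k<CARD('n). chain_row lam k \<bullet> y \<le> 0)"
proof -
  have nth: "(H_mat lam *v y) $ j = h_row lam (position j) \<bullet> y" for j
    by (simp add: H_mat_def matrix_vector_mult_def inner_vec_def)
  show ?thesis
  proof
    assume nn: "0 \<le> H_mat lam *v y"
    show "\<forall>k<CARD('n). chain_row lam k \<bullet> y \<le> 0"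
    proof (intro allI impI)
      fix k assume "k < CARD('n)"
      then obtain j :: 'n where "position j = Suc k"
        using position_surj[of "Suc k", where 'n='n] by auto
      then show "chain_row lam k \<bullet> y \<le> 0"
        using nn nth[of j] by (auto simp: less_eq_vec_def h_row_eq dest: spec[of _ j])
    qed
  next
    assume le: "\<forall>k<CARD('n). chain_row lam k \<bullet> y \<le> 0"
    have "0 \<le> h_row lam (position j) \<bullet> y" for j :: 'n
    proof -
      obtain k where "position j = Suc k" "k < CARD('n)"
        using position_bounds[of j] by (cases "position j") auto
      then show ?thesis using le by (simp add: h_row_eq)
    qed
    then show "0 \<le> H_mat lam *v y" by (simp add: less_eq_vec_def nth)
  qed
qed

lemma Omega_lin_iff:
  fixes e :: "('n::{finite,linorder}, 'N::finite) stacked"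
  shows "e \<in> Omega_lin lam \<longleftrightarrow> (\<forall>i. \<forall>k<CARD('n). chain_row lam k \<bullet> e $ i \<le> 0)"
proof -
  have "e \<in> Omega_lin lam \<longleftrightarrow> (\<forall>i. 0 \<le> H_mat lam *v e $ i)"
    by (simp add: Omega_lin_def block_diag_def less_eq_vec_def[where x=0])
  then show ?thesis by (simp add: H_mat_nonneg_iff)
qed

lemma Sigma_set_iff: "e \<in> Sigma_set \<longleftrightarrow> (\<forall>i. eta1 \<bullet> e $ i \<le> 0)"
  by (simp add: Sigma_set_def less_eq_vec_def)

text \<open>A dilation scales the first coordinate by a positive factor, so a sign condition on the
  projection passes to the point itself.\<close>

lemma eta1_inner_dil:
  fixes x :: "'n::{finite,linorder} colvec"
  shows "eta1 \<bullet> (dil mu s *v x) \<le> 0 \<longleftrightarrow> eta1 \<bullet> x \<le> 0"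
proof -
  obtain i :: 'n where i: "position i = 1" using position_surj[of 1, where 'n='n] by force
  then show ?thesis unfolding eta1_eq_axis[OF i] by (simp add: inner_axis' dil_nth mult_le_0_iff)
qed

context homogeneous_chain
begin

lemma Omega_hom_iff:
  fixes e :: "('n, 'N::finite) stacked"
  shows "e \<in> Omega_hom lam mu P \<longleftrightarrow> (\<forall>i. e $ i \<in> cone)"
proof -
  have "e \<in> Omega_hom lam mu P \<longleftrightarrow> (\<forall>i. 0 \<le> H_mat lam *v proj (e $ i))"
    by (simp add: Omega_hom_def block_diag_def proj_def less_eq_vec_def[where x=0] matrix_vector_mul_assoc)
  then show ?thesis by (simp add: H_mat_nonneg_iff cone_def)
qed

lemma cone_dil: "x \<in> cone \<Longrightarrow> dl s *v x \<in> cone"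
  by (cases "x = 0") (auto simp: cone_def proj_dil)

lemma cone_eta1:
  assumes "x \<in> cone"
  shows "eta1 \<bullet> x \<le> 0"
proof -
  have "eta1 \<bullet> proj x \<le> 0" using assms by (auto simp: cone_def chain_row_0[of lam, symmetric])
  then show ?thesis unfolding proj_def eta1_inner_dil .
qed

text \<open>In the unit ball of \<open>P\<close> the homogeneous norm is at most 1, so projecting
  means dilating by a nonnegative parameter, and expanding dilations preserve the orthant.\<close>

lemma orthant_ball_subset_cone:
  assumes "\<And>k. k < CARD('n) \<Longrightarrow> chain_row lam k \<bullet> x \<le> 0" "pnorm P x \<le> 1"
  shows "x \<in> cone"
proof (cases "x = 0")
  case False
  have "Q x \<le> 1" using assms(2) by (simp add: pnorm_def Q_def)
  then have "hn x \<le> 1" using hnorm_greater_iff[of 1 x] by simp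
  then have "0 \<le> - ln (hn x)" using hnorm_pos[OF False] by simp
  then show ?thesis
    using dil_preserves_chain_orthant[OF assms(1)] by (simp add: cone_def proj_def)
qed (simp add: cone_def proj_def)

context
  fixes E :: "('N::finite option \<times> 'N option) set"
  assumes graph: "comm_graph E"
begin

abbreviation "sol \<equiv> error_solution E lam mu P :: real set \<Rightarrow> (real \<Rightarrow> ('n, 'N) stacked) \<Rightarrow> bool"

lemma sol_iff: "sol {0..} e \<longleftrightarrow> (\<forall>i. block_solution {0..} (\<lambda>t. e t $ i))"
  by (rule error_solution_iff_blocks[OF graph]) (simp add: time_interval_def)

lemma sol_Icc: "sol {0..} e \<Longrightarrow> 0 \<le> a \<Longrightarrow> block_solution {a..b} (\<lambda>t. e t $ i)"
  unfolding sol_iff by (rule block_solution_subset) auto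

lemma forward_complete_error: "forward_complete sol"
  unfolding forward_complete_def
proof (intro conjI allI impI)
  fix e0 :: "('n, 'N) stacked"
  have "\<exists>x. block_solution {0..} x \<and> x 0 = e0 $ i" for i
    by (rule block_solution_exists)
  then obtain x where x: "\<And>i. block_solution {0..} (x i)" "\<And>i. x i 0 = e0 $ i" by metis
  show "\<exists>e. sol {0..} e \<and> e 0 = e0"
    by (rule exI[of _ "\<lambda>t. \<chi> i. x i t"]) (simp add: sol_iff x)
next
  fix \<tau> :: real and e assume "0 < \<tau>" "sol {0..<\<tau>} e"
  then have "block_solution {0..<\<tau>} (\<lambda>t. e t $ i)" for i
    using error_solution_iff_blocks[OF graph, of "{0..<\<tau>}" e] by (auto simp: time_interval_def)
  then have "\<exists>x. block_solution {0..} x \<and> (\<forall>t\<in>{0..<\<tau>}. x t = e t $ i)" for i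
    using \<open>0 < \<tau>\<close> by (intro block_solution_extend)
  then obtain x where x: "\<And>i. block_solution {0..} (x i)" "\<And>i t. t \<in> {0..<\<tau>} \<Longrightarrow> x i t = e t $ i"
    by metis
  show "\<exists>e'. sol {0..} e' \<and> (\<forall>t\<in>{0..<\<tau>}. e' t = e t)"
    by (rule exI[of _ "\<lambda>t. \<chi> i. x i t"]) (simp add: sol_iff x vec_eq_iff)
qed

lemma lyapunov_stable_error: "lyapunov_stable sol"
  unfolding lyapunov_stable_def
proof (intro allI impI)
  fix \<epsilon> :: real assume "\<epsilon> > 0"
  obtain Y where Y: "Y > 0" "\<And>x. hn x \<le> 1 \<Longrightarrow> norm x \<le> Y * hn x" using norm_le_hnorm by blast
  \<comment> \<open>The bound 1 admits the linear estimate of the norm; the other makes the sum over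
    all blocks at most \<epsilon>/2.\<close>
  define b where "b = min 1 (\<epsilon> / (2 * Y * CARD('N)))"
  have b: "0 < b" "b \<le> 1" "Y * b * CARD('N) < \<epsilon>"
  proof -
    have "Y * b * CARD('N) \<le> Y * (\<epsilon> / (2 * Y * CARD('N))) * CARD('N)"
      using Y(1) by (intro mult_right_mono mult_left_mono) (auto simp: b_def)
    also have "\<dots> < \<epsilon>" using Y(1) \<open>\<epsilon> > 0\<close> by simp
    finally show "Y * b * CARD('N) < \<epsilon>" .
  qed (use Y(1) \<open>\<epsilon> > 0\<close> in \<open>auto simp: b_def\<close>)
  obtain \<delta> where \<delta>: "\<delta> > 0" "\<And>x. norm x < \<delta> \<Longrightarrow> hn x < b"
  proof -
    obtain \<delta> where "\<delta> > 0" "\<And>x. dist x 0 < \<delta> \<Longrightarrow> dist (hn x) (hn 0) < b"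
      using isCont_hnorm[of 0] b(1) unfolding continuous_at_eps_delta by blast
    then show ?thesis by (intro that[of \<delta>]) (auto simp: dist_real_def abs_less_iff)
  qed
  have "norm (e t) < \<epsilon>" if e: "sol {0..} e" "norm (e 0) < \<delta>" and t: "0 \<le> t" for e t
  proof -
    have le: "norm (e t $ i) \<le> Y * b" for i
    proof -
      have "norm (e 0 $ i) < \<delta>" using e(2) Finite_Cartesian_Product.norm_nth_le[of "e 0" i] by linarith
      then have "hn (e t $ i) < b"
        using block_solution_hnorm_le[OF sol_Icc[OF e(1)], of 0 t i] t \<delta>(2)[of "e 0 $ i"] by simp
      then have "norm (e t $ i) \<le> Y * hn (e t $ i)" "hn (e t $ i) \<le> b" using b(2) by (auto intro: Y(2))
      then show ?thesis using Y(1) by (meson mult_left_mono less_imp_le order_trans)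
    qed
    have "norm (e t) \<le> (\<Sum>i\<in>UNIV. norm (e t $ i))"
      unfolding norm_vec_def by (rule L2_set_le_sum) simp
    also have "\<dots> \<le> (\<Sum>i\<in>(UNIV :: 'N set). Y * b)" by (intro sum_mono le)
    also have "\<dots> < \<epsilon>" using b(3) by (simp add: mult.commute)
    finally show ?thesis .
  qed
  then show "\<exists>\<delta>>0. \<forall>e. sol {0..} e \<and> norm (e 0) < \<delta> \<longrightarrow> (\<forall>t\<ge>0. norm (e t) < \<epsilon>)"
    using \<delta>(1) by blast
qed

lemma globally_finite_time_stable_error: "globally_finite_time_stable sol"
  unfolding globally_finite_time_stable_def
proof (intro conjI forward_complete_error lyapunov_stable_error)
  obtain \<kappa> where \<kappa>: "0 < \<kappa>" "\<And>x a b. block_solution {a..b} x \<Longrightarrow> a \<le> b \<Longrightarrow>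
      hn (x b) powr (- mu) \<le> max 0 (hn (x a) powr (- mu) - \<kappa> * (b - a))"
    using block_solution_decay by blast
  \<comment> \<open>Block \<open>i\<close> settles within
    \<open>hn (e $ i) powr (- mu) / \<kappa>\<close>; the sum over the blocks dominates each of
    these times.\<close>
  define T where "T = (\<lambda>e :: ('n, 'N) stacked. (\<Sum>i\<in>UNIV. hn (e $ i) powr (- mu)) / \<kappa>)"
  have T0: "0 \<le> T e" for e unfolding T_def using \<kappa>(1) by (intro divide_nonneg_pos sum_nonneg) auto
  have "e t = 0" if e: "sol {0..} e" and t: "T (e 0) \<le> t" for e t
  proof -
    have "e t $ i = 0" for i
    proof -
      have t0: "0 \<le> t" using T0[of "e 0"] t by linarith
      have "hn (e 0 $ i) powr (- mu) \<le> (\<Sum>i\<in>UNIV. hn (e 0 $ i) powr (- mu))"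
        by (rule member_le_sum) auto
      also have "\<dots> = \<kappa> * T (e 0)" using \<kappa>(1) by (simp add: T_def)
      also have "\<dots> \<le> \<kappa> * (t - 0)" using \<kappa>(1) t by simp
      finally have "hn (e t $ i) powr (- mu) \<le> 0"
        using \<kappa>(2)[OF sol_Icc[OF e] t0, of i] by simp
      then have "hn (e t $ i) powr (- mu) = 0" by (intro antisym) auto
      then show ?thesis by simp
    qed
    then show ?thesis by (simp add: vec_eq_iff)
  qed
  then show "\<exists>T. (\<forall>x. 0 \<le> T x) \<and> (\<forall>e. sol {0..} e \<longrightarrow> (\<forall>t\<ge>T (e 0). e t = 0))"
    using T0 by blast
qed

lemma Omega_hom_invariant:
  "strictly_positively_invariant sol (Omega_hom lam mu P)"
  unfolding strictly_positively_invariant_def Omega_hom_iff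
  using block_solution_cone_invariant[OF sol_Icc] by blast

end

end

theorem theorem3:
  fixes E :: "('N::finite option \<times> 'N option) set"
    and lam mu :: real
    and P :: "'n::{finite,linorder} sqmat"
  assumes graph: "comm_graph E"
    and lam: "0 < lam"
    and mu: "-1 \<le> mu" "mu < 0"
    and P_pos: "positive_definite P"
    and P_mono: "positive_definite (P ** G_mat mu + G_mat mu ** P)"
    and P_lyap: "negative_definite (P ** (A_mat - BK_mat lam) + transpose (A_mat - BK_mat lam) ** P)"
  shows "(Omega_lin lam :: ('n, 'N) stacked set) \<subseteq> Sigma_set
    \<and> globally_finite_time_stable
        (error_solution E lam mu P :: real set \<Rightarrow> (real \<Rightarrow> ('n, 'N) stacked) \<Rightarrow> bool)
    \<and> homogeneous_cone mu (Omega_hom lam mu P :: ('n, 'N) stacked set)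
    \<and> strictly_positively_invariant (error_solution E lam mu P)
        (Omega_hom lam mu P :: ('n, 'N) stacked set)
    \<and> (Omega_hom lam mu P :: ('n, 'N) stacked set) \<subseteq> Sigma_set
    \<and> (\<forall>e0 :: ('n, 'N) stacked. e0 \<in> Omega_lin lam \<and> (\<forall>i. pnorm P (e0 $ i) \<le> 1)
          \<longrightarrow> e0 \<in> Omega_hom lam mu P)"
proof -
  interpret homogeneous_chain lam mu P
    by unfold_locales (fact lam mu P_pos P_mono P_lyap)+
  have "homogeneous_cone mu (Omega_hom lam mu P :: ('n, 'N) stacked set)"
    unfolding homogeneous_cone_def
  proof (intro conjI ballI allI)
    have "(0 :: ('n, 'N) stacked) \<in> Omega_hom lam mu P"
      by (simp add: Omega_hom_iff cone_def proj_def)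
    then show "(Omega_hom lam mu P :: ('n, 'N) stacked set) \<noteq> {}" by blast
  qed (simp add: Omega_hom_iff block_diag_def cone_dil)
  moreover have "(Omega_lin lam :: ('n, 'N) stacked set) \<subseteq> Sigma_set"
    by (auto simp: Omega_lin_iff Sigma_set_iff chain_row_0[of lam, symmetric])
  moreover have "(Omega_hom lam mu P :: ('n, 'N) stacked set) \<subseteq> Sigma_set"
    by (auto simp: Omega_hom_iff Sigma_set_iff cone_eta1)
  ultimately show ?thesis
    using globally_finite_time_stable_error[OF graph] Omega_hom_invariant[OF graph] orthant_ball_subset_cone
    by (simp add: Omega_hom_iff Omega_lin_iff)
qed

end
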